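(* Let $\gamma:\mathbb{R}\to[0,\infty)$ be a continuous function with compact support. For each $n\ge 1$, let the initial configuration $\Psi$ of quantum random walks be chosen according to the measure $\Theta^n_\gamma$, and let $\eta^\Psi_m(k)$ denote the number of independent quantum random walks (driven by the Hadamard coin, started from the configuration $\Psi$) observed at site $k\in\mathbb{Z}$ at time $m\in\mathbb{N}$. Then, for every $t>0$ and every continuous function $G:\mathbb{R}\to\mathbb{R}$ with compact support, $$\lim_{n\to\infty}\frac1n\sum_{k\in\mathbb{Z}}G\Big(\frac kn\Big)\,\eta^\Psi_{\lfloor tn\rfloor}(k)=\int_{\mathbb{R}}G(x)\,\rho(t,x)\,dx\qquad\text{in probability,}$$ where $$\rho(t,x)=(\gamma*f_t)(x)=\int_{\mathbb{R}}\gamma(y)\,\frac1t f\Big(\frac{x-y}{t}\Big)\,dy,\qquad f_t(x)=\frac1t f\Big(\frac xt\Big),$$ and $f:\mathbb{R}\to[0,\infty)$ is the probability density $$f(x)=\begin{cases}\dfrac{1}{\pi(1-x^2)\sqrt{1-2x^2}}, & x\in\big(-\tfrac{\sqrt2}{2},\tfrac{\sqrt2}{2}\big),\\[2mm] 0,&\text{otherwise.}\end{cases}$$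
   Context: $\mathbb{N}=\{0,1,2,\dots\}$, and $\lfloor y\rfloor$ is the greatest integer less than or equal to $y$. State space. Let $\ell^2(\mathbb{Z})$ be the complex Hilbert space of square-summable doubly infinite sequences, with canonical orthonormal basis $\{e_k\}_{k\in\mathbb{Z}}$, and let $\{|{-1}\rangle,|{+1}\rangle\}$ be the canonical orthonormal basis of $\mathbb{C}^2$. The state space is the Hilbert space tensor product $\ell^2(\mathbb{Z})\otimes\mathbb{C}^2$. Dynamics. The Hadamard operator $H$ on $\mathbb{C}^2$ is the linear map with $H|{+1}\rangle=\frac{1}{\sqrt2}(|{+1}\rangle+|{-1}\rangle)$ and $H|{-1}\rangle=\frac{1}{\sqrt2}(|{+1}\rangle-|{-1}\rangle)$. The shift $S$ on $\ell^2(\mathbb{Z})\otimes\mathbb{C}^2$ is the bounded linear operator with $S(e_k\otimes|{+1}\rangle)=e_{k+1}\otimes|{+1}\rangle$ and $S(e_k\otimes|{-1}\rangle)=e_{k-1}\otimes|{-1}\rangle$ for all $k\in\mathbb{Z}$. Put $U=S\circ(\mathrm{Id}\otimes H)$, with $\mathrm{Id}$ the identity on $\ell^2(\mathbb{Z})$, and let $U^{(n)}$ be its $n$-fold iterate. Observed position. For a unit vector $\psi\in\ell^2(\mathbb{Z})\otimes\mathbb{C}^2$, write $U^{(n)}(\psi)=\big(\sum_k x^n_ke_k\big)\otimes|{+1}\rangle+\big(\sum_k y^n_ke_k\big)\otimes|{-1}\rangle$. Then $X^\psi_n$ denotes an integer-valued random variable with $\mathbb{P}(X^\psi_n=k)=|x^n_k|^2+|y^n_k|^2$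 for $k\in\mathbb{Z}$ (the position observed at time $n$ of a quantum random walk started from $\psi$). Systems of independent walks. A configuration of quantum random walks is a function $\Psi:\ell^2(\mathbb{Z})\otimes\mathbb{C}^2\to\mathbb{N}$, where $\Psi(\psi)$ is the number of walks in state $\psi$; only configurations with $\Psi(\psi)=0$ for all but finitely many $\psi$ are considered. Given $\Psi$, for each state $\psi$ let $X^\psi_n(1),\dots,X^\psi_n(\Psi(\psi))$ be copies of $X^\psi_n$, all of these (over all $\psi$ and all indices) being independent, and define $$\eta^\Psi_n(k)=\sum_{\psi}\sum_{j=1}^{\Psi(\psi)}\mathbf{1}[X^\psi_n(j)=k],\qquad k\in\mathbb{Z}.$$ Initial measure. $\Theta^n_\gamma$ is the product measure on $\mathbb{N}^{\ell^2(\mathbb{Z})\otimes\mathbb{C}^2}$ (that is, the numbers $\Psi(\psi)$ are independent over $\psi$) under which $\Psi(\psi)$ has distribution Poisson$\big(\frac12\gamma(\frac kn)\big)$ if $\psi=e_k\otimes|{+1}\rangle$ or $\psi=e_k\otimes|{-1}\rangle$ with $k\in\mathbb{Z}$, and $\Psi(\psi)=0$ almost surely for every other $\psi$. Here Poisson$(0)$ is the point mass at $0$. Convergence in probability is with respect to the joint law of $\Psi$ (chosen from $\Theta^n_\gamma$) and of the observed positions. *)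

theory Defs
  imports "HOL-Probability.Probability"
begin

section \<open>Square-summable families\<close>

lemma summable_on_inner:
  fixes f g :: "'i \<Rightarrow> 'v::real_inner"
  assumes "(\<lambda>i. (norm (f i))\<^sup>2) summable_on UNIV" "(\<lambda>i. (norm (g i))\<^sup>2) summable_on UNIV"
  shows "(\<lambda>i. inner (f i) (g i)) summable_on UNIV"
proof -
  have sm: "(\<lambda>i. (norm (f i))\<^sup>2 + (norm (g i))\<^sup>2) summable_on UNIV"
    by (intro summable_on_add assms)
  have bd: "norm (inner (f i) (g i)) \<le> (norm (f i))\<^sup>2 + (norm (g i))\<^sup>2" for i
  proof -
    have "norm (inner (f i) (g i)) \<le> norm (f i) * norm (g i)"
      using Cauchy_Schwarz_ineq2[of "f i" "g i"] by simp
    also have "2 * (norm (f i) * norm (g i)) \<le> (norm (f i))\<^sup>2 + (norm (g i))\<^sup>2"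
      using sum_squares_bound[of "norm (f i)" "norm (g i)"] by (simp add: mult.assoc)
    then have "norm (f i) * norm (g i) \<le> (norm (f i))\<^sup>2 + (norm (g i))\<^sup>2"
      using mult_nonneg_nonneg[OF norm_ge_zero[of "f i"] norm_ge_zero[of "g i"]] by linarith
    finally show ?thesis .
  qed
  have "(\<lambda>i. norm (inner (f i) (g i))) summable_on UNIV"
    by (rule Infinite_Sum.abs_summable_on_comparison_test'[OF sm]) (use bd in auto)
  then show ?thesis by (rule abs_summable_summable)
qed

lemma square_summable_add:
  fixes f g :: "'i \<Rightarrow> 'v::real_inner"
  assumes "(\<lambda>i. (norm (f i))\<^sup>2) summable_on UNIV" "(\<lambda>i. (norm (g i))\<^sup>2) summable_on UNIV"
  shows "(\<lambda>i. (norm (f i + g i))\<^sup>2) summable_on UNIV"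
proof -
  have "(\<lambda>i. (norm (f i))\<^sup>2 + (norm (g i))\<^sup>2 + 2 * inner (f i) (g i)) summable_on UNIV"
    by (intro summable_on_add summable_on_cmult_right summable_on_inner assms)
  then show ?thesis
    by (simp add: power2_norm_eq_inner inner_add_left inner_add_right inner_commute algebra_simps)
qed

lemma square_summable_scaleR:
  fixes f :: "'i \<Rightarrow> 'v::real_inner"
  assumes "(\<lambda>i. (norm (f i))\<^sup>2) summable_on UNIV"
  shows "(\<lambda>i. (norm (r *\<^sub>R f i))\<^sup>2) summable_on UNIV"
  using summable_on_cmult_right[OF assms, of "r\<^sup>2"] by (simp add: power_mult_distrib)

text \<open>
  \<open>(int, complex) ell2\<close> is the space \<open>\<ell>\<^sup>2(\<int>)\<close>.  The values may lie in any inner product space, so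
  that the tensor product \<open>\<ell>\<^sup>2(\<int>) \<otimes> \<complex>\<^sup>2\<close> can be realised as \<open>\<ell>\<^sup>2(\<int>; \<complex>\<^sup>2)\<close>.
\<close>

typedef (overloaded) ('i, 'v) ell2 =
  "{f :: 'i \<Rightarrow> 'v::real_inner. (\<lambda>i. (norm (f i))\<^sup>2) summable_on UNIV}"
  morphisms coord Abs_ell2
  by (rule exI[of _ "\<lambda>_. 0"]) simp

setup_lifting type_definition_ell2

lemma square_summable_coord: "(\<lambda>i. (norm (coord x i))\<^sup>2) summable_on UNIV"
  using coord[of x] by simp

lemma ell2_eqI: "(\<And>i. coord x i = coord y i) \<Longrightarrow> x = y"
  by (metis coord_inject ext)

instantiation ell2 :: (type, real_inner) real_vector
begin

lift_definition zero_ell2 :: "('a, 'b) ell2" is "\<lambda>_. 0" by simp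

lift_definition plus_ell2 :: "('a, 'b) ell2 \<Rightarrow> ('a, 'b) ell2 \<Rightarrow> ('a, 'b) ell2"
  is "\<lambda>f g i. f i + g i" by (rule square_summable_add)

lift_definition uminus_ell2 :: "('a, 'b) ell2 \<Rightarrow> ('a, 'b) ell2" is "\<lambda>f i. - f i" by simp

lift_definition minus_ell2 :: "('a, 'b) ell2 \<Rightarrow> ('a, 'b) ell2 \<Rightarrow> ('a, 'b) ell2"
  is "\<lambda>f g i. f i - g i"
  by (simp only: diff_conv_add_uminus, rule square_summable_add) auto

lift_definition scaleR_ell2 :: "real \<Rightarrow> ('a, 'b) ell2 \<Rightarrow> ('a, 'b) ell2"
  is "\<lambda>r f i. r *\<^sub>R f i" by (rule square_summable_scaleR)

instance
proof
  fix x y z :: "('a, 'b) ell2" and r s :: real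
  show "x + y + z = x + (y + z)" by transfer (simp add: add.assoc)
  show "x + y = y + x" by transfer (simp add: add.commute)
  show "0 + x = x" by transfer simp
  show "- x + x = 0" by transfer simp
  show "x - y = x + - y" by transfer simp
  show "r *\<^sub>R (x + y) = r *\<^sub>R x + r *\<^sub>R y" by transfer (simp add: scaleR_right_distrib)
  show "(r + s) *\<^sub>R x = r *\<^sub>R x + s *\<^sub>R x" by transfer (simp add: scaleR_left_distrib)
  show "r *\<^sub>R s *\<^sub>R x = (r * s) *\<^sub>R x" by transfer simp
  show "1 *\<^sub>R x = x" by transfer simp
qed

end

instantiation ell2 :: (type, real_inner) real_inner
begin

lift_definition inner_ell2 :: "('a, 'b) ell2 \<Rightarrow> ('a, 'b) ell2 \<Rightarrow> real"
  is "\<lambda>f g. \<Sum>\<^sub>\<infinity>i. inner (f i) (g i)" .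

definition norm_ell2 :: "('a, 'b) ell2 \<Rightarrow> real" where
  "norm_ell2 x = sqrt (inner x x)"

definition sgn_ell2 :: "('a, 'b) ell2 \<Rightarrow> ('a, 'b) ell2" where
  "sgn_ell2 x = x /\<^sub>R norm x"

definition dist_ell2 :: "('a, 'b) ell2 \<Rightarrow> ('a, 'b) ell2 \<Rightarrow> real" where
  "dist_ell2 x y = norm (x - y)"

definition uniformity_ell2 :: "(('a, 'b) ell2 \<times> ('a, 'b) ell2) filter" where
  "uniformity_ell2 = (INF e\<in>{0<..}. principal {(x, y). dist x y < e})"

definition open_ell2 :: "('a, 'b) ell2 set \<Rightarrow> bool" where
  "open_ell2 U \<longleftrightarrow> (\<forall>x\<in>U. \<forall>\<^sub>F (x', y) in uniformity. x' = x \<longrightarrow> y \<in> U)"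

instance
proof
  fix x y z :: "('a, 'b) ell2" and r :: real
  show "sgn x = x /\<^sub>R norm x" by (rule sgn_ell2_def)
  show "dist x y = norm (x - y)" by (rule dist_ell2_def)
  show "uniformity = (INF e\<in>{0<..}. principal {(x, y :: ('a, 'b) ell2). dist x y < e})"
    by (rule uniformity_ell2_def)
  show "open U = (\<forall>x\<in>U. \<forall>\<^sub>F (x', y) in uniformity. x' = x \<longrightarrow> y \<in> U)"
    for U :: "('a, 'b) ell2 set" by (rule open_ell2_def)
  show "inner x y = inner y x" by transfer (simp add: inner_commute)
  show "inner (x + y) z = inner x z + inner y z"
    by transfer (simp add: inner_add_left infsum_add summable_on_inner)
  show "inner (r *\<^sub>R x) y = r * inner x y"
    by transfer (simp add: infsum_cmult_right')
  show "0 \<le> inner x x" by transfer (simp add: infsum_nonneg)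
  show "inner x x = 0 \<longleftrightarrow> x = 0"
  proof
    assume "inner x x = 0"
    then have 0: "(\<Sum>\<^sub>\<infinity>i. inner (coord x i) (coord x i)) = 0" by (simp add: inner_ell2.rep_eq)
    have "inner (coord x i) (coord x i) = 0" for i
      by (rule nonneg_infsum_le_0D[where A = UNIV])
         (use 0 summable_on_inner[OF square_summable_coord square_summable_coord] in auto)
    then show "x = 0" by (intro ell2_eqI) (simp add: zero_ell2.rep_eq)
  qed (transfer, simp)
  show "norm x = sqrt (inner x x)" by (rule norm_ell2_def)
qed

end

lemma coord_0 [simp]: "coord 0 i = 0"
  and coord_add [simp]: "coord (x + y) i = coord x i + coord y i"
  and coord_uminus [simp]: "coord (- x) i = - coord x i"
  and coord_diff [simp]: "coord (x - y) i = coord x i - coord y i"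
  and coord_scaleR [simp]: "coord (r *\<^sub>R x) i = r *\<^sub>R coord x i"
  by (simp_all add: zero_ell2.rep_eq plus_ell2.rep_eq uminus_ell2.rep_eq minus_ell2.rep_eq
      scaleR_ell2.rep_eq)

lemma coord_sum: "coord (sum g F) i = (\<Sum>j\<in>F. coord (g j) i)"
  by (induction F rule: infinite_finite_induct) auto

lemma norm_ell2_square: "(norm x)\<^sup>2 = (\<Sum>\<^sub>\<infinity>i. (norm (coord x i))\<^sup>2)"
  by (simp add: power2_norm_eq_inner inner_ell2.rep_eq)

lift_definition single :: "'i \<Rightarrow> 'v \<Rightarrow> ('i, 'v::real_inner) ell2"
  is "\<lambda>k v i. if i = k then v else 0"
proof -
  fix k :: 'i and v :: 'v
  have "finite {i. (norm (if i = k then v else 0))\<^sup>2 \<noteq> 0}"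
    by (rule finite_subset[of _ "{k}"]) auto
  then show "(\<lambda>i. (norm (if i = k then v else 0))\<^sup>2) summable_on UNIV"
    by (intro finite_nonzero_values_imp_summable_on) simp
qed

lemma has_sum_single: "((\<lambda>k. single k (coord x k)) has_sum x) UNIV"
proof -
  let ?F = "finite_subsets_at_top UNIV"
  let ?S = "\<lambda>F. \<Sum>k\<in>F. single k (coord x k)"
  have eq: "(norm (?S F - x))\<^sup>2 = (norm x)\<^sup>2 - (\<Sum>i\<in>F. (norm (coord x i))\<^sup>2)" if "finite F" for F
  proof -
    have c: "coord (?S F - x) i = (if i \<in> F then 0 else - coord x i)" for i
      using that by (simp add: coord_sum single.rep_eq sum.delta)
    have "(norm (?S F - x))\<^sup>2 = (\<Sum>\<^sub>\<infinity>i. if i \<in> F then 0 else (norm (coord x i))\<^sup>2)"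
      unfolding norm_ell2_square c by (intro infsum_cong) auto
    also have "\<dots> = (\<Sum>\<^sub>\<infinity>i\<in>UNIV - F. (norm (coord x i))\<^sup>2)"
      by (rule infsum_cong_neutral) auto
    also have "\<dots> = (norm x)\<^sup>2 - (\<Sum>i\<in>F. (norm (coord x i))\<^sup>2)"
      unfolding norm_ell2_square using that
      by (subst infsum_Diff[OF square_summable_coord]) auto
    finally show ?thesis .
  qed
  have "(sum (\<lambda>i. (norm (coord x i))\<^sup>2) \<longlongrightarrow> (norm x)\<^sup>2) ?F"
    using has_sum_infsum[OF square_summable_coord[of x]]
    by (simp add: has_sum_def norm_ell2_square)
  then have "((\<lambda>F. (norm x)\<^sup>2 - (\<Sum>i\<in>F. (norm (coord x i))\<^sup>2)) \<longlongrightarrow> (norm x)\<^sup>2 - (norm x)\<^sup>2) ?F"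
    by (intro tendsto_intros)
  moreover have "\<forall>\<^sub>F F in ?F. (norm (?S F - x))\<^sup>2 = (norm x)\<^sup>2 - (\<Sum>i\<in>F. (norm (coord x i))\<^sup>2)"
    by (rule eventually_finite_subsets_at_top_weakI) (rule eq)
  ultimately have "((\<lambda>F. (norm (?S F - x))\<^sup>2) \<longlongrightarrow> 0) ?F"
    by (simp add: tendsto_cong)
  then have "((\<lambda>F. sqrt ((norm (?S F - x))\<^sup>2)) \<longlongrightarrow> sqrt 0) ?F"
    by (rule tendsto_real_sqrt)
  then have "((\<lambda>F. ?S F - x) \<longlongrightarrow> 0) ?F"
    by (intro tendsto_norm_zero_cancel[of "\<lambda>F. ?S F - x"]) simp
  then show ?thesis
    unfolding has_sum_def using LIM_zero_cancel by blast
qed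


section \<open>State space\<close>

datatype coin = Plus | Minus

instance coin :: finite
proof
  have "(UNIV :: coin set) = {Plus, Minus}" by (auto intro: coin.exhaust)
  then show "finite (UNIV :: coin set)" by (metis finite.emptyI finite.insertI)
qed

lemma UNIV_coin: "(UNIV :: coin set) = {Plus, Minus}"
  by (auto intro: coin.exhaust)

definition ket :: "coin \<Rightarrow> complex ^ coin" where
  "ket c = axis c 1"

definition site :: "int \<Rightarrow> (int, complex) ell2" where
  "site k = single k 1"

type_synonym state = "(int, complex ^ coin) ell2"

lemma norm_vector_smult: "norm (c *s v) = cmod c * norm v" for v :: "complex ^ 'n"
  by (simp add: norm_vec_def vector_scalar_mult_def norm_mult L2_set_right_distrib)

lift_definition tensor :: "(int, complex) ell2 \<Rightarrow> complex ^ coin \<Rightarrow> state"  (infixr "\<otimes>" 75)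
  is "\<lambda>a v k. a k *s v"
  by (simp add: norm_vector_smult power_mult_distrib summable_on_cmult_left)

lift_definition cscale :: "complex \<Rightarrow> state \<Rightarrow> state" is "\<lambda>c a k. c *s a k"
  by (simp add: norm_vector_smult power_mult_distrib summable_on_cmult_right)

text \<open>The sequences \<open>x\<close>, \<open>y\<close> with \<open>\<psi> = x \<otimes> |+1\<rangle> + y \<otimes> |-1\<rangle>\<close>; see \<open>state_decomposition\<close>.\<close>

lift_definition component :: "coin \<Rightarrow> state \<Rightarrow> (int, complex) ell2" is "\<lambda>c a k. a k $ c"
proof -
  fix c and f :: "int \<Rightarrow> complex ^ coin"
  assume "(\<lambda>i. (norm (f i))\<^sup>2) summable_on UNIV"
  then show "(\<lambda>i. (norm (f i $ c))\<^sup>2) summable_on UNIV"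
    by (rule summable_on_comparison_test) (auto intro: power_mono Finite_Cartesian_Product.norm_nth_le)
qed

lemma state_decomposition: "\<psi> = component Plus \<psi> \<otimes> ket Plus + component Minus \<psi> \<otimes> ket Minus"
proof (rule ell2_eqI)
  fix k
  show "coord \<psi> k = coord (component Plus \<psi> \<otimes> ket Plus + component Minus \<psi> \<otimes> ket Minus) k"
    unfolding vec_eq_iff
  proof
    fix c
    show "coord \<psi> k $ c
      = coord (component Plus \<psi> \<otimes> ket Plus + component Minus \<psi> \<otimes> ket Minus) k $ c"
      by (cases c) (simp_all add: tensor.rep_eq component.rep_eq ket_def axis_def)
  qed
qed

lemma state_decomposition_unique:
  assumes "\<psi> = x \<otimes> ket Plus + y \<otimes> ket Minus"
  shows "x = component Plus \<psi>" "y = component Minus \<psi>"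
  by (auto intro!: ell2_eqI simp: assms component.rep_eq tensor.rep_eq ket_def axis_def)

lemma vec_coin_eq_iff: "v = w \<longleftrightarrow> v $ Plus = w $ Plus \<and> v $ Minus = w $ Minus"
  unfolding vec_eq_iff by (metis coin.exhaust)

lemma norm_coin_square: "(norm v)\<^sup>2 = (cmod (v $ Plus))\<^sup>2 + (cmod (v $ Minus))\<^sup>2"
  by (simp add: norm_vec_def L2_set_def UNIV_coin)

lemma norm_state_square: "(norm (x \<otimes> ket Plus + y \<otimes> ket Minus))\<^sup>2 = (norm x)\<^sup>2 + (norm y)\<^sup>2"
proof -
  have "(norm (x \<otimes> ket Plus + y \<otimes> ket Minus))\<^sup>2
      = (\<Sum>\<^sub>\<infinity>k. (cmod (coord x k))\<^sup>2 + (cmod (coord y k))\<^sup>2)"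
    by (simp add: norm_ell2_square norm_coin_square tensor.rep_eq ket_def axis_def)
  also have "\<dots> = (norm x)\<^sup>2 + (norm y)\<^sup>2"
    by (simp add: norm_ell2_square infsum_add square_summable_coord)
  finally show ?thesis .
qed

definition bounded_clinear :: "(state \<Rightarrow> state) \<Rightarrow> bool" where
  "bounded_clinear T \<longleftrightarrow> bounded_linear T \<and> (\<forall>c \<psi>. T (cscale c \<psi>) = cscale c (T \<psi>))"

lemma bounded_clinear_eqI:
  assumes S: "bounded_clinear S" and T: "bounded_clinear T"
    and eq: "\<And>k c. S (site k \<otimes> ket c) = T (site k \<otimes> ket c)"
  shows "S = T"
proof
  fix \<psi>
  have blS: "bounded_linear S" and blT: "bounded_linear T"
    using S T by (auto simp: bounded_clinear_def)
  have single: "S (single k v) = T (single k v)" for k v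
  proof -
    have "single k v = cscale (v $ Plus) (site k \<otimes> ket Plus) + cscale (v $ Minus) (site k \<otimes> ket Minus)"
    proof (rule ell2_eqI)
      fix i
      show "coord (single k v) i = coord (cscale (v $ Plus) (site k \<otimes> ket Plus)
        + cscale (v $ Minus) (site k \<otimes> ket Minus)) i"
        unfolding vec_eq_iff
      proof
        fix c
        show "coord (single k v) i $ c = coord (cscale (v $ Plus) (site k \<otimes> ket Plus)
          + cscale (v $ Minus) (site k \<otimes> ket Minus)) i $ c"
          by (cases c)
             (simp_all add: single.rep_eq cscale.rep_eq tensor.rep_eq site_def ket_def axis_def)
      qed
    qed
    then show ?thesis
      using S T eq
      by (simp add: bounded_clinear_def linear_add[OF bounded_linear.linear[OF blS]]
          linear_add[OF bounded_linear.linear[OF blT]])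
  qed
  have "((\<lambda>k. S (single k (coord \<psi> k))) has_sum S \<psi>) UNIV"
    by (rule has_sum_bounded_linear[OF blS has_sum_single])
  moreover have "((\<lambda>k. T (single k (coord \<psi> k))) has_sum T \<psi>) UNIV"
    by (rule has_sum_bounded_linear[OF blT has_sum_single])
  ultimately show "S \<psi> = T \<psi>"
    unfolding single using has_sum_unique by blast
qed

lemma site_tensor_ket_inject: "site k \<otimes> ket c = site l \<otimes> ket d \<longleftrightarrow> k = l \<and> c = d"
proof
  assume eq: "site k \<otimes> ket c = site l \<otimes> ket d"
  have "coord (site l \<otimes> ket d) k $ c = 1"
    by (subst eq[symmetric]) (simp add: tensor.rep_eq site_def single.rep_eq ket_def)
  then show "k = l \<and> c = d"
    by (auto simp: tensor.rep_eq site_def single.rep_eq ket_def axis_def split: if_splits)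
qed simp


section \<open>Dynamics\<close>

definition hadamard :: "complex ^ coin \<Rightarrow> complex ^ coin" where
  "hadamard = (THE H. Vector_Spaces.linear (*s) (*s) H
     \<and> H (ket Plus) = complex_of_real (1 / sqrt 2) *s (ket Plus + ket Minus)
     \<and> H (ket Minus) = complex_of_real (1 / sqrt 2) *s (ket Plus - ket Minus))"

definition walk_shift :: "state \<Rightarrow> state" where
  "walk_shift = (THE S. bounded_clinear S
     \<and> (\<forall>k. S (site k \<otimes> ket Plus) = site (k + 1) \<otimes> ket Plus)
     \<and> (\<forall>k. S (site k \<otimes> ket Minus) = site (k - 1) \<otimes> ket Minus))"

definition op_tensor ::
  "((int, complex) ell2 \<Rightarrow> (int, complex) ell2) \<Rightarrow> (complex ^ coin \<Rightarrow> complex ^ coin) \<Rightarrow> state \<Rightarrow> state"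
  where "op_tensor A B = (THE T. bounded_clinear T \<and> (\<forall>a v. T (a \<otimes> v) = A a \<otimes> B v))"

definition walk_step :: "state \<Rightarrow> state" where
  "walk_step = walk_shift \<circ> op_tensor id hadamard"

text \<open>The descriptions above determine unique operators, acting on coordinates as follows.\<close>

lemma hadamard_ex1:
  fixes P defines "P \<equiv> (\<lambda>H. Vector_Spaces.linear (*s) (*s) H
     \<and> H (ket Plus) = complex_of_real (1 / sqrt 2) *s (ket Plus + ket Minus)
     \<and> H (ket Minus) = complex_of_real (1 / sqrt 2) *s (ket Plus - ket Minus))"
  shows "\<exists>!H. P H"
    and "P hadamard"
    and hadamard_nth: "hadamard v $ Plus = complex_of_real (1 / sqrt 2) * (v $ Plus + v $ Minus)"
      "hadamard v $ Minus = complex_of_real (1 / sqrt 2) * (v $ Plus - v $ Minus)"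
proof -
  define h where "h = complex_of_real (1 / sqrt 2)"
  define H0 :: "complex ^ coin \<Rightarrow> complex ^ coin" where
    "H0 v = (\<chi> c. h * (case c of Plus \<Rightarrow> v $ Plus + v $ Minus | Minus \<Rightarrow> v $ Plus - v $ Minus))" for v
  have lin: "Vector_Spaces.linear (*s) (*s) H0"
    by unfold_locales (auto simp: H0_def vec_eq_iff algebra_simps split: coin.splits)
  have P0: "P H0"
    using lin unfolding P_def h_def[symmetric]
    by (simp add: H0_def ket_def vec_coin_eq_iff axis_def)
  have uniq: "H = H0" if "P H" for H
  proof
    fix v :: "complex ^ coin"
    have v: "v = (v $ Plus) *s ket Plus + (v $ Minus) *s ket Minus"
      unfolding vec_eq_iff
    proof
      fix c show "v $ c = ((v $ Plus) *s ket Plus + (v $ Minus) *s ket Minus) $ c"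
        by (cases c) (simp_all add: ket_def axis_def)
    qed
    interpret H: Vector_Spaces.linear "(*s)" "(*s)" H using that by (simp add: P_def)
    interpret H0: Vector_Spaces.linear "(*s)" "(*s)" H0 by (rule lin)
    have "H (ket Plus) = H0 (ket Plus)" "H (ket Minus) = H0 (ket Minus)"
      using that P0 by (simp_all add: P_def)
    then show "H v = H0 v"
      by (subst (1 2) v) (simp add: H.add H0.add H.scale H0.scale)
  qed
  show ex1: "\<exists>!H. P H" using P0 uniq by blast
  show "P hadamard" using theI'[OF ex1] unfolding hadamard_def P_def .
  then have "hadamard v = H0 v" by (rule uniq[THEN fun_cong])
  then show "hadamard v $ Plus = complex_of_real (1 / sqrt 2) * (v $ Plus + v $ Minus)"
      "hadamard v $ Minus = complex_of_real (1 / sqrt 2) * (v $ Plus - v $ Minus)"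
    by (simp_all only: H0_def h_def vec_lambda_beta coin.case)
qed

lemma norm_hadamard: "norm (hadamard v) = norm v"
proof -
  have c: "(cmod (complex_of_real (1 / sqrt 2)))\<^sup>2 = 1 / 2"
    by (simp add: norm_divide power_divide)
  have "(cmod (a + b))\<^sup>2 + (cmod (a - b))\<^sup>2 = 2 * ((cmod a)\<^sup>2 + (cmod b)\<^sup>2)" for a b :: complex
    unfolding cmod_power2 by (simp add: power2_eq_square algebra_simps)
  note par = this[of "v $ Plus" "v $ Minus"]
  have "(norm (hadamard v))\<^sup>2 = (norm v)\<^sup>2"
    unfolding norm_coin_square hadamard_nth norm_mult power_mult_distrib c
      distrib_left[symmetric] par by simp
  then show ?thesis by (simp add: power2_eq_iff_nonneg)
qed

lemma id_tensor_hadamard_ex1: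
  fixes P defines "P \<equiv> (\<lambda>T. bounded_clinear T \<and> (\<forall>a v. T (a \<otimes> v) = id a \<otimes> hadamard v))"
  shows "\<exists>!T. P T"
    and "P (op_tensor id hadamard)"
    and coord_id_tensor_hadamard: "coord (op_tensor id hadamard \<psi>) k = hadamard (coord \<psi> k)"
proof -
  define T0 :: "state \<Rightarrow> state" where "T0 \<psi> = Abs_ell2 (\<lambda>k. hadamard (coord \<psi> k))" for \<psi>
  have T0: "coord (T0 \<psi>) k = hadamard (coord \<psi> k)" for \<psi> k
    unfolding T0_def using square_summable_coord[of \<psi>]
    by (subst Abs_ell2_inverse) (simp_all add: norm_hadamard)
  interpret H: Vector_Spaces.linear "(*s)" "(*s)" hadamard
    using hadamard_ex1(2) by simp
  have scaleR: "r *\<^sub>R v = complex_of_real r *s v" for r and v :: "complex ^ coin"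
    by (simp add: vec_eq_iff scaleR_conv_of_real[where 'a = complex])
  have bl: "bounded_linear T0"
  proof (rule bounded_linear_intro[where K = 1])
    show "T0 (x + y) = T0 x + T0 y" for x y
      by (rule ell2_eqI) (simp add: T0 H.add)
    show "T0 (r *\<^sub>R x) = r *\<^sub>R T0 x" for r x
      by (rule ell2_eqI) (simp add: T0 scaleR H.scale)
    show "norm (T0 x) \<le> norm x * 1" for x
    proof -
      have "(norm (T0 x))\<^sup>2 = (norm x)\<^sup>2"
        by (simp add: norm_ell2_square T0 norm_hadamard)
      then show ?thesis by (simp add: power2_eq_iff_nonneg)
    qed
  qed
  have P0: "P T0"
    unfolding P_def bounded_clinear_def
    by (auto intro!: bl ell2_eqI simp: T0 cscale.rep_eq tensor.rep_eq H.scale)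
  have uniq: "T = T0" if "P T" for T
    using that P0 by (intro bounded_clinear_eqI) (auto simp: P_def)
  show ex1: "\<exists>!T. P T" using P0 uniq by blast
  show "P (op_tensor id hadamard)" using theI'[OF ex1] unfolding op_tensor_def P_def .
  then have "op_tensor id hadamard = T0" by (rule uniq)
  then show "coord (op_tensor id hadamard \<psi>) k = hadamard (coord \<psi> k)" by (simp add: T0)
qed

lemma walk_shift_ex1:
  fixes P defines "P \<equiv> (\<lambda>S. bounded_clinear S
     \<and> (\<forall>k. S (site k \<otimes> ket Plus) = site (k + 1) \<otimes> ket Plus)
     \<and> (\<forall>k. S (site k \<otimes> ket Minus) = site (k - 1) \<otimes> ket Minus))"
  shows "\<exists>!S. P S"
    and "P walk_shift"
    and coord_walk_shift: "coord (walk_shift \<psi>) k $ Plus = coord \<psi> (k - 1) $ Plus"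
      "coord (walk_shift \<psi>) k $ Minus = coord \<psi> (k + 1) $ Minus"
proof -
  define s :: "state \<Rightarrow> int \<Rightarrow> complex ^ coin" where
    "s \<psi> k = (\<chi> c. case c of Plus \<Rightarrow> coord \<psi> (k - 1) $ Plus | Minus \<Rightarrow> coord \<psi> (k + 1) $ Minus)" for \<psi> k
  have bij: "bij (\<lambda>k::int. k - 1)" "bij (\<lambda>k::int. k + 1)"
    by (rule bij_betwI[where g = "\<lambda>k. k + 1"], auto)
       (rule bij_betwI[where g = "\<lambda>k. k - 1"], auto)
  have sq: "(norm (s \<psi> k))\<^sup>2 = (cmod (coord (component Plus \<psi>) (k - 1)))\<^sup>2
      + (cmod (coord (component Minus \<psi>) (k + 1)))\<^sup>2" for \<psi> k
    by (simp add: norm_coin_square s_def component.rep_eq)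
  have sm: "(\<lambda>k. (cmod (coord (component Plus \<psi>) (k - 1)))\<^sup>2) summable_on UNIV"
      "(\<lambda>k. (cmod (coord (component Minus \<psi>) (k + 1)))\<^sup>2) summable_on UNIV" for \<psi>
    using summable_on_reindex_bij_betw[OF bij(1), of "\<lambda>k. (cmod (coord (component Plus \<psi>) k))\<^sup>2"]
      summable_on_reindex_bij_betw[OF bij(2), of "\<lambda>k. (cmod (coord (component Minus \<psi>) k))\<^sup>2"]
      square_summable_coord by simp_all
  define S0 :: "state \<Rightarrow> state" where "S0 \<psi> = Abs_ell2 (s \<psi>)" for \<psi>
  have S0: "coord (S0 \<psi>) k = s \<psi> k" for \<psi> k
    unfolding S0_def using sm[of \<psi>]
    by (subst Abs_ell2_inverse) (simp_all add: sq summable_on_add)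
  have bl: "bounded_linear S0"
  proof (rule bounded_linear_intro[where K = 1])
    show "S0 (x + y) = S0 x + S0 y" for x y
      by (rule ell2_eqI) (auto simp: S0 s_def vec_eq_iff split: coin.splits)
    show "S0 (r *\<^sub>R x) = r *\<^sub>R S0 x" for r x
      by (rule ell2_eqI) (auto simp: S0 s_def vec_eq_iff split: coin.splits)
    show "norm (S0 x) \<le> norm x * 1" for x
    proof -
      have "(norm (S0 x))\<^sup>2 = (norm (component Plus x))\<^sup>2 + (norm (component Minus x))\<^sup>2"
        unfolding norm_ell2_square[of "S0 x"] S0 sq infsum_add[OF sm]
        using infsum_reindex_bij_betw[OF bij(1), of "\<lambda>k. (cmod (coord (component Plus x) k))\<^sup>2"]
          infsum_reindex_bij_betw[OF bij(2), of "\<lambda>k. (cmod (coord (component Minus x) k))\<^sup>2"]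
        by (simp add: norm_ell2_square)
      also have "\<dots> = (norm x)\<^sup>2"
        by (subst state_decomposition[of x]) (rule norm_state_square[symmetric])
      finally show ?thesis by (simp add: power2_eq_iff_nonneg)
    qed
  qed
  have P0: "P S0"
    unfolding P_def bounded_clinear_def
    by (auto intro!: bl ell2_eqI simp: S0 s_def cscale.rep_eq tensor.rep_eq site_def single.rep_eq
        ket_def vec_eq_iff axis_def split: coin.splits)
  have uniq: "S = S0" if "P S" for S
  proof (rule bounded_clinear_eqI)
    show "S (site k \<otimes> ket c) = S0 (site k \<otimes> ket c)" for k c
      using that P0 by (cases c) (simp_all add: P_def)
  qed (use that P0 in \<open>auto simp: P_def\<close>)
  show ex1: "\<exists>!S. P S" using P0 uniq by blast
  show "P walk_shift" using theI'[OF ex1] unfolding walk_shift_def P_def .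
  then have "walk_shift \<psi> = S0 \<psi>" by (rule uniq[THEN fun_cong])
  then show "coord (walk_shift \<psi>) k $ Plus = coord \<psi> (k - 1) $ Plus"
      "coord (walk_shift \<psi>) k $ Minus = coord \<psi> (k + 1) $ Minus"
    by (simp_all add: S0 s_def)
qed


section \<open>Systems of independent walks\<close>

definition detection_prob :: "nat \<Rightarrow> state \<Rightarrow> int \<Rightarrow> real" where
  "detection_prob m \<psi> k =
     (cmod (coord (component Plus ((walk_step ^^ m) \<psi>)) k))\<^sup>2
     + (cmod (coord (component Minus ((walk_step ^^ m) \<psi>)) k))\<^sup>2"

type_synonym config = "state \<Rightarrow> nat"

definition poisson_law :: "real \<Rightarrow> nat pmf" where
  "poisson_law r = (if r = 0 then return_pmf 0 else poisson_pmf r)"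

definition basis_states :: "state set" where
  "basis_states = {site k \<otimes> ket c | k c. True}"

definition initial_rate :: "(real \<Rightarrow> real) \<Rightarrow> nat \<Rightarrow> state \<Rightarrow> real" where
  "initial_rate \<gamma> n \<psi> =
     (if \<psi> \<in> basis_states
      then 1 / 2 * \<gamma> (real_of_int (THE k. \<exists>c. \<psi> = site k \<otimes> ket c) / real n) else 0)"

lemma initial_rate_basis: "initial_rate \<gamma> n (site k \<otimes> ket c) = 1 / 2 * \<gamma> (real_of_int k / real n)"
proof -
  have "(THE l. \<exists>d. site k \<otimes> ket c = site l \<otimes> ket d) = k"
    by (rule the_equality) (auto simp: site_tensor_ket_inject)
  then show ?thesis by (auto simp: initial_rate_def basis_states_def)
qed

definition initial_measure :: "(real \<Rightarrow> real) \<Rightarrow> nat \<Rightarrow> config measure" where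
  "initial_measure \<gamma> n = (\<Pi>\<^sub>M \<psi>\<in>UNIV. measure_pmf (poisson_law (initial_rate \<gamma> n \<psi>)))"

text \<open>
  \<open>\<Psi>\<close> is a random finitely supported configuration with law \<open>initial_measure \<gamma> n\<close>.  There are
  uncountably many states, and the law on the product \<open>\<sigma>\<close>-algebra only yields \<open>\<Psi>(\<psi>) = 0\<close> almost
  surely for each single state \<open>\<psi>\<close> outside the basis.  The occupation numbers sum over all \<open>\<psi>\<close>,
  so the exceptional null set is required to be the same for all these \<open>\<psi>\<close>.
\<close>

definition initial_configuration ::
  "'w measure \<Rightarrow> (real \<Rightarrow> real) \<Rightarrow> nat \<Rightarrow> ('w \<Rightarrow> config) \<Rightarrow> bool" where
  "initial_configuration M \<gamma> n \<Psi> \<longleftrightarrow>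
     (\<forall>\<omega>\<in>space M. finite {\<psi>. \<Psi> \<omega> \<psi> \<noteq> 0}) \<and>
     \<Psi> \<in> measurable M (\<Pi>\<^sub>M \<psi>\<in>UNIV. count_space UNIV) \<and>
     distr M (\<Pi>\<^sub>M \<psi>\<in>UNIV. count_space UNIV) \<Psi> = initial_measure \<gamma> n \<and>
     (AE \<omega> in M. \<forall>\<psi>. \<psi> \<notin> basis_states \<longrightarrow> \<Psi> \<omega> \<psi> = 0)"

text \<open>
  \<open>X \<psi> j\<close> is the position at time \<open>m\<close> of the \<open>j\<close>-th walk started from \<open>\<psi>\<close>.  It is available for
  all \<open>j \<ge> 1\<close>, and the whole array is independent of \<open>\<Psi>\<close>; only the entries with \<open>j \<le> \<Psi> \<psi>\<close> are
  counted, and given \<open>\<Psi>\<close> these are independent with the prescribed laws.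
\<close>

definition observed_positions ::
  "'w measure \<Rightarrow> nat \<Rightarrow> ('w \<Rightarrow> config) \<Rightarrow> (state \<Rightarrow> nat \<Rightarrow> 'w \<Rightarrow> int) \<Rightarrow> bool" where
  "observed_positions M m \<Psi> X \<longleftrightarrow>
     (let I = {\<psi>. norm \<psi> = 1} \<times> {1..} in
       prob_space.indep_vars M (\<lambda>_. count_space UNIV) (\<lambda>(\<psi>, j). X \<psi> j) I \<and>
       (\<forall>(\<psi>, j)\<in>I. \<forall>k. \<P>(\<omega> in M. X \<psi> j \<omega> = k) = detection_prob m \<psi> k) \<and>
       prob_space.indep_set M
         (sets (vimage_algebra (space M) \<Psi> (\<Pi>\<^sub>M \<psi>\<in>UNIV. count_space UNIV)))
         (sets (vimage_algebra (space M) (\<lambda>\<omega>. restrict (\<lambda>(\<psi>, j). X \<psi> j \<omega>) I)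
           (\<Pi>\<^sub>M i\<in>I. count_space UNIV))))"

definition occupation :: "config \<Rightarrow> (state \<Rightarrow> nat \<Rightarrow> int) \<Rightarrow> int \<Rightarrow> nat" where
  "occupation \<Phi> x k = (\<Sum>\<psi> | \<Phi> \<psi> \<noteq> 0. \<Sum>j = 1..\<Phi> \<psi>. of_bool (x \<psi> j = k))"

text \<open>
  The completion is needed because \<open>occupation\<close> depends on uncountably many coordinates of the
  configuration on a null set.  Measurability is required explicitly, as \<^const>\<open>measure\<close> is \<open>0\<close>
  on non-measurable sets.
\<close>

definition converges_in_probability ::
  "(nat \<Rightarrow> 'w measure) \<Rightarrow> (nat \<Rightarrow> 'w \<Rightarrow> real) \<Rightarrow> real \<Rightarrow> bool" where
  "converges_in_probability M Z c \<longleftrightarrow>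
     (\<forall>\<^sub>F n in sequentially. Z n \<in> borel_measurable (completion (M n))) \<and>
     (\<forall>\<epsilon>>0. (\<lambda>n. measure (completion (M n)) {\<omega> \<in> space (M n). \<bar>Z n \<omega> - c\<bar> > \<epsilon>}) \<longlonglongrightarrow> 0)"


section \<open>Limiting density\<close>

definition walk_density :: "real \<Rightarrow> real" where
  "walk_density x =
     (if x \<in> {- (sqrt 2 / 2)<..<sqrt 2 / 2} then 1 / (pi * (1 - x\<^sup>2) * sqrt (1 - 2 * x\<^sup>2)) else 0)"

lemma walk_density_nonneg: "0 \<le> walk_density x"
  and walk_density_integral: "integrable lborel walk_density" "(LBINT x. walk_density x) = 1"
proof -
  define c :: real where "c = sqrt 2 / 2"
  have c: "0 < c" "c\<^sup>2 = 1 / 2" by (auto simp: c_def power_divide)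
  have bd: "x\<^sup>2 < 1 / 2" if "- c < x" "x < c" for x
  proof -
    have "\<bar>x\<bar> < \<bar>c\<bar>" using that c(1) by auto
    then show ?thesis using c(2) by (metis power2_abs abs_ge_zero power_strict_mono zero_less_numeral)
  qed
  define g where "g x = 1 / (pi * (1 - x\<^sup>2) * sqrt (1 - 2 * x\<^sup>2))" for x :: real
  define A where "A x = arctan (x / sqrt (1 - 2 * x\<^sup>2)) / pi" for x :: real
  have g_nonneg: "0 \<le> g x" if "- c < x" "x < c" for x
    using bd[OF that] by (simp add: g_def)
  have wd: "walk_density x = indicator {-c<..<c} x *\<^sub>R g x" for x
    by (auto simp: walk_density_def g_def c_def indicator_def)
  show "0 \<le> walk_density x"
    unfolding wd using g_nonneg[of x] by (auto simp: indicator_def)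
  have der: "(A has_real_derivative g x) (at x)" if "- c < x" "x < c" for x
  proof -
    define w where "w = sqrt (1 - 2 * x\<^sup>2)"
    have p: "0 < 1 - 2 * x\<^sup>2" using bd[OF that] by simp
    have w: "0 < w" "w\<^sup>2 = 1 - 2 * x\<^sup>2" using p by (auto simp: w_def)
    have x1: "1 - x\<^sup>2 \<noteq> 0" using bd[OF that] by simp
    have ws: "((\<lambda>x. sqrt (1 - 2 * x\<^sup>2)) has_real_derivative (- (2 * x) / w)) (at x)"
      using p by (auto intro!: derivative_eq_intros simp: w_def field_simps)
    have "((\<lambda>x. x / sqrt (1 - 2 * x\<^sup>2)) has_real_derivative
        (1 * w - x * (- (2 * x) / w)) / (w * w)) (at x)"
      using w(1) unfolding w_def by (intro DERIV_divide DERIV_ident ws[unfolded w_def]) auto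
    also have "(1 * w - x * (- (2 * x) / w)) / (w * w) = (w\<^sup>2 + 2 * x\<^sup>2) / (w\<^sup>2 * w)"
      using w(1) by (simp add: field_simps power2_eq_square)
    also have "\<dots> = 1 / (w\<^sup>2 * w)" by (simp add: w(2))
    finally have d: "((\<lambda>x. x / sqrt (1 - 2 * x\<^sup>2)) has_real_derivative 1 / (w\<^sup>2 * w)) (at x)" .
    have "(A has_real_derivative (1 / (w\<^sup>2 * w) * inverse (1 + (x / w)\<^sup>2)) / pi) (at x)"
      unfolding A_def using DERIV_chain2[OF DERIV_arctan d] 
      by (intro DERIV_cdivide) (simp add: w_def mult.commute)
    also have "(1 / (w\<^sup>2 * w) * inverse (1 + (x / w)\<^sup>2)) / pi = 1 / (pi * (w\<^sup>2 + x\<^sup>2) * w)"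
      using w(1) by (simp add: power_divide divide_simps)
    also have "w\<^sup>2 + x\<^sup>2 = 1 - x\<^sup>2" by (simp add: w(2))
    finally show ?thesis by (simp add: g_def w_def)
  qed
  have cont: "isCont g x" if "- c < x" "x < c" for x
  proof -
    have "1 - x\<^sup>2 \<noteq> 0" "1 - 2 * x\<^sup>2 \<noteq> 0" using bd[OF that] by auto
    then show ?thesis unfolding g_def by (intro continuous_intros) auto
  qed
  have w0: "((\<lambda>x. 1 - 2 * x\<^sup>2) \<longlongrightarrow> 0) (at a within S)" if "a\<^sup>2 = 1 / 2" for a :: real and S
    by (rule tendsto_eq_intros refl | simp add: that)+
  have lim_c: "(A \<longlongrightarrow> 1 / 2) (at_left c)"
  proof -
    have pos: "eventually (\<lambda>x. 0 < sqrt (1 - 2 * x\<^sup>2)) (at_left c)"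
      using eventually_at_left_real[of "- c" c] c(1)
      by (auto elim!: eventually_mono dest!: bd)
    have "((\<lambda>x. sqrt (1 - 2 * x\<^sup>2)) \<longlongrightarrow> 0) (at_left c)"
      using tendsto_real_sqrt[OF w0[OF c(2)]] by simp
    then have "filterlim (\<lambda>x. x / sqrt (1 - 2 * x\<^sup>2)) at_top (at_left c)"
      using pos c(1) by (intro LIM_at_top_divide[where a = c]) (auto intro!: tendsto_ident_at)
    then have "((\<lambda>x. arctan (x / sqrt (1 - 2 * x\<^sup>2))) \<longlongrightarrow> pi / 2) (at_left c)"
      by (rule filterlim_compose[OF tendsto_arctan_at_top])
    then show ?thesis unfolding A_def using tendsto_divide[OF _ tendsto_const, of _ "pi / 2" _ pi] by simp
  qed
  have lim_mc: "(A \<longlongrightarrow> - 1 / 2) (at_right (- c))"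
  proof -
    have "((\<lambda>x. - A (- x)) \<longlongrightarrow> - (1 / 2)) (at_right (- c))"
      using lim_c by (intro tendsto_minus) (simp add: at_right_minus filterlim_filtermap)
    then show ?thesis by (simp add: A_def[abs_def] arctan_minus)
  qed
  have c_less: "ereal (- c) < ereal c" using c(1) by simp
  have A1: "((A \<circ> real_of_ereal) \<longlongrightarrow> - 1 / 2) (at_right (ereal (- c)))"
    using lim_mc by (simp add: ereal_tendsto_simps)
  have A2: "((A \<circ> real_of_ereal) \<longlongrightarrow> 1 / 2) (at_left (ereal c))"
    using lim_c by (simp add: ereal_tendsto_simps)
  have nn: "AE x in lborel. ereal (- c) < ereal x \<longrightarrow> ereal x < ereal c \<longrightarrow> 0 \<le> g x"
    using g_nonneg by simp
  have "set_integrable lborel (einterval (ereal (- c)) (ereal c)) g"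
    "(LBINT x=ereal (- c)..ereal c. g x) = 1 / 2 - - 1 / 2"
    by (rule interval_integral_FTC_nonneg[OF c_less _ _ nn A1 A2]; use der cont in simp)+
  then show "integrable lborel walk_density" "(LBINT x. walk_density x) = 1"
    using c(1) unfolding wd
    by (auto simp: set_integrable_def interval_lebesgue_integral_def set_lebesgue_integral_def)
qed

definition scaled_density :: "real \<Rightarrow> real \<Rightarrow> real" where
  "scaled_density t x = 1 / t * walk_density (x / t)"

definition convolution :: "(real \<Rightarrow> real) \<Rightarrow> (real \<Rightarrow> real) \<Rightarrow> real \<Rightarrow> real" where
  "convolution g h x = (LBINT y. g y * h (x - y))"

definition rho :: "(real \<Rightarrow> real) \<Rightarrow> real \<Rightarrow> real \<Rightarrow> real" where
  "rho \<gamma> t = convolution \<gamma> (scaled_density t)"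

definition compact_support :: "(real \<Rightarrow> real) \<Rightarrow> bool" where
  "compact_support g \<longleftrightarrow> compact (closure {x. g x \<noteq> 0})"

end

theory Submission
  imports Defs
begin

text \<open>
  Given the configuration and the time \<open>m = \<lfloor>tn\<rfloor>\<close>, the empirical sum
  \<open>1/n \<Sum>\<^sub>k G(k/n) \<eta>(k)\<close> is \<open>1/n\<close> times a sum of bounded functions of independent positions, with
  independent Poisson numbers of walks per state.  Its variance is of order \<open>1/n\<close>, since only \<open>O(n)\<close>
  states can be occupied; so it concentrates at its mean
  (\<open>poisson_marked_sum_deviation\<close>, \<open>empirical_sum_deviation\<close>).  The work is to compute the limit of
  the mean.

  The mean is a Riemann sum.  Both coin states over a site carry the same rate \<open>\<gamma>(k/n)/2\<close>, so the
  mean only involves the displacement law \<open>walk_law m\<close> of a walk whose initial coin is chosen by a fair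
  toss.  If \<open>walk_law m\<close>, rescaled by \<open>1/n\<close>, converges weakly to the density \<open>f\<^sub>t\<close>, the mean converges
  to \<open>\<integral> \<gamma>(y) \<integral> f\<^sub>t(u) G(y + u) du dy\<close>, which is \<open>\<integral> G \<rho>(t, \<cdot>)\<close> by Fubini
  (\<open>riemann_sum_tendsto\<close>, \<open>integral_rho\<close>, \<open>mean_occupation_limit\<close>).

  Weak convergence comes from characteristic functions.  In Fourier space one step of the walk is
  multiplication by the unitary matrix \<open>A(\<theta>) = diag(e\<^sup>i\<^sup>\<theta>, e\<^sup>-\<^sup>i\<^sup>\<theta>) H\<close>, and by Parseval the characteristic
  function of \<open>walk_law m\<close> at \<open>s\<close> is the average over \<open>\<theta>\<close> of half the trace of
  \<open>A(\<theta>)\<^sup>-\<^sup>m A(\<theta> + s)\<^sup>m\<close>: averaging over the two initial coins is what produces a trace.  The eigenvalues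
  of \<open>A(\<theta>)\<close> are \<open>i e\<^sup>\<plusminus>\<^sup>i\<^sup>\<omega>\<close> with \<open>cos \<omega> = sin \<theta> / \<surd>2\<close>.  For \<open>s = \<xi>/n\<close> and \<open>m/n \<longlongrightarrow> t\<close> the eigenvectors at
  \<open>\<theta>\<close> and \<open>\<theta> + s\<close> agree in the limit, and what survives is the phase difference
  \<open>m (\<omega>(\<theta> + \<xi>/n) - \<omega>(\<theta>)) \<longlongrightarrow> \<xi> t \<omega>'(\<theta>)\<close>.  Hence the limit law is that of \<open>t \<omega>'(\<theta>)\<close> for \<open>\<theta>\<close> uniform on the
  circle, and the substitution \<open>x = \<omega>'(\<theta>)\<close> turns it into the density \<open>f\<^sub>t\<close>
  (\<open>fourier_sum_amplitude_trace\<close>, \<open>walk_kernel_limit\<close>, \<open>phase_velocity_integral\<close>,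
  \<open>walk_law_weak_limit\<close>).
\<close>

section \<open>Fourier sums of finitely supported amplitudes\<close>

text \<open>
  The sum runs over the support, which is finite for amplitudes reached in finitely many steps.
\<close>

definition fourier_sum :: "(int \<Rightarrow> complex) \<Rightarrow> real \<Rightarrow> complex" where
  "fourier_sum f \<theta> = (\<Sum>k | f k \<noteq> 0. f k * cis (real_of_int k * \<theta>))"

lemma fourier_sum_superset:
  assumes "finite S" "{k. f k \<noteq> 0} \<subseteq> S"
  shows "fourier_sum f \<theta> = (\<Sum>k\<in>S. f k * cis (real_of_int k * \<theta>))"
  unfolding fourier_sum_def using assms by (intro sum.mono_neutral_left) auto

lemma fourier_sum_linear:
  assumes "finite {k. f k \<noteq> 0}" "finite {k. g k \<noteq> 0}"
  shows "fourier_sum (\<lambda>k. a * f k + b * g k) \<theta> = a * fourier_sum f \<theta> + b * fourier_sum g \<theta>"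
proof -
  let ?S = "{k. f k \<noteq> 0} \<union> {k. g k \<noteq> 0}"
  have S: "fourier_sum h \<theta> = (\<Sum>k\<in>?S. h k * cis (real_of_int k * \<theta>))" if "{k. h k \<noteq> 0} \<subseteq> ?S" for h
    using assms that by (intro fourier_sum_superset) auto
  have "fourier_sum (\<lambda>k. a * f k + b * g k) \<theta>
      = (\<Sum>k\<in>?S. (a * f k + b * g k) * cis (real_of_int k * \<theta>))"
    by (rule S) auto
  also have "\<dots> = a * (\<Sum>k\<in>?S. f k * cis (real_of_int k * \<theta>)) + b * (\<Sum>k\<in>?S. g k * cis (real_of_int k * \<theta>))"
    by (simp only: sum_distrib_left sum.distrib[symmetric] distrib_right mult.assoc)
  also have "\<dots> = a * fourier_sum f \<theta> + b * fourier_sum g \<theta>"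
    by (subst (1 2) S) auto
  finally show ?thesis .
qed

text \<open>
  Moving by \<open>j\<close> sites is multiplication by a phase; this diagonalises the shift of the walk.
\<close>

lemma fourier_sum_shift: "fourier_sum (\<lambda>k. f (k - j)) \<theta> = cis (real_of_int j * \<theta>) * fourier_sum f \<theta>"
proof -
  have "fourier_sum (\<lambda>k. f (k - j)) \<theta> = (\<Sum>k | f k \<noteq> 0. f k * cis (real_of_int (k + j) * \<theta>))"
    unfolding fourier_sum_def
    by (rule sum.reindex_bij_witness[of _ "\<lambda>k. k + j" "\<lambda>k. k - j"]) auto
  also have "\<dots> = cis (real_of_int j * \<theta>) * fourier_sum f \<theta>"
    unfolding fourier_sum_def sum_distrib_left of_int_add distrib_right cis_mult[symmetric]
    by (intro sum.cong refl) simp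
  finally show ?thesis .
qed

lemma integral_cis_period:
  "(LINT \<theta>:{-pi..pi}|lborel. cis (real_of_int j * \<theta>)) = (if j = 0 then 2 * pi else 0)"
proof (cases "j = 0")
  case True
  then show ?thesis by (simp add: set_lebesgue_integral_def scaleR_conv_of_real)
next
  case False
  let ?F = "\<lambda>\<theta>. cis (real_of_int j * \<theta>) / (\<i> * of_int j)"
  have "(LINT \<theta>:{-pi..pi}|lborel. cis (real_of_int j * \<theta>)) = ?F pi - ?F (- pi)"
    unfolding set_lebesgue_integral_def
  proof (rule integral_FTC_Icc)
    show "(?F has_vector_derivative cis (real_of_int j * x)) (at x within {-pi..pi})" for x
      unfolding cis_conv_exp using False
      by (auto intro!: derivative_eq_intros has_vector_derivative_real_field simp: field_simps)
  qed (auto intro!: continuous_intros)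
  also have "cis (real_of_int j * pi) = cis (real_of_int j * (- pi))"
    by (simp add: complex_eq_iff sin_zero_iff_int2)
  finally show ?thesis using False by simp
qed

text \<open>
  Parseval's identity with the second factor translated by \<open>s\<close>.  The translation inserts
  \<open>e\<^sup>i\<^sup>k\<^sup>s\<close>, so when \<open>\<bar>f k\<bar>\<^sup>2\<close> is a probability distribution the right-hand side is \<open>2\<pi>\<close> times its
  characteristic function at \<open>s\<close>.
\<close>

lemma fourier_sum_Parseval:
  assumes "finite {k. f k \<noteq> 0}"
  shows "(LINT \<theta>:{-pi..pi}|lborel. cnj (fourier_sum f \<theta>) * fourier_sum f (\<theta> + s))
    = 2 * pi * (\<Sum>k | f k \<noteq> 0. of_real ((cmod (f k))\<^sup>2) * cis (real_of_int k * s))"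
proof -
  let ?S = "{k. f k \<noteq> 0}"
  define a where "a k l = cnj (f k) * f l * cis (real_of_int l * s)" for k l
  define e where "e k l \<theta> = indicator {-pi..pi} \<theta> *\<^sub>R (a k l * cis (real_of_int (l - k) * \<theta>))" for k l \<theta>
  have int: "integrable lborel (e k l)" for k l
    unfolding e_def[abs_def] set_integrable_def[symmetric]
    by (intro borel_integrable_atLeastAtMost' continuous_intros)
  have "cnj (fourier_sum f \<theta>) * fourier_sum f (\<theta> + s)
     = (\<Sum>k\<in>?S. \<Sum>l\<in>?S. a k l * cis (real_of_int (l - k) * \<theta>))" for \<theta>
  proof -
    have "cnj (cis (real_of_int k * \<theta>)) * cis (real_of_int l * (\<theta> + s))
        = cis (real_of_int l * s) * cis (real_of_int (l - k) * \<theta>)" for k l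
      by (simp add: cis_cnj cis_mult algebra_simps)
    then have "cnj (f k * cis (real_of_int k * \<theta>)) * (f l * cis (real_of_int l * (\<theta> + s)))
        = a k l * cis (real_of_int (l - k) * \<theta>)" for k l
      unfolding a_def complex_cnj_mult by (metis mult.assoc mult.left_commute)
    then show ?thesis
      by (simp only: fourier_sum_def cnj_sum sum_product)
  qed
  then have "(LINT \<theta>:{-pi..pi}|lborel. cnj (fourier_sum f \<theta>) * fourier_sum f (\<theta> + s))
    = (LINT \<theta>|lborel. (\<Sum>k\<in>?S. \<Sum>l\<in>?S. e k l \<theta>))"
    by (simp only: set_lebesgue_integral_def scaleR_sum_right e_def)
  also have "\<dots> = (\<Sum>k\<in>?S. \<Sum>l\<in>?S. integral\<^sup>L lborel (e k l))"
    by (simp add: int)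
  also have "\<dots> = (\<Sum>k\<in>?S. \<Sum>l\<in>?S. a k l * (if l - k = 0 then 2 * pi else 0))"
    unfolding e_def[abs_def] set_lebesgue_integral_def[symmetric] set_integral_mult_right
      integral_cis_period ..
  also have "\<dots> = (\<Sum>k\<in>?S. \<Sum>l\<in>?S. if l = k then a k l * (2 * pi) else 0)"
    by (intro sum.cong) auto
  also have "\<dots> = (\<Sum>k\<in>?S. a k k * (2 * pi))"
    using assms by (intro sum.cong) (auto simp: sum.delta)
  also have "\<dots> = 2 * pi * (\<Sum>k | f k \<noteq> 0. of_real ((cmod (f k))\<^sup>2) * cis (real_of_int k * s))"
    unfolding complex_norm_square a_def by (simp add: sum_distrib_left mult_ac)
  finally show ?thesis .
qed

section \<open>The Hadamard walk in Fourier space\<close>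

text \<open>
  \<open>c\<close> is the initial coin and \<open>d\<close> the observed one.  Starting at the origin suffices, by
  translation invariance (\<open>coord_walk_site\<close>).
\<close>

definition amplitude :: "nat \<Rightarrow> coin \<Rightarrow> coin \<Rightarrow> int \<Rightarrow> complex" where
  "amplitude m c d k = coord ((walk_step ^^ m) (site 0 \<otimes> ket c)) k $ d"

lemma coord_walk_step:
  "coord (walk_step \<psi>) k $ Plus
     = complex_of_real (1 / sqrt 2) * (coord \<psi> (k - 1) $ Plus + coord \<psi> (k - 1) $ Minus)"
  "coord (walk_step \<psi>) k $ Minus
     = complex_of_real (1 / sqrt 2) * (coord \<psi> (k + 1) $ Plus - coord \<psi> (k + 1) $ Minus)"
  unfolding walk_step_def comp_apply coord_walk_shift coord_id_tensor_hadamard hadamard_nth by auto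

lemma amplitude_0: "amplitude 0 c d k = (if c = d \<and> k = 0 then 1 else 0)"
  by (simp add: amplitude_def tensor.rep_eq site_def single.rep_eq ket_def axis_def)

lemma amplitude_Suc:
  "amplitude (Suc m) c Plus k
     = complex_of_real (1 / sqrt 2) * (amplitude m c Plus (k - 1) + amplitude m c Minus (k - 1))"
  "amplitude (Suc m) c Minus k
     = complex_of_real (1 / sqrt 2) * (amplitude m c Plus (k + 1) - amplitude m c Minus (k + 1))"
  by (simp_all add: amplitude_def coord_walk_step del: of_real_divide)

lemma coord_walk_site: "coord ((walk_step ^^ m) (site l \<otimes> ket c)) k $ d = amplitude m c d (k - l)"
proof (induction m arbitrary: k d)
  case 0
  then show ?case
    by (simp add: amplitude_def tensor.rep_eq site_def single.rep_eq ket_def axis_def)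
next
  case (Suc m)
  then show ?case
    by (cases d) (simp_all add: coord_walk_step amplitude_Suc algebra_simps del: of_real_divide)
qed

text \<open>
  The walk moves one site per step.
\<close>

lemma amplitude_eq_0: "int m < \<bar>k\<bar> \<Longrightarrow> amplitude m c d k = 0"
proof (induction m arbitrary: k d)
  case (Suc m)
  then show ?case by (cases d) (simp_all add: amplitude_Suc)
qed (simp add: amplitude_0)

lemma amplitude_support: "{k. amplitude m c d k \<noteq> 0} \<subseteq> {-int m..int m}"
  using amplitude_eq_0[of m] by (auto simp: not_less[symmetric] abs_less_iff intro: leI)

lemma finite_amplitude_support: "finite {k. amplitude m c d k \<noteq> 0}"
  by (rule finite_subset[OF amplitude_support]) simp

lemma detection_prob_site:
  "detection_prob m (site l \<otimes> ket c) k
    = (cmod (amplitude m c Plus (k - l)))\<^sup>2 + (cmod (amplitude m c Minus (k - l)))\<^sup>2"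
  by (simp add: detection_prob_def component.rep_eq coord_walk_site)

text \<open>
  \<open>A(\<theta>)\<close> has determinant \<open>-1\<close> and trace \<open>i \<surd>2 sin \<theta>\<close>, so \<open>A(\<theta>)/i\<close> has determinant \<open>1\<close> and
  trace \<open>2 cos \<omega>\<close> with \<open>cos \<omega> = sin \<theta> / \<surd>2\<close>; its eigenvalues are \<open>e\<^sup>\<plusminus>\<^sup>i\<^sup>\<omega>\<close>.  This \<open>\<omega>\<close> is the phase.
\<close>

definition phase :: "real \<Rightarrow> real" where
  "phase \<theta> = arccos (sin \<theta> / sqrt 2)"

lemma sin_div_sqrt2_bounds: "\<bar>sin \<theta> / sqrt 2\<bar> < 1"
proof -
  have "\<bar>sin \<theta>\<bar> \<le> 1" by simp
  also have "1 < sqrt (2::real)" by simp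
  finally show ?thesis by (simp add: abs_divide)
qed

lemma cos_phase: "cos (phase \<theta>) = sin \<theta> / sqrt 2"
  unfolding phase_def using sin_div_sqrt2_bounds[of \<theta>] by (intro cos_arccos) linarith+

lemma sin_phase: "sin (phase \<theta>) = sqrt ((1 + (cos \<theta>)\<^sup>2) / 2)"
proof -
  have "sin (phase \<theta>) = sqrt (1 - (sin \<theta> / sqrt 2)\<^sup>2)"
    unfolding phase_def using sin_div_sqrt2_bounds[of \<theta>] by (intro sin_arccos) linarith+
  also have "1 - (sin \<theta> / sqrt 2)\<^sup>2 = (1 + (cos \<theta>)\<^sup>2) / 2"
    by (simp add: power_divide sin_squared_eq field_simps)
  finally show ?thesis .
qed

text \<open>
  The two eigenvalues of \<open>A(\<theta>)\<close> stay uniformly apart.  This makes the phase smooth and gives the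
  uniform bound that dominated convergence needs.
\<close>

lemma sin_phase_ge: "sqrt (1 / 2) \<le> sin (phase \<theta>)"
  unfolding sin_phase by (intro real_sqrt_le_mono) simp

lemma sin_phase_pos: "0 < sin (phase \<theta>)"
  using sin_phase_ge[of \<theta>] by (rule less_le_trans[rotated]) simp

lemma sin_phase_square: "(sin (phase \<theta>))\<^sup>2 = (1 + (cos \<theta>)\<^sup>2) / 2"
  unfolding sin_phase by (simp add: add_nonneg_nonneg)

text \<open>
  The entry in row \<open>d\<close> and column \<open>c\<close> of the Hermitian matrix \<open>Q(\<theta>)\<close> in the decomposition
  \<open>A(\<theta>) = i (cos \<omega> - i Q(\<theta>) / \<surd>2)\<close>.  It is traceless and \<open>Q(\<theta>)\<^sup>2 = 1 + cos\<^sup>2 \<theta> = 2 sin\<^sup>2 \<omega>\<close>.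
\<close>

definition symbol_entry :: "coin \<Rightarrow> coin \<Rightarrow> real \<Rightarrow> complex" where
  "symbol_entry c d \<theta> =
     (case d of Plus \<Rightarrow> (case c of Plus \<Rightarrow> of_real (cos \<theta>) | Minus \<Rightarrow> cis \<theta>)
      | Minus \<Rightarrow> (case c of Plus \<Rightarrow> cis (- \<theta>) | Minus \<Rightarrow> - of_real (cos \<theta>)))"

text \<open>
  The two rows of the matrix \<open>A(\<theta>)\<close>.
\<close>

lemma fourier_sum_amplitude_Suc:
  "fourier_sum (amplitude (Suc m) c Plus) \<theta> = of_real (1 / sqrt 2) * cis \<theta> *
     (fourier_sum (amplitude m c Plus) \<theta> + fourier_sum (amplitude m c Minus) \<theta>)"
  "fourier_sum (amplitude (Suc m) c Minus) \<theta> = of_real (1 / sqrt 2) * cis (- \<theta>) *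
     (fourier_sum (amplitude m c Plus) \<theta> - fourier_sum (amplitude m c Minus) \<theta>)"
proof -
  let ?h = "complex_of_real (1 / sqrt 2)"
  let ?a = "\<lambda>d. amplitude m c d"
  note fin = finite_amplitude_support[of m c]
  have P: "amplitude (Suc m) c Plus = (\<lambda>k. (\<lambda>k. ?h * ?a Plus k + ?h * ?a Minus k) (k - 1))"
    by (simp add: fun_eq_iff amplitude_Suc distrib_left del: of_real_divide)
  show "fourier_sum (amplitude (Suc m) c Plus) \<theta> = ?h * cis \<theta> *
     (fourier_sum (?a Plus) \<theta> + fourier_sum (?a Minus) \<theta>)"
    unfolding P fourier_sum_shift[of "\<lambda>k. ?h * ?a Plus k + ?h * ?a Minus k" 1]
      fourier_sum_linear[OF fin fin] by (simp add: algebra_simps del: of_real_divide)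
  have M: "amplitude (Suc m) c Minus = (\<lambda>k. (\<lambda>k. ?h * ?a Plus k + (- ?h) * ?a Minus k) (k - (- 1)))"
    by (simp add: fun_eq_iff amplitude_Suc right_diff_distrib del: of_real_divide)
  show "fourier_sum (amplitude (Suc m) c Minus) \<theta> = ?h * cis (- \<theta>) *
     (fourier_sum (?a Plus) \<theta> - fourier_sum (?a Minus) \<theta>)"
    unfolding M fourier_sum_shift[of "\<lambda>k. ?h * ?a Plus k + (- ?h) * ?a Minus k" "- 1"]
      fourier_sum_linear[OF fin fin] by (simp add: algebra_simps del: of_real_divide)
qed

text \<open>
  De Moivre's formula for \<open>A(\<theta>) = i (cos \<omega> - i sin \<omega> \<cdot> Q(\<theta>) / (\<surd>2 sin \<omega>))\<close>: the matrix
  \<open>Q(\<theta>) / (\<surd>2 sin \<omega>)\<close> squares to the identity, so the \<open>m\<close>-th power replaces \<open>i\<close> in front by \<open>i\<^sup>m\<close>, and \<open>\<omega>\<close> by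
  \<open>m \<omega>\<close> in the cosine and in the first sine.
\<close>

lemma fourier_sum_amplitude:
  "fourier_sum (amplitude m c d) \<theta> = \<i> ^ m *
     (of_real (if c = d then cos (m * phase \<theta>) else 0)
      - \<i> * of_real (sin (m * phase \<theta>) / (sqrt 2 * sin (phase \<theta>))) * symbol_entry c d \<theta>)"
proof (induction m arbitrary: c d)
  case 0
  have eq: "fourier_sum (amplitude 0 c d) \<theta> = (\<Sum>k\<in>{0}. amplitude 0 c d k * cis (real_of_int k * \<theta>))"
    by (rule fourier_sum_superset) (auto simp: amplitude_0)
  show ?case unfolding eq by (simp add: amplitude_0)
next
  case (Suc m)
  define w where "w = phase \<theta>"
  define h where "h = 1 / sqrt (2::real)"
  define S where "S = sin (m * w) / (sqrt 2 * sin w)"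
  define S' where "S' = sin (Suc m * w) / (sqrt 2 * sin w)"
  define C where "C = cos (m * w)"
  define C' where "C' = cos (Suc m * w)"
  have h3: "sqrt 2 = 2 * h" by (simp add: h_def real_div_sqrt)
  have sw: "sin w \<noteq> 0" "sin w * sin w = (1 + (cos \<theta>)\<^sup>2) / 2"
    using sin_phase_pos[of \<theta>] sin_phase_square[of \<theta>] by (auto simp: w_def power2_eq_square)
  have cw: "cos w = h * sin \<theta>" by (simp add: w_def h_def cos_phase)
  \<comment> \<open>The addition theorems, with \<open>cos \<omega> = h sin \<theta>\<close> and \<open>2 sin\<^sup>2 \<omega> = 1 + cos\<^sup>2 \<theta>\<close> inserted.\<close>
  have S': "S' = h * C + h * sin \<theta> * S"
    using sw(1) by (simp add: S'_def S_def C_def distrib_right sin_add cw h3) (simp add: h_def field_simps)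
  have "C' = C * cos w - sin (m * w) * sin w"
    by (simp add: C'_def C_def distrib_right cos_add)
  also have "sin (m * w) * sin w = S * sqrt 2 * (sin w * sin w)"
    using sw(1) by (simp add: S_def)
  also have "\<dots> = S * h * (1 + (cos \<theta>)\<^sup>2)"
    unfolding sw(2) h3 by simp
  finally have C': "C' = C * (h * sin \<theta>) - S * h * (1 + (cos \<theta>)\<^sup>2)"
    unfolding cw .
  have h2: "of_real (1 / sqrt 2) = complex_of_real h" by (simp add: h_def)
  have sc: "sin \<theta> * sin \<theta> = 1 - cos \<theta> * cos \<theta>"
    using sin_squared_eq[of \<theta>] by (simp add: power2_eq_square)
  have sc': "x * (sin \<theta> * sin \<theta>) = x - x * (cos \<theta> * cos \<theta>)" for x
    unfolding sc by (simp add: algebra_simps)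
  \<comment> \<open>The induction step is the matrix product \<open>A(\<theta>) A(\<theta>)\<^sup>m\<close>, one equation per entry, with the factor \<open>i\<^sup>m\<close> removed.\<close>
  have PP: "h * cis \<theta> * (C - \<i> * S * cos \<theta> - \<i> * S * cis (- \<theta>)) = \<i> * (C' - \<i> * S' * cos \<theta>)"
    unfolding C' S' by (simp add: complex_eq_iff power2_eq_square algebra_simps sc sc')
  have PM: "h * cis (- \<theta>) * (C - \<i> * S * cos \<theta> + \<i> * S * cis (- \<theta>)) = S' * cis (- \<theta>)"
    unfolding C' S' by (simp add: complex_eq_iff power2_eq_square algebra_simps sc sc')
  have MP: "h * cis \<theta> * (C - \<i> * S * cis \<theta> + \<i> * S * cos \<theta>) = S' * cis \<theta>"
    unfolding C' S' by (simp add: complex_eq_iff power2_eq_square algebra_simps sc sc')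
  have MM: "h * cis (- \<theta>) * (- (\<i> * S * cis \<theta>) - C - \<i> * S * cos \<theta>) = \<i> * (C' + \<i> * S' * cos \<theta>)"
    unfolding C' S' by (simp add: complex_eq_iff power2_eq_square algebra_simps sc sc')
  note rec = fourier_sum_amplitude_Suc Suc.IH w_def[symmetric] S_def[symmetric] C_def[symmetric]
    S'_def[symmetric] C'_def[symmetric] h2 symbol_entry_def coin.case
  show ?case
  proof (cases c; cases d)
    assume "c = Plus" "d = Plus"
    then show ?thesis
      using arg_cong[OF PP, of "\<lambda>z. \<i> ^ m * z"] by (simp only: rec) (simp add: algebra_simps)
  next
    assume "c = Plus" "d = Minus"
    then show ?thesis
      using arg_cong[OF PM, of "\<lambda>z. \<i> ^ m * z"] by (simp only: rec) (simp add: algebra_simps)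
  next
    assume "c = Minus" "d = Plus"
    then show ?thesis
      using arg_cong[OF MP, of "\<lambda>z. \<i> ^ m * z"] by (simp only: rec) (simp add: algebra_simps)
  next
    assume "c = Minus" "d = Minus"
    then show ?thesis
      using arg_cong[OF MM, of "\<lambda>z. \<i> ^ m * z"] by (simp only: rec) (simp add: algebra_simps)
  qed
qed

text \<open>
  Half the trace of \<open>A(\<theta>)\<^sup>-\<^sup>m A(\<theta>')\<^sup>m\<close>, written out; see \<open>fourier_sum_amplitude_trace\<close>.
\<close>

definition walk_kernel :: "nat \<Rightarrow> real \<Rightarrow> real \<Rightarrow> real" where
  "walk_kernel m \<theta> \<theta>' = cos (m * phase \<theta>) * cos (m * phase \<theta>')
     + sin (m * phase \<theta>) * sin (m * phase \<theta>')
       * ((cos \<theta> * cos \<theta>' + cos (\<theta>' - \<theta>)) / (2 * sin (phase \<theta>) * sin (phase \<theta>')))"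

lemma sum_coin: "(\<Sum>c\<in>UNIV. f c) = f Plus + f Minus" for f :: "coin \<Rightarrow> 'a::comm_monoid_add"
  by (simp add: UNIV_coin)

text \<open>
  The left-hand side is the trace of \<open>A(\<theta>)\<^sup>-\<^sup>m A(\<theta>')\<^sup>m\<close> because \<open>A(\<theta>)\<close> is unitary.  The mixed terms,
  linear in \<open>Q\<close>, drop out since \<open>Q\<close> is traceless; this is why the result is real.
\<close>

lemma fourier_sum_amplitude_trace:
  "(\<Sum>c\<in>UNIV. \<Sum>d\<in>UNIV. cnj (fourier_sum (amplitude m c d) \<theta>) * fourier_sum (amplitude m c d) \<theta>')
     = 2 * of_real (walk_kernel m \<theta> \<theta>')"
proof -
  define S where "S = sin (m * phase \<theta>) / (sqrt 2 * sin (phase \<theta>))"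
  define S' where "S' = sin (m * phase \<theta>') / (sqrt 2 * sin (phase \<theta>'))"
  define C where "C = cos (m * phase \<theta>)"
  define C' where "C' = cos (m * phase \<theta>')"
  have K: "walk_kernel m \<theta> \<theta>' = C * C' + S * S' * (cos \<theta> * cos \<theta>' + cos (\<theta>' - \<theta>))"
    using sin_phase_pos[of \<theta>] sin_phase_pos[of \<theta>']
    by (simp add: walk_kernel_def S_def S'_def C_def C'_def)
  have unit: "cnj (\<i> ^ m * a) * (\<i> ^ m * b) = cnj a * b" for a b
  proof -
    have "cnj (\<i> ^ m) * \<i> ^ m = of_real ((cmod (\<i> ^ m))\<^sup>2)"
      by (metis complex_norm_square mult.commute)
    then show ?thesis by (simp add: norm_power algebra_simps)
  qed
  show ?thesis
    unfolding sum_coin fourier_sum_amplitude unit K S_def[symmetric] S'_def[symmetric]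
      C_def[symmetric] C'_def[symmetric]
    by (simp add: symbol_entry_def complex_eq_iff cos_diff algebra_simps)
qed

text \<open>
  The factor \<open>1/2\<close> stands for a fair toss of the initial coin.  This average arises because both coin
  states over a site carry the same Poisson rate.
\<close>

definition mean_detection :: "nat \<Rightarrow> int \<Rightarrow> real" where
  "mean_detection m k = (\<Sum>c\<in>UNIV. \<Sum>d\<in>UNIV. (cmod (amplitude m c d k))\<^sup>2) / 2"

lemma mean_detection_nonneg: "0 \<le> mean_detection m k"
  by (simp add: mean_detection_def sum_nonneg)

lemma mean_detection_eq_0: "int m < \<bar>k\<bar> \<Longrightarrow> mean_detection m k = 0"
  by (simp add: mean_detection_def amplitude_eq_0)

text \<open>
  The characteristic function of the averaged displacement: Parseval followed by the trace formula.
\<close>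

lemma mean_detection_fourier:
  "(\<Sum>k\<in>{-int m..int m}. of_real (mean_detection m k) * cis (real_of_int k * s))
     = of_real ((LINT \<theta>:{-pi..pi}|lborel. walk_kernel m \<theta> (\<theta> + s)) / (2 * pi))"
proof -
  let ?F = "\<lambda>c d. fourier_sum (amplitude m c d)"
  let ?I = "\<lambda>c d. (LINT \<theta>:{-pi..pi}|lborel. cnj (?F c d \<theta>) * ?F c d (\<theta> + s))"
  have i: "set_integrable lborel {-pi..pi} (\<lambda>\<theta>. cnj (?F c d \<theta>) * ?F c d (\<theta> + s))" for c d
    unfolding fourier_sum_def by (intro borel_integrable_atLeastAtMost' continuous_intros)
  have "of_real ((LINT \<theta>:{-pi..pi}|lborel. 2 * walk_kernel m \<theta> (\<theta> + s)))
      = (LINT \<theta>:{-pi..pi}|lborel. (\<Sum>c\<in>UNIV. \<Sum>d\<in>UNIV. cnj (?F c d \<theta>) * ?F c d (\<theta> + s)))"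
    unfolding fourier_sum_amplitude_trace
    by (simp only: set_lebesgue_integral_def integral_complex_of_real[symmetric]
        scaleR_conv_of_real real_scaleR_def of_real_mult) simp
  also have "\<dots> = (\<Sum>c\<in>UNIV. \<Sum>d\<in>UNIV. ?I c d)"
    using i unfolding sum_coin by (simp add: set_integral_add)
  also have "\<dots> = (\<Sum>c\<in>UNIV. \<Sum>d\<in>UNIV. 2 * pi * (\<Sum>k\<in>{-int m..int m}.
      of_real ((cmod (amplitude m c d k))\<^sup>2) * cis (real_of_int k * s)))"
    unfolding fourier_sum_Parseval[OF finite_amplitude_support] using amplitude_support[of m]
    by (intro sum.cong refl arg_cong2[where f = "(*)"] sum.mono_neutral_left) auto
  also have "\<dots> = 4 * pi * (\<Sum>k\<in>{-int m..int m}. of_real (mean_detection m k) * cis (real_of_int k * s))"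
    unfolding sum_coin mean_detection_def sum_distrib_left sum.distrib[symmetric]
    by (intro sum.cong refl) (simp add: field_simps)
  finally have "of_real (2 * (LINT \<theta>:{-pi..pi}|lborel. walk_kernel m \<theta> (\<theta> + s)))
      = of_real (4 * pi) * (\<Sum>k\<in>{-int m..int m}. of_real (mean_detection m k) * cis (real_of_int k * s))"
    by simp
  then show ?thesis by (simp add: field_simps)
qed

lemma walk_kernel_same: "walk_kernel m \<theta> \<theta> = 1"
proof -
  have "cos \<theta> * cos \<theta> + cos (\<theta> - \<theta>) = 2 * sin (phase \<theta>) * sin (phase \<theta>)"
    using sin_phase_square[of \<theta>] by (simp add: power2_eq_square)
  then show ?thesis
    using sin_phase_pos[of \<theta>] unfolding walk_kernel_def
    by (simp add: power2_eq_square[symmetric])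
qed

text \<open>
  The characteristic function at \<open>0\<close>, where the kernel is constantly \<open>1\<close>.
\<close>

lemma mean_detection_sum: "(\<Sum>k\<in>{-int m..int m}. mean_detection m k) = 1"
proof -
  have "complex_of_real (\<Sum>k\<in>{-int m..int m}. mean_detection m k) = of_real 1"
    using mean_detection_fourier[of m 0] by (simp add: walk_kernel_same set_lebesgue_integral_def)
  then show ?thesis by (simp only: of_real_eq_iff)
qed

section \<open>Group velocity and limit law of a single walk\<close>

text \<open>
  The group velocity: the derivative of the phase, by \<open>phase_has_derivative\<close>.
\<close>

definition phase_velocity :: "real \<Rightarrow> real" where
  "phase_velocity \<theta> = - cos \<theta> / sqrt (1 + (cos \<theta>)\<^sup>2)"

lemma one_plus_square_neq_0: "1 + x\<^sup>2 \<noteq> (0::real)" "\<not> 1 + x\<^sup>2 < (0::real)"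
  using zero_le_power2[of x] by linarith+

lemma phase_has_derivative: "(phase has_real_derivative phase_velocity \<theta>) (at \<theta>)"
proof -
  have b: "- 1 < sin \<theta> / sqrt 2" "sin \<theta> / sqrt 2 < 1"
    using sin_div_sqrt2_bounds[of \<theta>] by (auto simp only: abs_less_iff)
  have "1 - (sin \<theta> / sqrt 2)\<^sup>2 = (1 + (cos \<theta>)\<^sup>2) / 2"
    by (simp add: power_divide sin_squared_eq field_simps)
  then have s: "sqrt (1 - (sin \<theta> / sqrt 2)\<^sup>2) = sqrt (1 + (cos \<theta>)\<^sup>2) / sqrt 2"
    by (simp only: real_sqrt_divide)
  have d: "((\<lambda>\<theta>. sin \<theta> / sqrt 2) has_real_derivative cos \<theta> / sqrt 2) (at \<theta>)"
    by (rule DERIV_cdivide[OF DERIV_sin])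
  have q: "inverse (- (x / z)) * (a / z) = - a / x" if "0 < z" for a x z :: real
    using that by (cases "x = 0") (simp_all add: field_simps)
  have v: "inverse (- (sqrt (1 + (cos \<theta>)\<^sup>2) / sqrt 2)) * (cos \<theta> / sqrt 2) = phase_velocity \<theta>"
    unfolding phase_velocity_def by (rule q) simp
  have "((\<lambda>\<theta>. arccos (sin \<theta> / sqrt 2)) has_real_derivative
      inverse (- sqrt (1 - (sin \<theta> / sqrt 2)\<^sup>2)) * (cos \<theta> / sqrt 2)) (at \<theta>)"
    by (rule DERIV_chain2[OF DERIV_arccos[OF b] d])
  then show ?thesis unfolding s v phase_def[abs_def] .
qed

lemma isCont_phase: "isCont phase \<theta>"
  using phase_has_derivative by (rule DERIV_isCont)

lemma continuous_on_phase [continuous_intros]: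
  "continuous_on S f \<Longrightarrow> continuous_on S (\<lambda>x. phase (f x))" for S :: "real set"
  by (rule continuous_on_compose2[of UNIV phase]) (auto intro!: continuous_at_imp_continuous_on isCont_phase)

lemma continuous_on_phase_velocity [continuous_intros]:
  "continuous_on S f \<Longrightarrow> continuous_on S (\<lambda>x. phase_velocity (f x))" for S :: "real set"
  unfolding phase_velocity_def by (intro continuous_intros) (auto simp: one_plus_square_neq_0)

text \<open>
  The kernel is \<open>cos (m \<omega>(\<theta>') - m \<omega>(\<theta>))\<close> plus a bounded multiple of \<open>R(\<theta>') - 1\<close>, where \<open>R\<close> is the
  overlap of the normalised matrices \<open>Q(\<theta>)\<close> and \<open>Q(\<theta>')\<close>.  At \<open>\<theta>' = \<theta> + \<xi>/n\<close> the overlap tends to \<open>1\<close>,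
  while the phase difference is multiplied by \<open>m \<approx> t n\<close> and turns into a derivative.
\<close>

lemma walk_kernel_limit:
  assumes m: "(\<lambda>n. real (m n) / real n) \<longlonglongrightarrow> t"
  shows "(\<lambda>n. walk_kernel (m n) \<theta> (\<theta> + \<xi> / real n)) \<longlonglongrightarrow> cos (\<xi> * t * phase_velocity \<theta>)"
proof -
  define R where "R \<theta>' = (cos \<theta> * cos \<theta>' + cos (\<theta>' - \<theta>)) / (2 * sin (phase \<theta>) * sin (phase \<theta>'))" for \<theta>'
  have eq: "walk_kernel k \<theta> \<theta>' = cos (k * phase \<theta>' - k * phase \<theta>)
      + sin (k * phase \<theta>) * sin (k * phase \<theta>') * (R \<theta>' - 1)" for k \<theta>'
    by (simp add: walk_kernel_def R_def cos_diff algebra_simps)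
  have n0: "(\<lambda>n. 1 / real n) \<longlonglongrightarrow> 0" by (rule lim_1_over_n)
  have \<theta>n: "(\<lambda>n. \<theta> + \<xi> / real n) \<longlonglongrightarrow> \<theta>"
    using tendsto_add[OF tendsto_const[of \<theta>] tendsto_mult_left[OF n0, of \<xi>]] by simp
  have "((\<lambda>s. phase (\<theta> + \<xi> * s)) has_real_derivative phase_velocity (\<theta> + \<xi> * 0) * \<xi>) (at 0)"
    by (rule DERIV_chain2[OF phase_has_derivative]) (auto intro!: derivative_eq_intros)
  then have "((\<lambda>h. (phase (\<theta> + \<xi> * h) - phase \<theta>) / h) \<longlongrightarrow> \<xi> * phase_velocity \<theta>) (at 0)"
    by (simp add: DERIV_def mult.commute)
  moreover have "filterlim (\<lambda>n. 1 / real n) (at 0) sequentially"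
    using n0 by (simp add: filterlim_at eventually_sequentiallyI[of 1])
  ultimately have "(\<lambda>n. (phase (\<theta> + \<xi> * (1 / real n)) - phase \<theta>) / (1 / real n)) \<longlonglongrightarrow> \<xi> * phase_velocity \<theta>"
    by (rule filterlim_compose)
  from tendsto_mult[OF m this]
  have "(\<lambda>n. real (m n) / real n * ((phase (\<theta> + \<xi> * (1 / real n)) - phase \<theta>) / (1 / real n)))
     \<longlonglongrightarrow> \<xi> * t * phase_velocity \<theta>" by (simp add: mult_ac)
  then have "(\<lambda>n. real (m n) * phase (\<theta> + \<xi> / real n) - real (m n) * phase \<theta>) \<longlonglongrightarrow> \<xi> * t * phase_velocity \<theta>"
    by (rule Lim_transform_eventually)
       (auto intro!: eventually_sequentiallyI[of 1] simp: algebra_simps)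
  then have c: "(\<lambda>n. cos (real (m n) * phase (\<theta> + \<xi> / real n) - real (m n) * phase \<theta>))
      \<longlonglongrightarrow> cos (\<xi> * t * phase_velocity \<theta>)"
    by (rule tendsto_cos)
  have "isCont R \<theta>"
    unfolding R_def using sin_phase_pos[of \<theta>]
    by (intro continuous_intros continuous_within_compose3[OF isCont_phase] isCont_phase) auto
  then have "(\<lambda>n. R (\<theta> + \<xi> / real n)) \<longlonglongrightarrow> R \<theta>"
    using \<theta>n by (rule isCont_tendsto_compose)
  moreover have "R \<theta> = 1"
    using sin_phase_square[of \<theta>] sin_phase_pos[of \<theta>]
    by (simp add: R_def power2_eq_square field_simps add_nonneg_eq_0_iff)
  ultimately have "(\<lambda>n. R (\<theta> + \<xi> / real n) - 1) \<longlonglongrightarrow> 0"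
    using tendsto_diff[OF _ tendsto_const, of _ 1 _ 1] by fastforce
  then have "(\<lambda>n. (R (\<theta> + \<xi> / real n) - 1) *
      (sin (m n * phase \<theta>) * sin (m n * phase (\<theta> + \<xi> / real n)))) \<longlonglongrightarrow> 0"
    by (rule Lim_null_comparison[OF _ tendsto_norm_zero, rotated])
       (auto intro!: always_eventually mult_left_le mult_le_one simp: abs_mult)
  from tendsto_add[OF c this] show ?thesis
    by (simp add: eq mult_ac)
qed

lemma walk_kernel_bound: "\<bar>walk_kernel m \<theta> \<theta>'\<bar> \<le> 3"
proof -
  have "sqrt (1 / 2) * sqrt (1 / 2) \<le> sin (phase \<theta>) * sin (phase \<theta>')"
    by (intro mult_mono sin_phase_ge) (use sin_phase_pos[of \<theta>] in auto)
  then have s: "1 \<le> 2 * sin (phase \<theta>) * sin (phase \<theta>')" by simp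
  have ab: "\<bar>a * b\<bar> \<le> 1" if "\<bar>a\<bar> \<le> 1" "\<bar>b\<bar> \<le> 1" for a b :: real
    using that by (simp add: abs_mult mult_le_one)
  have "\<bar>cos \<theta> * cos \<theta>' + cos (\<theta>' - \<theta>)\<bar> \<le> 2"
    using ab[of "cos \<theta>" "cos \<theta>'"] abs_cos_le_one[of "\<theta>' - \<theta>"]
      abs_triangle_ineq[of "cos \<theta> * cos \<theta>'" "cos (\<theta>' - \<theta>)"] abs_cos_le_one[of \<theta>] abs_cos_le_one[of \<theta>']
    by linarith
  then have R: "\<bar>(cos \<theta> * cos \<theta>' + cos (\<theta>' - \<theta>)) / (2 * sin (phase \<theta>) * sin (phase \<theta>'))\<bar> \<le> 2"
    using s by (subst abs_divide, subst divide_le_eq) auto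
  define C where "C = cos (m * phase \<theta>) * cos (m * phase \<theta>')"
  define S where "S = sin (m * phase \<theta>) * sin (m * phase \<theta>')"
  define R where "R = (cos \<theta> * cos \<theta>' + cos (\<theta>' - \<theta>)) / (2 * sin (phase \<theta>) * sin (phase \<theta>'))"
  have "\<bar>S * R\<bar> \<le> 1 * 2"
    unfolding abs_mult using R by (intro mult_mono) (auto simp: S_def R_def intro: ab)
  moreover have "\<bar>C\<bar> \<le> 1" unfolding C_def by (intro ab) auto
  ultimately have "\<bar>C + S * R\<bar> \<le> 3" by linarith
  then show ?thesis by (simp add: walk_kernel_def C_def S_def R_def)
qed

lemma walk_kernel_integral_limit:
  assumes m: "(\<lambda>n. real (m n) / real n) \<longlonglongrightarrow> t"
  shows "(\<lambda>n. LINT \<theta>:{-pi..pi}|lborel. walk_kernel (m n) \<theta> (\<theta> + \<xi> / real n))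
     \<longlonglongrightarrow> (LINT \<theta>:{-pi..pi}|lborel. cos (\<xi> * t * phase_velocity \<theta>))"
  unfolding set_lebesgue_integral_def
proof (rule integral_dominated_convergence[where w = "\<lambda>\<theta>. indicator {-pi..pi} \<theta> *\<^sub>R 3"])
  have nz: "sin (phase \<theta>) \<noteq> 0" for \<theta> using sin_phase_pos[of \<theta>] by simp
  show "(\<lambda>\<theta>. indicator {-pi..pi} \<theta> *\<^sub>R walk_kernel (m n) \<theta> (\<theta> + \<xi> / real n)) \<in> borel_measurable lborel" for n
  proof -
    have "continuous_on UNIV (\<lambda>\<theta>. walk_kernel (m n) \<theta> (\<theta> + \<xi> / real n))"
      unfolding walk_kernel_def by (intro continuous_intros) (simp_all add: nz)
    then show ?thesis
      by (intro borel_measurable_scaleR) (auto intro: borel_measurable_continuous_onI)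
  qed
  show "(\<lambda>\<theta>. indicator {-pi..pi} \<theta> *\<^sub>R cos (\<xi> * t * phase_velocity \<theta>)) \<in> borel_measurable lborel"
    by (intro borel_measurable_scaleR)
       (auto intro!: borel_measurable_continuous_onI continuous_intros)
  show "AE \<theta> in lborel. (\<lambda>n. indicator {-pi..pi} \<theta> *\<^sub>R walk_kernel (m n) \<theta> (\<theta> + \<xi> / real n))
      \<longlonglongrightarrow> indicator {-pi..pi} \<theta> *\<^sub>R cos (\<xi> * t * phase_velocity \<theta>)"
    by (intro AE_I2 tendsto_scaleR tendsto_const walk_kernel_limit m)
  show "AE \<theta> in lborel. norm (indicator {-pi..pi} \<theta> *\<^sub>R walk_kernel (m n) \<theta> (\<theta> + \<xi> / real n))
      \<le> indicator {-pi..pi} \<theta> *\<^sub>R 3" for n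
    using walk_kernel_bound by (auto simp: indicator_def)
qed simp

text \<open>
  Under \<open>x = \<omega>'(\<theta>)\<close> the uniform density \<open>1/\<pi>\<close> on \<open>(0, \<pi>)\<close> becomes \<open>walk_density\<close>: with
  \<open>r\<^sup>2 = 1 + cos\<^sup>2 \<theta>\<close> one has \<open>1 - x\<^sup>2 = 1/r\<^sup>2\<close> and \<open>1 - 2x\<^sup>2 = sin\<^sup>2 \<theta> / r\<^sup>2\<close>, and \<open>dx = sin \<theta> / r\<^sup>3 d\<theta>\<close>.
\<close>

lemma walk_density_phase_velocity:
  assumes "0 < \<theta>" "\<theta> < pi"
  shows "phase_velocity \<theta> \<in> {- (sqrt 2 / 2)<..<sqrt 2 / 2}"
    and "sin \<theta> / (sqrt (1 + (cos \<theta>)\<^sup>2)) ^ 3 * walk_density (phase_velocity \<theta>) = 1 / pi"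
proof -
  define r where "r = sqrt (1 + (cos \<theta>)\<^sup>2)"
  have r: "0 < r" "r\<^sup>2 = 1 + (cos \<theta>)\<^sup>2" by (auto simp: r_def add_pos_nonneg)
  have s: "0 < sin \<theta>" using assms by (rule sin_gt_zero)
  have v: "phase_velocity \<theta> = - cos \<theta> / r" by (simp add: phase_velocity_def r_def)
  have v2: "(phase_velocity \<theta>)\<^sup>2 = (r\<^sup>2 - 1) / r\<^sup>2" by (simp add: v r(2) power_divide)
  have "1 - 2 * (phase_velocity \<theta>)\<^sup>2 = (2 - r\<^sup>2) / r\<^sup>2"
    unfolding v2 using r(1) by (simp add: field_simps)
  also have "2 - r\<^sup>2 = (sin \<theta>)\<^sup>2" by (simp add: r(2) sin_squared_eq)
  finally have v3: "1 - 2 * (phase_velocity \<theta>)\<^sup>2 = (sin \<theta> / r)\<^sup>2" by (simp add: power_divide)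
  have v4: "1 - (phase_velocity \<theta>)\<^sup>2 = 1 / r\<^sup>2" unfolding v2 using r(1) by (simp add: field_simps)
  have "0 < 1 - 2 * (phase_velocity \<theta>)\<^sup>2" unfolding v3 using s r(1) by simp
  then have "(phase_velocity \<theta>)\<^sup>2 < (sqrt 2 / 2)\<^sup>2" by (simp add: power_divide)
  then have "\<bar>phase_velocity \<theta>\<bar>\<^sup>2 < (sqrt 2 / 2)\<^sup>2" by (simp only: power2_abs)
  then have "\<bar>phase_velocity \<theta>\<bar> < sqrt 2 / 2" by (rule power2_less_imp_less) simp
  then show mem: "phase_velocity \<theta> \<in> {- (sqrt 2 / 2)<..<sqrt 2 / 2}" by (auto simp: abs_less_iff)
  have "sqrt (1 - 2 * (phase_velocity \<theta>)\<^sup>2) = sin \<theta> / r" unfolding v3 using s r(1) by simp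
  then have "walk_density (phase_velocity \<theta>) = 1 / (pi * (1 / r\<^sup>2) * (sin \<theta> / r))"
    unfolding walk_density_def v4 using mem by simp
  then show "sin \<theta> / (sqrt (1 + (cos \<theta>)\<^sup>2)) ^ 3 * walk_density (phase_velocity \<theta>) = 1 / pi"
    unfolding r_def[symmetric] using r(1) s by (simp add: field_simps power2_eq_square power3_eq_cube)
qed

lemma isCont_walk_density:
  assumes "x \<in> {- (sqrt 2 / 2)<..<sqrt 2 / 2}"
  shows "isCont walk_density x"
proof -
  have "\<bar>x\<bar> < sqrt 2 / 2" using assms by auto
  then have "\<bar>x\<bar>\<^sup>2 < (sqrt 2 / 2)\<^sup>2" by (intro power_strict_mono) auto
  then have x: "x\<^sup>2 < 1 / 2" by (simp add: power_divide)
  have "\<forall>\<^sub>F y in nhds x. walk_density y = 1 / (pi * (1 - y\<^sup>2) * sqrt (1 - 2 * y\<^sup>2))"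
    by (rule eventually_mono[OF eventually_nhds_in_open[OF open_greaterThanLessThan assms]])
       (simp add: walk_density_def)
  moreover have "isCont (\<lambda>y. 1 / (pi * (1 - y\<^sup>2) * sqrt (1 - 2 * y\<^sup>2))) x"
    using x by (intro continuous_intros) auto
  ultimately show ?thesis by (simp add: isCont_cong)
qed

lemma phase_velocity_has_derivative:
  "(phase_velocity has_real_derivative sin \<theta> / (sqrt (1 + (cos \<theta>)\<^sup>2)) ^ 3) (at \<theta>)"
proof -
  define r where "r = sqrt (1 + (cos \<theta>)\<^sup>2)"
  have r: "0 < r" "r\<^sup>2 = 1 + (cos \<theta>)\<^sup>2" by (auto simp: r_def add_pos_nonneg)
  have d: "((\<lambda>\<theta>. sqrt (1 + (cos \<theta>)\<^sup>2)) has_real_derivative - (cos \<theta> * sin \<theta>) / r) (at \<theta>)"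
    unfolding r_def by (auto intro!: derivative_eq_intros simp: one_plus_square_neq_0 field_simps)
  have d1: "((\<lambda>\<theta>. - cos \<theta>) has_real_derivative sin \<theta>) (at \<theta>)"
    by (auto intro!: derivative_eq_intros)
  have "(phase_velocity has_real_derivative
      (sin \<theta> * r - (- cos \<theta>) * (- (cos \<theta> * sin \<theta>) / r)) / (r * r)) (at \<theta>)"
    unfolding phase_velocity_def[abs_def] r_def
    using DERIV_divide[OF d1 d] r(1) unfolding r_def by simp
  also have "(sin \<theta> * r - (- cos \<theta>) * (- (cos \<theta> * sin \<theta>) / r)) / (r * r)
      = sin \<theta> * (r\<^sup>2 - (cos \<theta>)\<^sup>2) / r ^ 3"
    using r(1) by (simp add: field_simps power2_eq_square power3_eq_cube)
  also have "\<dots> = sin \<theta> / r ^ 3" by (simp add: r(2))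
  finally show ?thesis by (simp add: r_def)
qed

lemma walk_density_measurable [measurable]: "walk_density \<in> borel_measurable borel"
  using borel_measurable_integrable[OF walk_density_integral(1)] by simp

text \<open>
  The velocity at a uniform angle has density \<open>walk_density\<close>, stated for the test functions that
  occur in characteristic functions.
\<close>

lemma phase_velocity_integral:
  "(LINT \<theta>:{-pi..pi}|lborel. cos (a * phase_velocity \<theta>)) / (2 * pi)
     = (LBINT x. cos (a * x) * walk_density x)"
proof -
  let ?c = "sqrt 2 / 2" and ?f = "\<lambda>x. cos (a * x) * walk_density x"
  let ?h = "\<lambda>\<theta>. cos (a * phase_velocity \<theta>)"
  let ?v' = "\<lambda>\<theta>. sin \<theta> / (sqrt (1 + (cos \<theta>)\<^sup>2)) ^ 3"
  have cont: "continuous_on S ?h" for S by (intro continuous_intros)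
  have ci: "isCont phase_velocity \<theta>" for \<theta>
    using phase_velocity_has_derivative by (rule DERIV_isCont)
  have int: "integrable lborel ?f"
    by (rule Bochner_Integration.integrable_bound[OF walk_density_integral(1)])
       (auto simp: abs_mult mult_left_le_one_le)
  have pull: "?v' \<theta> *\<^sub>R ?f (phase_velocity \<theta>) = ?h \<theta> * (1 / pi)" if "0 < \<theta>" "\<theta> < pi" for \<theta>
  proof -
    have "?v' \<theta> *\<^sub>R ?f (phase_velocity \<theta>) = ?h \<theta> * (?v' \<theta> * walk_density (phase_velocity \<theta>))" by simp
    then show ?thesis unfolding walk_density_phase_velocity(2)[OF that] .
  qed
  have int_pull: "set_integrable lborel (einterval 0 pi) (\<lambda>\<theta>. ?v' \<theta> *\<^sub>R ?f (phase_velocity \<theta>))"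
  proof -
    have "set_integrable lborel {0..pi} (\<lambda>\<theta>. ?h \<theta> * (1 / pi))"
      by (intro borel_integrable_atLeastAtMost' continuous_intros)
    then have "set_integrable lborel {0<..<pi} (\<lambda>\<theta>. ?h \<theta> * (1 / pi))"
      by (rule set_integrable_subset) auto
    moreover have "einterval 0 (ereal pi) = {0<..<pi}" by (auto simp: einterval_def)
    moreover have "set_integrable lborel {0<..<pi} (\<lambda>\<theta>. ?v' \<theta> *\<^sub>R ?f (phase_velocity \<theta>))
        = set_integrable lborel {0<..<pi} (\<lambda>\<theta>. ?h \<theta> * (1 / pi))"
      by (intro set_integrable_cong refl pull) auto
    ultimately show ?thesis by (simp only:)
  qed
  \<comment> \<open>On \<open>(0, \<pi>)\<close> the velocity increases from \<open>-\<surd>2/2\<close> to \<open>\<surd>2/2\<close>.  The density blows up at both ends, so the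
      substitution is made on open intervals.\<close>
  have "(LBINT x=ereal (- ?c)..ereal ?c. ?f x) = (LBINT \<theta>=0..ereal pi. ?v' \<theta> *\<^sub>R ?f (phase_velocity \<theta>))"
  proof (rule interval_integral_substitution_integrable)
    show "0 < ereal pi" by simp
    show "(phase_velocity has_real_derivative ?v' x) (at x)" for x
      by (rule phase_velocity_has_derivative)
    show "isCont ?f (phase_velocity x)" if "0 < ereal x" "ereal x < ereal pi" for x
      using walk_density_phase_velocity(1)[of x] that
      by (intro continuous_intros isCont_walk_density) auto
    show "isCont ?v' x" for x
      by (intro continuous_intros) (simp add: one_plus_square_neq_0)
    show "0 \<le> ?v' x" if "0 \<le> ereal x" "ereal x \<le> ereal pi" for x
      using that by (intro divide_nonneg_nonneg sin_ge_zero) auto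
    have c: "phase_velocity 0 = - ?c" "phase_velocity pi = ?c"
      by (simp_all add: phase_velocity_def real_div_sqrt field_simps)
    show "((ereal \<circ> phase_velocity \<circ> real_of_ereal) \<longlongrightarrow> ereal (- ?c)) (at_right 0)"
      using isContD[OF ci[of 0], THEN tendsto_within_subset, of "{0<..}"] unfolding c(1)
      by (simp add: zero_ereal_def ereal_tendsto_simps)
    show "((ereal \<circ> phase_velocity \<circ> real_of_ereal) \<longlongrightarrow> ereal ?c) (at_left (ereal pi))"
      using isContD[OF ci[of pi], THEN tendsto_within_subset, of "{..<pi}"] unfolding c(2)
      by (simp add: ereal_tendsto_simps)
    show "set_integrable lborel (einterval (ereal (- ?c)) (ereal ?c)) ?f"
      unfolding set_integrable_def by (rule integrable_mult_indicator[OF _ int]) simp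
  qed (rule int_pull)
  also have "\<dots> = (LBINT \<theta>=ereal 0..ereal pi. ?h \<theta>) / pi"
    unfolding zero_ereal_def using pull
    by (subst interval_lebesgue_integral_divide[symmetric], intro interval_integral_cong) auto
  also have "(LBINT x=ereal (- ?c)..ereal ?c. ?f x) = (LBINT x. ?f x)"
    by (simp add: interval_integral_Ioo set_lebesgue_integral_def walk_density_def)
       (intro Bochner_Integration.integral_cong, auto simp: indicator_def)
  finally have half: "(LBINT \<theta>=ereal 0..ereal pi. ?h \<theta>) = pi * (LBINT x. ?f x)" by simp
  \<comment> \<open>The velocity is even in \<open>\<theta>\<close>, so the other half of the circle contributes the same amount.\<close>
  have "(LBINT \<theta>=ereal (- pi)..ereal 0. ?h \<theta>) = (LBINT \<theta>=ereal 0..ereal pi. ?h \<theta>)"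
    by (subst interval_integral_reflect) (simp add: phase_velocity_def)
  moreover have "(LBINT \<theta>=ereal (- pi)..ereal 0. ?h \<theta>) + (LBINT \<theta>=ereal 0..ereal pi. ?h \<theta>)
      = (LBINT \<theta>=ereal (- pi)..ereal pi. ?h \<theta>)"
    by (rule interval_integral_sum)
       (use cont in \<open>auto simp: interval_lebesgue_integrable_def min_def max_def
          intro!: set_integrable_subset[OF borel_integrable_atLeastAtMost'[OF cont[of "{-pi..pi}"]]]\<close>)
  ultimately have "(LINT \<theta>:{-pi..pi}|lborel. ?h \<theta>) = 2 * pi * (LBINT x. ?f x)"
    using half by (simp add: interval_integral_Icc)
  then show ?thesis by simp
qed

definition walk_law :: "nat \<Rightarrow> int pmf" where
  "walk_law m = embed_pmf (mean_detection m)"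

lemma pmf_walk_law: "pmf (walk_law m) k = mean_detection m k"
  unfolding walk_law_def
proof (rule pmf_embed_pmf[OF mean_detection_nonneg])
  have "(\<integral>\<^sup>+ k. ennreal (mean_detection m k) \<partial>count_space UNIV) = (\<Sum>k\<in>{-int m..int m}. ennreal (mean_detection m k))"
    by (rule nn_integral_count_space') (auto simp: mean_detection_eq_0)
  then show "(\<integral>\<^sup>+ k. ennreal (mean_detection m k) \<partial>count_space UNIV) = 1"
    by (simp add: sum_ennreal mean_detection_nonneg mean_detection_sum)
qed

lemma expectation_walk_law:
  fixes f :: "int \<Rightarrow> 'b::{banach, second_countable_topology}"
  shows "(LINT k|walk_law m. f k) = (\<Sum>k\<in>{-int m..int m}. mean_detection m k *\<^sub>R f k)"
proof -
  have "k \<in> {-int m..int m}" if "k \<in> set_pmf (walk_law m)" for k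
    using that mean_detection_eq_0[of m k] by (force simp: set_pmf_iff pmf_walk_law)
  then show ?thesis
    by (subst integral_measure_pmf[of "{-int m..int m}"]) (simp_all add: pmf_walk_law)
qed

lemma scaled_density_integral:
  fixes F :: "real \<Rightarrow> 'b::{banach, second_countable_topology}"
  assumes "t > 0"
  shows "(LBINT x. scaled_density t x *\<^sub>R F x) = (LBINT u. walk_density u *\<^sub>R F (t * u))"
  using assms by (subst lborel_integral_real_affine[of t _ 0]) (simp_all add: scaled_density_def flip: integral_scaleR_right)

lemma scaled_density_nonneg: "t > 0 \<Longrightarrow> 0 \<le> scaled_density t x"
  by (simp add: scaled_density_def walk_density_nonneg)

lemma scaled_density_measurable [measurable]: "scaled_density t \<in> borel_measurable borel"
  unfolding scaled_density_def[abs_def] by measurable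

lemma integrable_scaled_density:
  assumes "t > 0"
  shows "integrable lborel (scaled_density t)"
  using integrable_mult_right[OF lborel_integrable_real_affine[OF walk_density_integral(1), of "1 / t" 0], of "1 / t"] assms
  by (simp add: scaled_density_def[abs_def])

lemma walk_density_even: "walk_density (- x) = walk_density x"
  by (auto simp: walk_density_def)

text \<open>
  The limit density is even, so its characteristic function is a cosine transform.
\<close>

lemma char_scaled_density:
  assumes t: "t > 0"
  shows "char (density lborel (scaled_density t)) \<xi> = of_real (LBINT x. cos (\<xi> * t * x) * walk_density x)"
proof -
  have int: "complex_integrable lborel (\<lambda>u. walk_density u *\<^sub>R iexp (\<xi> * (t * u)))"
    by (rule Bochner_Integration.integrable_bound[OF walk_density_integral(1)]) auto
  have "char (density lborel (scaled_density t)) \<xi> = (CLBINT x. scaled_density t x *\<^sub>R iexp (\<xi> * x))"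
    unfolding char_def using scaled_density_nonneg[OF t] by (subst integral_density) auto
  also have "\<dots> = (CLBINT u. walk_density u *\<^sub>R iexp (\<xi> * (t * u)))"
    by (rule scaled_density_integral[OF t])
  also have "\<dots> = of_real (LBINT x. cos (\<xi> * t * x) * walk_density x)"
  proof (rule complex_eqI)
    show "Re (CLBINT u. walk_density u *\<^sub>R iexp (\<xi> * (t * u))) = Re (of_real (LBINT x. cos (\<xi> * t * x) * walk_density x))"
      using int by (simp add: integral_Re[symmetric] Re_exp mult_ac)
    have "(LBINT u. walk_density u * sin (\<xi> * (t * u))) = - (LBINT u. walk_density u * sin (\<xi> * (t * u)))"
      by (subst lborel_integral_real_affine[of "-1" _ 0]) (simp_all add: walk_density_even)
    then show "Im (CLBINT u. walk_density u *\<^sub>R iexp (\<xi> * (t * u))) = Im (of_real (LBINT x. cos (\<xi> * t * x) * walk_density x))"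
      using int by (simp add: integral_Im[symmetric] Im_exp mult_ac)
  qed
  finally show ?thesis .
qed

text \<open>
  Levy's continuity theorem reduces the claim to characteristic functions, which are given by
  \<open>mean_detection_fourier\<close>, converge by dominated convergence, and have the right limit by the
  substitution \<open>phase_velocity_integral\<close>.
\<close>

lemma walk_law_weak_limit:
  assumes m: "(\<lambda>n. real (m n) / real n) \<longlonglongrightarrow> t" and t: "t > 0"
    and g: "continuous_on UNIV g" "\<And>x. \<bar>g x\<bar> \<le> B"
  shows "(\<lambda>n. LINT k|walk_law (m n). g (real_of_int k / real n)) \<longlonglongrightarrow> (LBINT x. scaled_density t x * g x :: real)"
proof -
  define \<mu> where "\<mu> n = distr (measure_pmf (walk_law (m n))) borel (\<lambda>k. real_of_int k / real n)" for n
  define \<nu> where "\<nu> = density lborel (scaled_density t)"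
  have \<mu>: "real_distribution (\<mu> n)" for n
    unfolding \<mu>_def by (intro prob_space.real_distribution_distr measure_pmf.prob_space_axioms) simp
  have mass: "(LBINT x. scaled_density t x) = 1"
    using scaled_density_integral[OF t, of "\<lambda>_. 1 :: real"] by (simp add: walk_density_integral)
  have "emeasure \<nu> (space \<nu>) = 1"
    using nn_integral_eq_integral[OF integrable_scaled_density[OF t]] scaled_density_nonneg[OF t]
    by (simp add: \<nu>_def emeasure_density mass)
  then have "prob_space \<nu>" by (rule prob_spaceI)
  then have \<nu>: "real_distribution \<nu>"
    by (simp add: real_distribution_def real_distribution_axioms_def \<nu>_def)
  have "weak_conv_m \<mu> \<nu>"
  proof (rule levy_continuity[OF \<mu> \<nu>])
    fix \<xi>
    have "char (\<mu> n) \<xi> = of_real ((LINT \<theta>:{-pi..pi}|lborel. walk_kernel (m n) \<theta> (\<theta> + \<xi> / real n)) / (2 * pi))" for n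
    proof -
      have "char (\<mu> n) \<xi> = (LINT k|walk_law (m n). iexp (\<xi> * (real_of_int k / real n)))"
        unfolding char_def \<mu>_def by (rule integral_distr) auto
      then show ?thesis
        unfolding expectation_walk_law mean_detection_fourier[symmetric]
        by (simp add: scaleR_conv_of_real cis_conv_exp mult_ac)
    qed
    moreover have "(\<lambda>n. (LINT \<theta>:{-pi..pi}|lborel. walk_kernel (m n) \<theta> (\<theta> + \<xi> / real n)) / (2 * pi))
        \<longlonglongrightarrow> (LBINT x. cos (\<xi> * t * x) * walk_density x)"
      unfolding phase_velocity_integral[symmetric]
      by (intro tendsto_divide walk_kernel_integral_limit m) auto
    ultimately show "(\<lambda>n. char (\<mu> n) \<xi>) \<longlonglongrightarrow> char \<nu> \<xi>"
      unfolding \<nu>_def char_scaled_density[OF t] by (simp only: tendsto_of_real)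
  qed
  then have "(\<lambda>n. integral\<^sup>L (\<mu> n) g) \<longlonglongrightarrow> integral\<^sup>L \<nu> g"
    by (rule weak_conv_imp_integral_bdd_continuous_conv[OF \<mu> \<nu>])
       (use g in \<open>auto simp: continuous_on_eq_continuous_at\<close>)
  moreover have [measurable]: "g \<in> borel_measurable borel"
    using g(1) by (rule borel_measurable_continuous_onI)
  have "integral\<^sup>L (\<mu> n) g = (LINT k|walk_law (m n). g (real_of_int k / real n))" for n
    unfolding \<mu>_def by (rule integral_distr) auto
  moreover have "integral\<^sup>L \<nu> g = (LBINT x. scaled_density t x * g x)"
    unfolding \<nu>_def using scaled_density_nonneg[OF t] by (subst integral_density) auto
  ultimately show ?thesis by simp
qed

section \<open>Sums over Poisson numbers of independent marks\<close>

text \<open>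
  Both series reduce to the exponential series after an index shift, as \<open>k / k! = 1 / (k - 1)!\<close>.
\<close>

lemma poisson_law_sums:
  assumes r: "0 \<le> r"
  shows "(\<lambda>k. pmf (poisson_law r) k * real k) sums r"
    and "(\<lambda>k. pmf (poisson_law r) k * (real k)\<^sup>2) sums (r + r\<^sup>2)"
proof -
  have p: "pmf (poisson_law r) k = r ^ k / fact k * exp (- r)" for k
    using r by (cases k) (auto simp: poisson_law_def pmf_return)
  have e: "(\<lambda>k. r ^ k / fact k * exp (- r)) sums 1"
    using sums_mult2[OF exp_converges[of r], of "exp (- r)"]
    by (simp add: divide_inverse exp_minus_inverse mult.commute[of "inverse _"])
  have f1: "pmf (poisson_law r) (Suc k) * real (Suc k) = r * (r ^ k / fact k * exp (- r))" for k
    unfolding p by (simp add: field_simps del: of_nat_Suc)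
  show s1: "(\<lambda>k. pmf (poisson_law r) k * real k) sums r"
    using sums_mult[OF e, of r] unfolding f1[symmetric]
    by (subst (asm) sums_Suc_iff) simp
  have f2: "pmf (poisson_law r) (Suc k) * (real (Suc k))\<^sup>2
      = r * (pmf (poisson_law r) k * real k) + r * (r ^ k / fact k * exp (- r))" for k
  proof -
    have "pmf (poisson_law r) (Suc k) * (real (Suc k))\<^sup>2
        = (pmf (poisson_law r) (Suc k) * real (Suc k)) * real (Suc k)"
      by (simp only: power2_eq_square mult.assoc)
    then show ?thesis unfolding f1 unfolding p by (simp add: algebra_simps add_divide_distrib)
  qed
  have "(\<lambda>k. pmf (poisson_law r) (Suc k) * (real (Suc k))\<^sup>2) sums (r * r + r * 1)"
    unfolding f2 by (intro sums_add sums_mult s1 e)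
  then show "(\<lambda>k. pmf (poisson_law r) k * (real k)\<^sup>2) sums (r + r\<^sup>2)"
    by (subst (asm) sums_Suc_iff) (simp add: power2_eq_square add.commute)
qed

lemma nat_pmf_expectation_sums:
  fixes f :: "nat \<Rightarrow> real"
  assumes "\<And>k. 0 \<le> f k" and s: "(\<lambda>k. pmf p k * f k) sums s"
  shows "integrable (measure_pmf p) f" "(LINT k|p. f k) = s"
proof -
  have i: "integrable (count_space UNIV) (\<lambda>k. pmf p k * f k)"
    using assms by (simp add: integrable_count_space_nat_iff sums_iff)
  show "integrable (measure_pmf p) f"
    using i unfolding measure_pmf_eq_density by (subst integrable_density) auto
  show "(LINT k|p. f k) = s"
    using i s unfolding measure_pmf_eq_density
    by (subst integral_density) (auto simp: integral_count_space_nat sums_iff)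
qed

context prob_space
begin

lemma poisson_variable_moments:
  fixes N :: "'a \<Rightarrow> nat"
  assumes [measurable]: "N \<in> measurable M (count_space UNIV)"
    and law: "distr M (count_space UNIV) N = measure_pmf (poisson_law r)" and r: "0 \<le> r"
  shows "integrable M (\<lambda>\<omega>. real (N \<omega>))" "integrable M (\<lambda>\<omega>. (real (N \<omega>))\<^sup>2)"
    and "expectation (\<lambda>\<omega>. real (N \<omega>)) = r" "expectation (\<lambda>\<omega>. (real (N \<omega>) - r)\<^sup>2) = r"
proof -
  have push: "integrable M (\<lambda>\<omega>. f (N \<omega>)) \<longleftrightarrow> integrable (measure_pmf (poisson_law r)) f"
    "expectation (\<lambda>\<omega>. f (N \<omega>)) = (LINT k|poisson_law r. f k)" for f :: "nat \<Rightarrow> real"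
    unfolding law[symmetric] by (simp_all add: integrable_distr_eq integral_distr)
  note m1 = nat_pmf_expectation_sums[OF _ poisson_law_sums(1)[OF r]]
  note m2 = nat_pmf_expectation_sums[OF _ poisson_law_sums(2)[OF r]]
  show i: "integrable M (\<lambda>\<omega>. real (N \<omega>))" "integrable M (\<lambda>\<omega>. (real (N \<omega>))\<^sup>2)"
    using m1 m2 push(1)[of real] push(1)[of "\<lambda>k. (real k)\<^sup>2"] by auto
  show e: "expectation (\<lambda>\<omega>. real (N \<omega>)) = r"
    using m1 push(2)[of real] by auto
  have e2: "expectation (\<lambda>\<omega>. (real (N \<omega>))\<^sup>2) = r + r\<^sup>2"
    using m2 push(2)[of "\<lambda>k. (real k)\<^sup>2"] by auto
  show "expectation (\<lambda>\<omega>. (real (N \<omega>) - r)\<^sup>2) = r"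
    using variance_eq[OF i] unfolding e e2 by simp
qed

text \<open>
  Pythagoras in \<open>L\<^sup>2\<close>.
\<close>

lemma orthogonal_sum_second_moment:
  fixes f :: "'i \<Rightarrow> 'a \<Rightarrow> real"
  assumes int: "\<And>i j. i \<in> A \<Longrightarrow> j \<in> A \<Longrightarrow> integrable M (\<lambda>\<omega>. f i \<omega> * f j \<omega>)"
    and orth: "\<And>i j. i \<in> A \<Longrightarrow> j \<in> A \<Longrightarrow> i \<noteq> j \<Longrightarrow> expectation (\<lambda>\<omega>. f i \<omega> * f j \<omega>) = 0"
    and A: "finite A"
  shows "integrable M (\<lambda>\<omega>. (\<Sum>i\<in>A. f i \<omega>)\<^sup>2)"
    and "expectation (\<lambda>\<omega>. (\<Sum>i\<in>A. f i \<omega>)\<^sup>2) = (\<Sum>i\<in>A. expectation (\<lambda>\<omega>. (f i \<omega>)\<^sup>2))"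
proof -
  have eq: "(\<lambda>\<omega>. (\<Sum>i\<in>A. f i \<omega>)\<^sup>2) = (\<lambda>\<omega>. \<Sum>i\<in>A. \<Sum>j\<in>A. f i \<omega> * f j \<omega>)"
    by (simp add: power2_eq_square sum_product)
  show "integrable M (\<lambda>\<omega>. (\<Sum>i\<in>A. f i \<omega>)\<^sup>2)"
    unfolding eq by (intro Bochner_Integration.integrable_sum int)
  have "expectation (\<lambda>\<omega>. (\<Sum>i\<in>A. f i \<omega>)\<^sup>2) = (\<Sum>i\<in>A. expectation (\<lambda>\<omega>. \<Sum>j\<in>A. f i \<omega> * f j \<omega>))"
    unfolding eq by (intro Bochner_Integration.integral_sum Bochner_Integration.integrable_sum int)
  also have "\<dots> = (\<Sum>i\<in>A. \<Sum>j\<in>A. expectation (\<lambda>\<omega>. f i \<omega> * f j \<omega>))"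
    by (intro sum.cong refl Bochner_Integration.integral_sum int)
  also have "\<dots> = (\<Sum>i\<in>A. \<Sum>j\<in>A. if i = j then expectation (\<lambda>\<omega>. (f i \<omega>)\<^sup>2) else 0)"
    by (intro sum.cong refl) (auto simp: orth power2_eq_square)
  finally show "expectation (\<lambda>\<omega>. (\<Sum>i\<in>A. f i \<omega>)\<^sup>2) = (\<Sum>i\<in>A. expectation (\<lambda>\<omega>. (f i \<omega>)\<^sup>2))"
    using A by simp
qed

lemma indep_vars_expectation_mult:
  fixes f g :: "_ \<Rightarrow> real"
  assumes "indep_vars M' X I" "i \<in> I" "j \<in> I" "i \<noteq> j"
    and "f \<in> borel_measurable (M' i)" "g \<in> borel_measurable (M' j)"
    and "integrable M (\<lambda>\<omega>. f (X i \<omega>))" "integrable M (\<lambda>\<omega>. g (X j \<omega>))"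
  shows "integrable M (\<lambda>\<omega>. f (X i \<omega>) * g (X j \<omega>))"
    and "expectation (\<lambda>\<omega>. f (X i \<omega>) * g (X j \<omega>))
      = expectation (\<lambda>\<omega>. f (X i \<omega>)) * expectation (\<lambda>\<omega>. g (X j \<omega>))"
proof -
  have "indep_var (PiM {i} M') (\<lambda>\<omega>. restrict (\<lambda>i. X i \<omega>) {i}) (PiM {j} M') (\<lambda>\<omega>. restrict (\<lambda>i. X i \<omega>) {j})"
    using assms by (intro indep_var_restrict) auto
  from indep_var_compose[OF this, of "\<lambda>h. f (h i)" borel "\<lambda>h. g (h j)" borel]
  have "indep_var borel (\<lambda>\<omega>. f (X i \<omega>)) borel (\<lambda>\<omega>. g (X j \<omega>))"
    using assms(5,6) by (simp add: comp_def measurable_compose[OF measurable_component_singleton])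
  then show "integrable M (\<lambda>\<omega>. f (X i \<omega>) * g (X j \<omega>))"
    and "expectation (\<lambda>\<omega>. f (X i \<omega>) * g (X j \<omega>))
      = expectation (\<lambda>\<omega>. f (X i \<omega>)) * expectation (\<lambda>\<omega>. g (X j \<omega>))"
    using indep_var_integrable indep_var_lebesgue_integral assms(7,8) by blast+
qed

text \<open>
  Independence of two generated \<open>\<sigma>\<close>-algebras, in the form that applies to expectations of products.
  The variables \<open>Y\<close> and \<open>Z\<close> may have values in different types, whereas \<open>indep_var\<close> relates variables
  of one type; hence the passage to real functions of them.
\<close>

lemma indep_set_vimage_algebra_imp_indep_var:
  fixes u :: "'b \<Rightarrow> real" and v :: "'c \<Rightarrow> real"
  assumes indep: "indep_set (sets (vimage_algebra (space M) Y S)) (sets (vimage_algebra (space M) Z T))"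
    and [measurable]: "Y \<in> measurable M S" "Z \<in> measurable M T" "u \<in> borel_measurable S" "v \<in> borel_measurable T"
  shows "indep_var borel (\<lambda>\<omega>. u (Y \<omega>)) borel (\<lambda>\<omega>. v (Z \<omega>))"
proof -
  have sub: "sigma_sets (space M) {(\<lambda>\<omega>. w (W \<omega>)) -` A \<inter> space M | A. A \<in> sets borel}
      \<subseteq> sets (vimage_algebra (space M) W R)"
    if W: "W \<in> measurable M R" and w: "w \<in> borel_measurable R" for W :: "'a \<Rightarrow> 'd" and R and w :: "'d \<Rightarrow> real"
  proof -
    have "{(\<lambda>\<omega>. w (W \<omega>)) -` A \<inter> space M | A. A \<in> sets borel} \<subseteq> sets (vimage_algebra (space M) W R)"
    proof clarify
      fix A :: "real set" assume "A \<in> sets borel"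
      then have "w -` A \<inter> space R \<in> sets R" using w by (rule measurable_sets[rotated])
      then have "W -` (w -` A \<inter> space R) \<inter> space M \<in> sets (vimage_algebra (space M) W R)"
        by (rule in_vimage_algebra)
      also have "W -` (w -` A \<inter> space R) \<inter> space M = (\<lambda>\<omega>. w (W \<omega>)) -` A \<inter> space M"
        using measurable_space[OF W] by auto
      finally show "(\<lambda>\<omega>. w (W \<omega>)) -` A \<inter> space M \<in> sets (vimage_algebra (space M) W R)" .
    qed
    from sets.sigma_sets_subset[OF this] show ?thesis by simp
  qed
  have "indep_set (sigma_sets (space M) {(\<lambda>\<omega>. u (Y \<omega>)) -` A \<inter> space M | A. A \<in> sets borel})
      (sigma_sets (space M) {(\<lambda>\<omega>. v (Z \<omega>)) -` A \<inter> space M | A. A \<in> sets borel})"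
    using indep unfolding indep_set_def
    by (rule indep_sets_mono_sets) (use sub[of Y S u] sub[of Z T v] in \<open>auto split: bool.splits\<close>)
  then show ?thesis
    unfolding indep_var_eq by simp
qed

text \<open>
  A law of large numbers for \<open>N\<^sub>i\<close> marks \<open>X\<^sub>i\<^sub>,\<^sub>1, X\<^sub>i\<^sub>,\<^sub>2, \<dots>\<close> per index \<open>i\<close>.  With \<open>D\<close> the centred marks, the
  deviation is \<open>S + V\<close>, where \<open>S = \<Sum>\<^sub>i \<Sum>\<^sub>j\<^sub>\<le>\<^sub>N\<^sub>i D\<^sub>i\<^sub>,\<^sub>j\<close> is the fluctuation of the marks and
  \<open>V = \<Sum>\<^sub>i \<mu>\<^sub>i (N\<^sub>i - r\<^sub>i)\<close> that of the numbers.  Each is a sum of orthogonal terms with second moment at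
  most \<open>C\<^sup>2 \<Sum>\<^sub>i r\<^sub>i\<close>, and Chebyshev's inequality at level \<open>\<epsilon>/2\<close> for each gives the factor \<open>8\<close>.
\<close>

lemma poisson_marked_sum_deviation:
  fixes N :: "'a \<Rightarrow> 'i \<Rightarrow> nat" and X :: "'i \<Rightarrow> nat \<Rightarrow> 'a \<Rightarrow> 'b" and g :: "'b \<Rightarrow> real"
  assumes F: "finite F" "F \<subseteq> J"
    and N_indep: "indep_vars (\<lambda>_. count_space UNIV) (\<lambda>i \<omega>. N \<omega> i) UNIV"
    and N_law: "\<And>i. i \<in> F \<Longrightarrow> distr M (count_space UNIV) (\<lambda>\<omega>. N \<omega> i) = measure_pmf (poisson_law (r i))"
    and r: "\<And>i. i \<in> F \<Longrightarrow> 0 \<le> r i"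
    and X_indep: "indep_vars (\<lambda>_. count_space UNIV) (\<lambda>(i, j). X i j) (J \<times> {1..})"
    and NX_indep: "indep_set
      (sets (vimage_algebra (space M) N (\<Pi>\<^sub>M i\<in>UNIV. count_space UNIV)))
      (sets (vimage_algebra (space M) (\<lambda>\<omega>. restrict (\<lambda>(i, j). X i j \<omega>) (J \<times> {1..}))
        (\<Pi>\<^sub>M p\<in>J \<times> {1..}. count_space UNIV)))"
    and g: "\<And>x. \<bar>g x\<bar> \<le> C"
    and mean: "\<And>i j. i \<in> F \<Longrightarrow> 1 \<le> j \<Longrightarrow> expectation (\<lambda>\<omega>. g (X i j \<omega>)) = \<mu> i"
    and \<epsilon>: "0 < \<epsilon>"
  shows "(\<lambda>\<omega>. \<Sum>i\<in>F. \<Sum>j=1..N \<omega> i. g (X i j \<omega>)) \<in> borel_measurable M"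
    and "prob {\<omega>\<in>space M. \<epsilon> < \<bar>(\<Sum>i\<in>F. \<Sum>j=1..N \<omega> i. g (X i j \<omega>)) - (\<Sum>i\<in>F. r i * \<mu> i)\<bar>}
      \<le> 8 * C\<^sup>2 * (\<Sum>i\<in>F. r i) / \<epsilon>\<^sup>2"
proof -
  define \<Lambda> where "\<Lambda> = (\<Sum>i\<in>F. r i)"
  have N_meas [measurable]: "(\<lambda>\<omega>. N \<omega> i) \<in> measurable M (count_space UNIV)" for i
    using N_indep by (auto simp: indep_vars_def)
  have X_meas: "X i j \<in> measurable M (count_space UNIV)" if "i \<in> F" "1 \<le> j" for i j
    using X_indep F(2) that by (auto simp: indep_vars_def)
  have N_PiM: "N \<in> measurable M (\<Pi>\<^sub>M i\<in>UNIV. count_space UNIV)"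
    using measurable_restrict[OF N_meas, where I = UNIV] by (simp add: restrict_UNIV)
  have X_PiM: "(\<lambda>\<omega>. restrict (\<lambda>(i, j). X i j \<omega>) (J \<times> {1..}))
      \<in> measurable M (\<Pi>\<^sub>M p\<in>J \<times> {1..}. count_space UNIV)"
    by (rule measurable_restrict) (use X_indep in \<open>auto simp: indep_vars_def split: prod.splits\<close>)
  have gX_meas [measurable]: "(\<lambda>\<omega>. g (X i j \<omega>)) \<in> borel_measurable M" if "i \<in> F" "1 \<le> j" for i j
    using X_meas[OF that] by (rule measurable_compose) simp
  have sum_meas: "(\<lambda>\<omega>. \<Sum>j=1..N \<omega> i. h j \<omega>) \<in> borel_measurable M"
    if "\<And>j. 1 \<le> j \<Longrightarrow> h j \<in> borel_measurable M" for h :: "nat \<Rightarrow> 'a \<Rightarrow> real" and i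
    by (rule measurable_compose_countable[where f = "\<lambda>n \<omega>. \<Sum>j=1..n. h j \<omega>", OF _ N_meas])
       (auto intro!: borel_measurable_sum that)
  show meas [measurable]: "(\<lambda>\<omega>. \<Sum>i\<in>F. \<Sum>j=1..N \<omega> i. g (X i j \<omega>)) \<in> borel_measurable M"
    by (intro borel_measurable_sum sum_meas gX_meas)
  note mom = poisson_variable_moments[OF N_meas N_law r]
  have C0: "0 \<le> C" using g by (meson abs_ge_zero order_trans)
  have int_g: "integrable M (\<lambda>\<omega>. g (X i j \<omega>))" if "i \<in> F" "1 \<le> j" for i j
    using gX_meas[OF that] g by (intro integrable_const_bound[of _ C]) auto
  have \<mu>: "\<bar>\<mu> i\<bar> \<le> C" if "i \<in> F" for i
  proof -
    have "\<bar>expectation (\<lambda>\<omega>. g (X i 1 \<omega>))\<bar> \<le> expectation (\<lambda>\<omega>. \<bar>g (X i 1 \<omega>)\<bar>)"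
      by (rule integral_abs_bound)
    also have "\<dots> \<le> expectation (\<lambda>\<omega>. C)"
      using int_g[OF that] g by (intro integral_mono) auto
    finally show ?thesis using mean[OF that, of 1] by (simp add: prob_space)
  qed
  define D where "D i j \<omega> = g (X i j \<omega>) - \<mu> i" for i j \<omega>
  have D_meas [measurable]: "D i j \<in> borel_measurable M" if "i \<in> F" "1 \<le> j" for i j
    unfolding D_def using gX_meas[OF that] by measurable
  have D_bound: "\<bar>D i j \<omega>\<bar> \<le> 2 * C" if "i \<in> F" for i j \<omega>
    using g[of "X i j \<omega>"] \<mu>[OF that] unfolding D_def by linarith
  have D_mean: "expectation (D i j) = 0" if "i \<in> F" "1 \<le> j" for i j
    unfolding D_def using int_g[OF that] mean[OF that] by (simp add: prob_space)
  have D_var: "expectation (\<lambda>\<omega>. (D i j \<omega>)\<^sup>2) \<le> C\<^sup>2" if "i \<in> F" "1 \<le> j" for i j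
  proof -
    have i2: "integrable M (\<lambda>\<omega>. (g (X i j \<omega>))\<^sup>2)"
      using gX_meas[OF that] g C0
      by (intro integrable_const_bound[of _ "C\<^sup>2"]) (auto simp: power2_le_iff_abs_le)
    have "expectation (\<lambda>\<omega>. (D i j \<omega>)\<^sup>2) = expectation (\<lambda>\<omega>. (g (X i j \<omega>))\<^sup>2) - (\<mu> i)\<^sup>2"
      unfolding D_def using variance_eq[OF int_g[OF that] i2] by (simp add: mean[OF that])
    also have "\<dots> \<le> expectation (\<lambda>\<omega>. (g (X i j \<omega>))\<^sup>2)" by simp
    also have "\<dots> \<le> expectation (\<lambda>\<omega>. C\<^sup>2)"
      using i2 g C0 by (intro integral_mono) (auto simp: power2_le_iff_abs_le)
    finally show ?thesis by (simp add: prob_space)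
  qed
  \<comment> \<open>Summands with the random range \<open>j \<le> N\<^sub>i\<close> turned into an indicator factor, so that independence of numbers and
      marks can be used.\<close>
  define T where "T = (\<lambda>(i, j) \<omega>. of_bool (j \<le> N \<omega> i) * D i j \<omega>)"
  have T_mult: "integrable M (\<lambda>\<omega>. T a \<omega> * T b \<omega>)"
      "expectation (\<lambda>\<omega>. T a \<omega> * T b \<omega>)
        = expectation (\<lambda>\<omega>. of_bool (snd a \<le> N \<omega> (fst a)) * of_bool (snd b \<le> N \<omega> (fst b)))
          * expectation (\<lambda>\<omega>. D (fst a) (snd a) \<omega> * D (fst b) (snd b) \<omega>)"
    if "a \<in> F \<times> {1..}" "b \<in> F \<times> {1..}" for a b
  proof -
    let ?u = "\<lambda>h :: 'i \<Rightarrow> nat. of_bool (snd a \<le> h (fst a)) * of_bool (snd b \<le> h (fst b)) :: real"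
    let ?v = "\<lambda>h :: 'i \<times> nat \<Rightarrow> 'b. (g (h a) - \<mu> (fst a)) * (g (h b) - \<mu> (fst b))"
    have ab: "a \<in> J \<times> {1..}" "b \<in> J \<times> {1..}" using that F(2) by auto
    have mu: "?u \<in> borel_measurable (\<Pi>\<^sub>M i\<in>UNIV. count_space UNIV)" by measurable
    have mv: "?v \<in> borel_measurable (\<Pi>\<^sub>M p\<in>J \<times> {1..}. count_space UNIV)"
      using ab by (intro borel_measurable_times borel_measurable_diff borel_measurable_const
          measurable_compose[OF measurable_component_singleton]) auto
    have v: "?v (restrict (\<lambda>(i, j). X i j \<omega>) (J \<times> {1..})) = D (fst a) (snd a) \<omega> * D (fst b) (snd b) \<omega>" for \<omega>
      using ab by (auto simp: D_def split: prod.splits)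
    have ind: "indep_var borel (\<lambda>\<omega>. ?u (N \<omega>)) borel (\<lambda>\<omega>. D (fst a) (snd a) \<omega> * D (fst b) (snd b) \<omega>)"
      using indep_set_vimage_algebra_imp_indep_var[OF NX_indep N_PiM X_PiM mu mv] unfolding v .
    have iu: "integrable M (\<lambda>\<omega>. ?u (N \<omega>))"
      by (intro integrable_const_bound[of _ 1]) (auto simp: of_bool_def)
    have iv: "integrable M (\<lambda>\<omega>. D (fst a) (snd a) \<omega> * D (fst b) (snd b) \<omega>)"
    proof (rule integrable_const_bound)
      show "AE \<omega> in M. norm (D (fst a) (snd a) \<omega> * D (fst b) (snd b) \<omega>) \<le> (2 * C) * (2 * C)"
        unfolding real_norm_def abs_mult
        by (intro AE_I2 mult_mono D_bound) (use that C0 in auto)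
    qed (use that D_meas in auto)
    have T: "(\<lambda>\<omega>. T a \<omega> * T b \<omega>) = (\<lambda>\<omega>. ?u (N \<omega>) * (D (fst a) (snd a) \<omega> * D (fst b) (snd b) \<omega>))"
      by (auto simp: T_def split: prod.splits)
    show "integrable M (\<lambda>\<omega>. T a \<omega> * T b \<omega>)"
      unfolding T by (rule indep_var_integrable[OF ind iu iv])
    show "expectation (\<lambda>\<omega>. T a \<omega> * T b \<omega>) = expectation (\<lambda>\<omega>. ?u (N \<omega>))
          * expectation (\<lambda>\<omega>. D (fst a) (snd a) \<omega> * D (fst b) (snd b) \<omega>)"
      unfolding T by (rule indep_var_lebesgue_integral[OF ind iu iv])
  qed
  \<comment> \<open>Distinct marks are independent and centred.  Two marks of the same index are included, although their indicator
      factors are dependent.\<close>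
  have T_orth: "expectation (\<lambda>\<omega>. T a \<omega> * T b \<omega>) = 0" if "a \<in> F \<times> {1..}" "b \<in> F \<times> {1..}" "a \<noteq> b" for a b
  proof -
    obtain i j k l where ab: "a = (i, j)" "b = (k, l)" by (cases a, cases b)
    have "expectation (\<lambda>\<omega>. D i j \<omega> * D k l \<omega>) = expectation (D i j) * expectation (D k l)"
      using indep_vars_expectation_mult(2)[OF X_indep, of a b "\<lambda>x. g x - \<mu> i" "\<lambda>x. g x - \<mu> k"] that F(2) int_g
      by (simp add: ab D_def[abs_def] subset_iff)
    then show ?thesis
      unfolding T_mult(2)[OF that(1,2)] using that D_mean by (simp add: ab)
  qed
  \<comment> \<open>Only finitely many summands can be handled by orthogonality, hence the truncation at \<open>K\<close>; the bound is
      uniform in \<open>K\<close> because \<open>\<Sum>\<^sub>j\<^sub>\<le>\<^sub>K 1[j \<le> N\<^sub>i] \<le> N\<^sub>i\<close>.\<close>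
  have trunc: "prob {\<omega>\<in>space M. a \<le> \<bar>\<Sum>p\<in>F \<times> {1..K}. T p \<omega>\<bar>} \<le> C\<^sup>2 * \<Lambda> / a\<^sup>2" if "0 < a" for a :: real and K :: nat
  proof -
    let ?S = "\<lambda>\<omega>. \<Sum>p\<in>F \<times> {1..K}. T p \<omega>"
    have T_meas: "T p \<in> borel_measurable M" if "p \<in> F \<times> {1..K}" for p
      using that D_meas by (auto simp: T_def)
    have sub: "p \<in> F \<times> {1..K} \<Longrightarrow> p \<in> F \<times> {1..}" for p by auto
    have fin: "finite (F \<times> {1..K})" using F(1) by simp
    note moment = orthogonal_sum_second_moment[OF T_mult(1)[OF sub sub] T_orth[OF sub sub] fin]
    have i: "integrable M (\<lambda>\<omega>. (?S \<omega>)\<^sup>2)"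
      by (rule moment(1))
    have e: "expectation (\<lambda>\<omega>. (?S \<omega>)\<^sup>2) = (\<Sum>p\<in>F \<times> {1..K}. expectation (\<lambda>\<omega>. (T p \<omega>)\<^sup>2))"
      by (rule moment(2))
    have ib: "integrable M (\<lambda>\<omega>. of_bool (j \<le> N \<omega> i) :: real)" for i j
      by (intro integrable_const_bound[of _ 1]) auto
    have "expectation (\<lambda>\<omega>. (T (i, j) \<omega>)\<^sup>2) \<le> expectation (\<lambda>\<omega>. of_bool (j \<le> N \<omega> i)) * C\<^sup>2"
      if "i \<in> F" "1 \<le> j" for i j
    proof -
      have "expectation (\<lambda>\<omega>. (T (i, j) \<omega>)\<^sup>2)
          = expectation (\<lambda>\<omega>. of_bool (j \<le> N \<omega> i)) * expectation (\<lambda>\<omega>. (D i j \<omega>)\<^sup>2)"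
        using T_mult(2)[of "(i, j)" "(i, j)"] that by (simp add: power2_eq_square of_bool_conj[symmetric])
      also have "\<dots> \<le> expectation (\<lambda>\<omega>. of_bool (j \<le> N \<omega> i)) * C\<^sup>2"
        using D_var[OF that] by (intro mult_left_mono) auto
      finally show ?thesis .
    qed
    then have "expectation (\<lambda>\<omega>. (?S \<omega>)\<^sup>2) \<le> (\<Sum>i\<in>F. \<Sum>j=1..K. expectation (\<lambda>\<omega>. of_bool (j \<le> N \<omega> i)) * C\<^sup>2)"
      unfolding e sum.cartesian_product by (intro sum_mono) auto
    also have "\<dots> = (\<Sum>i\<in>F. expectation (\<lambda>\<omega>. \<Sum>j=1..K. of_bool (j \<le> N \<omega> i)) * C\<^sup>2)"
    proof (intro sum.cong refl)
      fix i
      show "(\<Sum>j=1..K. expectation (\<lambda>\<omega>. of_bool (j \<le> N \<omega> i)) * C\<^sup>2)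
          = expectation (\<lambda>\<omega>. \<Sum>j=1..K. of_bool (j \<le> N \<omega> i)) * C\<^sup>2"
        unfolding sum_distrib_right[symmetric] by (subst Bochner_Integration.integral_sum) (auto simp: ib)
    qed
    also have "\<dots> \<le> (\<Sum>i\<in>F. r i * C\<^sup>2)"
    proof (intro sum_mono mult_right_mono)
      fix i assume i: "i \<in> F"
      have "(\<Sum>j=1..K. of_bool (j \<le> N \<omega> i)) \<le> real (N \<omega> i)" for \<omega>
      proof -
        have "(\<Sum>j=1..K. of_bool (j \<le> N \<omega> i)) = real (card ({1..K} \<inter> {j. j \<le> N \<omega> i}))"
          by (simp add: sum_of_bool_eq)
        also have "\<dots> \<le> real (card {1..N \<omega> i})"
          by (intro of_nat_mono card_mono) auto
        finally show ?thesis by simp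
      qed
      then have "expectation (\<lambda>\<omega>. \<Sum>j=1..K. of_bool (j \<le> N \<omega> i)) \<le> expectation (\<lambda>\<omega>. real (N \<omega> i))"
        by (intro integral_mono Bochner_Integration.integrable_sum ib mom(1)[OF i i])
      then show "expectation (\<lambda>\<omega>. \<Sum>j=1..K. of_bool (j \<le> N \<omega> i)) \<le> r i"
        using mom(3)[OF i i] by simp
    qed simp
    finally have "expectation (\<lambda>\<omega>. (?S \<omega>)\<^sup>2) \<le> C\<^sup>2 * \<Lambda>"
      by (simp only: \<Lambda>_def sum_distrib_left mult.commute[of _ "C\<^sup>2"])
    then have "expectation (\<lambda>\<omega>. (?S \<omega>)\<^sup>2) / a\<^sup>2 \<le> C\<^sup>2 * \<Lambda> / a\<^sup>2"
      by (intro divide_right_mono) auto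
    moreover have "prob {\<omega>\<in>space M. a \<le> \<bar>?S \<omega>\<bar>} \<le> expectation (\<lambda>\<omega>. (?S \<omega>)\<^sup>2) / a\<^sup>2"
      using T_meas by (intro second_moment_method i that borel_measurable_sum)
    ultimately show ?thesis by linarith
  qed
  define S where "S \<omega> = (\<Sum>i\<in>F. \<Sum>j=1..N \<omega> i. D i j \<omega>)" for \<omega>
  have S_meas [measurable]: "S \<in> borel_measurable M"
    unfolding S_def[abs_def] by (intro borel_measurable_sum sum_meas D_meas)
  have S_tail: "prob {\<omega>\<in>space M. a \<le> \<bar>S \<omega>\<bar>} \<le> C\<^sup>2 * \<Lambda> / a\<^sup>2" if a: "0 < a" for a
  proof -
    \<comment> \<open>The truncation matters only if some \<open>N\<^sub>i\<close> exceeds \<open>K\<close>, which Markov's inequality makes unlikely.\<close>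
    have "prob {\<omega>\<in>space M. a \<le> \<bar>S \<omega>\<bar>} \<le> C\<^sup>2 * \<Lambda> / a\<^sup>2 + \<Lambda> / real (Suc K)" for K
    proof -
      let ?A = "{\<omega>\<in>space M. a \<le> \<bar>\<Sum>p\<in>F \<times> {1..K}. T p \<omega>\<bar>}"
      let ?B = "\<lambda>i. {\<omega>\<in>space M. real (Suc K) \<le> real (N \<omega> i)}"
      have T_meas [measurable]: "T p \<in> borel_measurable M" if "p \<in> F \<times> {1..K}" for p
        using that D_meas by (auto simp: T_def)
      have agree: "S \<omega> = (\<Sum>p\<in>F \<times> {1..K}. T p \<omega>)" if "\<And>i. i \<in> F \<Longrightarrow> N \<omega> i \<le> K" for \<omega>
      proof -
        have "(\<Sum>j=1..N \<omega> i. D i j \<omega>) = (\<Sum>j=1..K. T (i, j) \<omega>)" if "i \<in> F" for i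
          using \<open>\<And>i. i \<in> F \<Longrightarrow> N \<omega> i \<le> K\<close>[OF that]
          by (intro sum.mono_neutral_cong_left) (auto simp: T_def)
        then have "S \<omega> = (\<Sum>i\<in>F. \<Sum>j\<in>{1..K}. T (i, j) \<omega>)"
          unfolding S_def by (rule sum.cong[OF refl])
        then show ?thesis unfolding sum.cartesian_product by (simp add: split_def)
      qed
      have "{\<omega>\<in>space M. a \<le> \<bar>S \<omega>\<bar>} \<subseteq> ?A \<union> (\<Union>i\<in>F. ?B i)"
      proof
        fix \<omega> assume w: "\<omega> \<in> {\<omega>\<in>space M. a \<le> \<bar>S \<omega>\<bar>}"
        show "\<omega> \<in> ?A \<union> (\<Union>i\<in>F. ?B i)"
        proof (cases "\<exists>i\<in>F. K < N \<omega> i")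
          case True
          then obtain i where "i \<in> F" "Suc K \<le> N \<omega> i" by (auto simp: Suc_le_eq)
          then have "i \<in> F" "\<omega> \<in> ?B i" using w by (auto simp del: of_nat_Suc)
          then show ?thesis by blast
        next
          case False
          then have "N \<omega> i \<le> K" if "i \<in> F" for i using that by (auto simp: not_less)
          from agree[OF this] show ?thesis using w by auto
        qed
      qed
      moreover have B: "?B i \<in> events" for i by measurable
      then have UB: "(\<Union>i\<in>F. ?B i) \<in> events" by (intro sets.finite_UN F(1))
      moreover have A: "?A \<in> events" by measurable
      ultimately have "prob {\<omega>\<in>space M. a \<le> \<bar>S \<omega>\<bar>} \<le> prob (?A \<union> (\<Union>i\<in>F. ?B i))"
        by (intro finite_measure_mono sets.Un)
      also have "\<dots> \<le> prob ?A + prob (\<Union>i\<in>F. ?B i)"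
        by (intro measure_Un_le A UB)
      also have "prob (\<Union>i\<in>F. ?B i) \<le> (\<Sum>i\<in>F. prob (?B i))"
        using B by (intro finite_measure_subadditive_finite F(1)) auto
      also have "(\<Sum>i\<in>F. prob (?B i)) \<le> (\<Sum>i\<in>F. r i / real (Suc K))"
      proof (intro sum_mono)
        fix i assume i: "i \<in> F"
        have "prob (?B i) \<le> expectation (\<lambda>\<omega>. real (N \<omega> i)) / real (Suc K)"
          using mom(1)[OF i i] by (intro integral_Markov_inequality_measure[where A = "{}"]) auto
        then show "prob (?B i) \<le> r i / real (Suc K)" using mom(3)[OF i i] by simp
      qed
      also have "\<dots> = \<Lambda> / real (Suc K)" by (simp add: \<Lambda>_def sum_divide_distrib)
      finally show ?thesis using trunc[OF a, of K] by linarith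
    qed
    moreover have "(\<lambda>K. C\<^sup>2 * \<Lambda> / a\<^sup>2 + \<Lambda> / real (Suc K)) \<longlonglongrightarrow> C\<^sup>2 * \<Lambda> / a\<^sup>2 + 0"
      by (intro tendsto_add tendsto_const LIMSEQ_Suc[OF lim_const_over_n])
    ultimately show ?thesis
      using LIMSEQ_le_const by fastforce
  qed
  define V where "V \<omega> = (\<Sum>i\<in>F. \<mu> i * (real (N \<omega> i) - r i))" for \<omega>
  have V_tail: "prob {\<omega>\<in>space M. a \<le> \<bar>V \<omega>\<bar>} \<le> C\<^sup>2 * \<Lambda> / a\<^sup>2" if a: "0 < a" for a
  proof -
    let ?f = "\<lambda>i \<omega>. \<mu> i * (real (N \<omega> i) - r i)"
    have sq: "integrable M (\<lambda>\<omega>. (real (N \<omega> i) - r i)\<^sup>2)" if "i \<in> F" for i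
      using mom(1,2)[OF that that] by (simp add: power2_diff)
    have mult: "integrable M (\<lambda>\<omega>. (real (N \<omega> i) - r i) * (real (N \<omega> k) - r k)) \<and>
        expectation (\<lambda>\<omega>. (real (N \<omega> i) - r i) * (real (N \<omega> k) - r k)) = 0"
      if "i \<in> F" "k \<in> F" "i \<noteq> k" for i k
      using indep_vars_expectation_mult[OF N_indep _ _ that(3), of "\<lambda>n. real n - r i" "\<lambda>n. real n - r k"]
        mom(1,3)[OF that(1) that(1)] mom(1,3)[OF that(2) that(2)] by (simp add: prob_space)
    have int: "integrable M (\<lambda>\<omega>. ?f i \<omega> * ?f k \<omega>)" if "i \<in> F" "k \<in> F" for i k
    proof -
      have "integrable M (\<lambda>\<omega>. (real (N \<omega> i) - r i) * (real (N \<omega> k) - r k))"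
        using mult[OF that] sq[OF that(1)] by (cases "i = k") (auto simp: power2_eq_square)
      from integrable_mult_right[OF this, of "\<mu> i * \<mu> k"] show ?thesis by (simp add: mult_ac)
    qed
    \<comment> \<open>Here the terms are uncorrelated because the numbers \<open>N\<^sub>i\<close> are independent.\<close>
    have orth: "expectation (\<lambda>\<omega>. ?f i \<omega> * ?f k \<omega>) = 0" if "i \<in> F" "k \<in> F" "i \<noteq> k" for i k
    proof -
      have "expectation (\<lambda>\<omega>. ?f i \<omega> * ?f k \<omega>)
          = expectation (\<lambda>\<omega>. (\<mu> i * \<mu> k) * ((real (N \<omega> i) - r i) * (real (N \<omega> k) - r k)))"
        by (simp add: mult_ac)
      then show ?thesis using mult[OF that] by simp
    qed
    have "expectation (\<lambda>\<omega>. (V \<omega>)\<^sup>2) = (\<Sum>i\<in>F. expectation (\<lambda>\<omega>. (?f i \<omega>)\<^sup>2))"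
      unfolding V_def by (rule orthogonal_sum_second_moment(2)[OF int orth F(1)])
    also have "\<dots> = (\<Sum>i\<in>F. (\<mu> i)\<^sup>2 * r i)"
      by (intro sum.cong refl) (simp add: power_mult_distrib mom(4))
    also have "\<dots> \<le> (\<Sum>i\<in>F. C\<^sup>2 * r i)"
      using \<mu> r C0 by (intro sum_mono mult_right_mono) (auto simp: power2_le_iff_abs_le)
    finally have "expectation (\<lambda>\<omega>. (V \<omega>)\<^sup>2) / a\<^sup>2 \<le> C\<^sup>2 * \<Lambda> / a\<^sup>2"
      by (intro divide_right_mono) (auto simp: \<Lambda>_def sum_distrib_left)
    moreover have "integrable M (\<lambda>\<omega>. (V \<omega>)\<^sup>2)"
      unfolding V_def by (rule orthogonal_sum_second_moment(1)[OF int orth F(1)])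
    then have "prob {\<omega>\<in>space M. a \<le> \<bar>V \<omega>\<bar>} \<le> expectation (\<lambda>\<omega>. (V \<omega>)\<^sup>2) / a\<^sup>2"
      by (intro second_moment_method a) (auto simp: V_def[abs_def])
    ultimately show ?thesis by linarith
  qed
  have split: "(\<Sum>i\<in>F. \<Sum>j=1..N \<omega> i. g (X i j \<omega>)) - (\<Sum>i\<in>F. r i * \<mu> i) = S \<omega> + V \<omega>" for \<omega>
  proof -
    have inner: "(\<Sum>j=1..N \<omega> i. D i j \<omega>) = (\<Sum>j=1..N \<omega> i. g (X i j \<omega>)) - real (N \<omega> i) * \<mu> i" for i
      by (simp add: D_def sum_subtractf)
    have "S \<omega> + V \<omega> = (\<Sum>i\<in>F. (\<Sum>j=1..N \<omega> i. g (X i j \<omega>)) - r i * \<mu> i)"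
      unfolding S_def V_def inner sum.distrib[symmetric] by (intro sum.cong refl) (simp add: algebra_simps)
    then show ?thesis by (simp only: sum_subtractf)
  qed
  have [measurable]: "V \<in> borel_measurable M" unfolding V_def[abs_def] by measurable
  have "prob {\<omega>\<in>space M. \<epsilon> < \<bar>(\<Sum>i\<in>F. \<Sum>j=1..N \<omega> i. g (X i j \<omega>)) - (\<Sum>i\<in>F. r i * \<mu> i)\<bar>}
      \<le> prob ({\<omega>\<in>space M. \<epsilon> / 2 \<le> \<bar>S \<omega>\<bar>} \<union> {\<omega>\<in>space M. \<epsilon> / 2 \<le> \<bar>V \<omega>\<bar>})"
    unfolding split by (intro finite_measure_mono) auto
  also have "\<dots> \<le> prob {\<omega>\<in>space M. \<epsilon> / 2 \<le> \<bar>S \<omega>\<bar>} + prob {\<omega>\<in>space M. \<epsilon> / 2 \<le> \<bar>V \<omega>\<bar>}"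
    by (intro measure_Un_le) auto
  also have "\<dots> \<le> C\<^sup>2 * \<Lambda> / (\<epsilon> / 2)\<^sup>2 + C\<^sup>2 * \<Lambda> / (\<epsilon> / 2)\<^sup>2"
    using \<epsilon> by (intro add_mono S_tail V_tail) auto
  also have "\<dots> = 8 * C\<^sup>2 * (\<Sum>i\<in>F. r i) / \<epsilon>\<^sup>2"
    by (simp add: \<Lambda>_def power_divide)
  finally show "prob {\<omega>\<in>space M. \<epsilon> < \<bar>(\<Sum>i\<in>F. \<Sum>j=1..N \<omega> i. g (X i j \<omega>)) - (\<Sum>i\<in>F. r i * \<mu> i)\<bar>}
      \<le> 8 * C\<^sup>2 * (\<Sum>i\<in>F. r i) / \<epsilon>\<^sup>2" .
qed

end

section \<open>Riemann sums and the limit of the mean\<close>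

lemma compact_support_bound:
  assumes "compact_support g"
  obtains R where "0 < R" "\<And>x. R < \<bar>x\<bar> \<Longrightarrow> g x = 0"
proof -
  have "bounded {x. g x \<noteq> 0}"
    using assms bounded_subset[OF compact_imp_bounded closure_subset] by (auto simp: compact_support_def)
  then obtain R where "0 < R" "\<forall>x\<in>{x. g x \<noteq> 0}. norm x \<le> R" by (auto simp: bounded_pos)
  then show thesis by (intro that[of R]) force+
qed

lemma compact_support_imp_bounded:
  assumes "continuous_on UNIV g" "compact_support g"
  obtains C where "0 < C" "\<And>x. \<bar>g x\<bar> \<le> C"
proof -
  obtain R where R: "0 < R" "\<And>x. R < \<bar>x\<bar> \<Longrightarrow> g x = 0"
    using compact_support_bound[OF assms(2)] by blast
  have "compact (g ` {-R..R})"
    using continuous_on_subset[OF assms(1)] by (intro compact_continuous_image) auto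
  then obtain C where C: "0 < C" "\<forall>y\<in>g ` {-R..R}. norm y \<le> C"
    using compact_imp_bounded[THEN bounded_pos[THEN iffD1]] by blast
  have "\<bar>g x\<bar> \<le> C" for x
    using C R(2)[of x] by (cases "\<bar>x\<bar> \<le> R") (auto simp: abs_le_iff)
  then show thesis using C(1) that by blast
qed

text \<open>
  If \<open>g\<close> vanishes outside \<open>[-R, R]\<close>, uniform continuity on \<open>[-R - 1, R + 1]\<close> is enough: of two points at
  distance less than \<open>1\<close>, either both lie in that interval or both lie outside \<open>[-R, R]\<close>.
\<close>

lemma compact_support_imp_uniformly_continuous:
  assumes "continuous_on UNIV g" "compact_support g"
  shows "uniformly_continuous_on UNIV g"
  unfolding uniformly_continuous_on_def
proof (intro allI impI)
  fix e :: real assume e: "0 < e"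
  obtain R where R: "0 < R" "\<And>x. R < \<bar>x\<bar> \<Longrightarrow> g x = 0"
    using compact_support_bound[OF assms(2)] by blast
  have "uniformly_continuous_on {-R-1..R+1} g"
    using continuous_on_subset[OF assms(1)] by (intro compact_uniformly_continuous) auto
  then obtain d where d: "0 < d"
      "\<And>x y. x \<in> {-R-1..R+1} \<Longrightarrow> y \<in> {-R-1..R+1} \<Longrightarrow> dist y x < d \<Longrightarrow> dist (g y) (g x) < e"
    unfolding uniformly_continuous_on_def using e by metis
  have "dist (g y) (g x) < e" if "dist y x < min d 1" for x y
  proof (cases "x \<in> {-R-1..R+1} \<and> y \<in> {-R-1..R+1}")
    case True
    then show ?thesis using d(2) that by auto
  next
    case False
    then have "R < \<bar>x\<bar>" "R < \<bar>y\<bar>" using that by (auto simp: dist_real_def)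
    then show ?thesis using R(2) e by simp
  qed
  then show "\<exists>d>0. \<forall>x\<in>UNIV. \<forall>y\<in>UNIV. dist y x < d \<longrightarrow> dist (g y) (g x) < e"
    using d(1) by (intro exI[of _ "min d 1"]) auto
qed

lemma floor_div_tendsto: "(\<lambda>n. real_of_int \<lfloor>real n * y\<rfloor> / real n) \<longlonglongrightarrow> y"
proof -
  have "(\<lambda>n. real_of_int \<lfloor>real n * y\<rfloor> / real n - y) \<longlonglongrightarrow> 0"
  proof (rule Lim_null_comparison)
    show "\<forall>\<^sub>F n in sequentially. norm (real_of_int \<lfloor>real n * y\<rfloor> / real n - y) \<le> 1 / real n"
    proof (rule eventually_sequentiallyI)
      fix n :: nat assume n: "1 \<le> n"
      have "real_of_int \<lfloor>real n * y\<rfloor> / real n - y = (real_of_int \<lfloor>real n * y\<rfloor> - real n * y) / real n"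
        using n by (simp add: field_simps)
      moreover have "\<bar>real_of_int \<lfloor>real n * y\<rfloor> - real n * y\<bar> \<le> 1" by linarith
      ultimately show "norm (real_of_int \<lfloor>real n * y\<rfloor> / real n - y) \<le> 1 / real n"
        by (simp add: abs_divide divide_right_mono)
    qed
    show "(\<lambda>n. 1 / real n) \<longlonglongrightarrow> 0" by (rule lim_1_over_n)
  qed
  then show ?thesis by (rule LIM_zero_cancel)
qed

text \<open>
  The sites \<open>k\<close> with \<open>\<bar>k/n\<bar> \<le> R\<close>, multiplied out so that \<open>n = 0\<close> is harmless.
\<close>

definition lattice_points :: "real \<Rightarrow> nat \<Rightarrow> int set" where
  "lattice_points R n = {k. \<bar>real_of_int k\<bar> \<le> R * real n}"

lemma finite_lattice_points: "finite (lattice_points R n)"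
proof (rule finite_subset)
  show "lattice_points R n \<subseteq> {- \<lceil>R * real n\<rceil>..\<lceil>R * real n\<rceil>}"
    unfolding lattice_points_def by (auto simp: abs_le_iff) linarith+
qed simp

text \<open>
  The Riemann sum is the integral of the step function \<open>y \<mapsto> \<phi>\<^sub>n(\<lfloor>ny\<rfloor>/n)\<close>, so dominated convergence
  applies.  The summand depends on \<open>n\<close> because it will contain the law of the walk.
\<close>

lemma riemann_sum_tendsto:
  fixes \<phi> :: "nat \<Rightarrow> real \<Rightarrow> real"
  assumes supp: "\<And>n x. R < \<bar>x\<bar> \<Longrightarrow> \<phi> n x = 0"
    and bound: "\<And>n x. \<bar>\<phi> n x\<bar> \<le> C"
    and lim: "\<And>y. (\<lambda>n. \<phi> n (real_of_int \<lfloor>real n * y\<rfloor> / real n)) \<longlonglongrightarrow> \<psi> y"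
  shows "(\<lambda>n. 1 / real n * (\<Sum>k\<in>lattice_points R n. \<phi> n (real_of_int k / real n))) \<longlonglongrightarrow> (LBINT y. \<psi> y)"
proof -
  define s where "s n y = \<phi> n (real_of_int \<lfloor>real n * y\<rfloor> / real n)" for n y
  let ?I = "\<lambda>n k. {real_of_int k / real n..<(real_of_int k + 1) / real n}"
  have s_eq: "s n y = (\<Sum>k\<in>lattice_points R n. \<phi> n (real_of_int k / real n) * indicator (?I n k) y)" if n: "1 \<le> n" for n y
  proof -
    have mem: "y \<in> ?I n k \<longleftrightarrow> k = \<lfloor>real n * y\<rfloor>" for k
      using n by (auto simp: field_simps floor_eq_iff eq_commute[of k])
    have out: "s n y = 0" if "\<lfloor>real n * y\<rfloor> \<notin> lattice_points R n"
      unfolding s_def using that n by (intro supp) (auto simp: lattice_points_def field_simps abs_divide)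
    have "(\<Sum>k\<in>lattice_points R n. \<phi> n (real_of_int k / real n) * indicator (?I n k) y)
        = (\<Sum>k\<in>lattice_points R n. if k = \<lfloor>real n * y\<rfloor> then s n y else 0)"
    proof (intro sum.cong refl)
      fix k
      have "indicator (?I n k) y = (if k = \<lfloor>real n * y\<rfloor> then 1 else 0 :: real)"
        by (simp only: indicator_def mem of_bool_def)
      then show "\<phi> n (real_of_int k / real n) * indicator (?I n k) y = (if k = \<lfloor>real n * y\<rfloor> then s n y else 0)"
        by (simp only:) (simp add: s_def)
    qed
    also have "\<dots> = s n y" using out finite_lattice_points by (simp add: sum.delta)
    finally show ?thesis by simp
  qed
  have s_meas: "s n \<in> borel_measurable lborel" if "1 \<le> n" for n
    unfolding s_eq[OF that, abs_def] by measurable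
  have s_int: "(LBINT y. s n y) = 1 / real n * (\<Sum>k\<in>lattice_points R n. \<phi> n (real_of_int k / real n))" if n: "1 \<le> n" for n
  proof -
    have I: "measure lborel (?I n k) = 1 / real n" for k
      using n by (simp add: divide_right_mono diff_divide_distrib[symmetric])
    have fin: "emeasure lborel (?I n k) < \<infinity>" for k
      using n by (simp add: divide_right_mono)
    show ?thesis
      unfolding s_eq[OF n] using I fin
      by (subst Bochner_Integration.integral_sum) (auto simp: sum_distrib_left mult.commute)
  qed
  \<comment> \<open>\<open>\<lfloor>ny\<rfloor>/n\<close> differs from \<open>y\<close> by at most \<open>1/n \<le> 1\<close>, hence the margin \<open>1\<close> around \<open>[-R, R]\<close>.\<close>
  have dom: "\<bar>s n y\<bar> \<le> indicator {-R-1..R+1} y * C" if n: "1 \<le> n" for n y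
  proof (cases "y \<in> {-R-1..R+1}")
    case True
    then show ?thesis using bound by (simp add: s_def)
  next
    case False
    have f: "real_of_int \<lfloor>real n * y\<rfloor> \<le> real n * y" "real n * y - 1 \<le> real_of_int \<lfloor>real n * y\<rfloor>"
      by linarith+
    have "real_of_int \<lfloor>real n * y\<rfloor> / real n \<le> y"
      using f(1) n by (simp add: divide_le_eq mult.commute)
    moreover have "y - 1 \<le> real_of_int \<lfloor>real n * y\<rfloor> / real n"
      using f(2) n by (simp add: le_divide_eq algebra_simps)
    ultimately have "\<bar>real_of_int \<lfloor>real n * y\<rfloor> / real n - y\<bar> \<le> 1" by linarith
    then have "R < \<bar>real_of_int \<lfloor>real n * y\<rfloor> / real n\<bar>"
      using False by (simp only: atLeastAtMost_iff) linarith
    then show ?thesis using False by (simp add: s_def supp)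
  qed
  \<comment> \<open>At \<open>n = 0\<close> the step function need not have bounded support; hence the shift of the index.\<close>
  have "(\<lambda>n. LBINT y. s (Suc n) y) \<longlonglongrightarrow> (LBINT y. \<psi> y)"
  proof (rule integral_dominated_convergence[where w = "\<lambda>y. indicator {-R-1..R+1} y * C"])
    have lim': "(\<lambda>n. s (Suc n) y) \<longlonglongrightarrow> \<psi> y" for y
      using LIMSEQ_Suc[OF lim[of y]] by (simp only: s_def)
    show "\<psi> \<in> borel_measurable lborel"
      by (rule borel_measurable_LIMSEQ_real[OF lim' s_meas]) simp
    show "AE y in lborel. (\<lambda>n. s (Suc n) y) \<longlonglongrightarrow> \<psi> y" using lim' by simp
    show "integrable lborel (\<lambda>y. indicator {-R-1..R+1} y * C)"
      by (intro integrable_mult_left integrable_real_indicator) (auto simp: emeasure_lborel_Icc_eq)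
    show "AE y in lborel. norm (s (Suc n) y) \<le> indicator {-R-1..R+1} y * C" for n
      using dom[of "Suc n"] by simp
  qed (rule s_meas, simp)
  then have "(\<lambda>n. LBINT y. s n y) \<longlonglongrightarrow> (LBINT y. \<psi> y)" by (rule LIMSEQ_imp_Suc)
  then show ?thesis
    by (rule Lim_transform_eventually) (rule eventually_sequentiallyI[of 1], rule s_int)
qed

text \<open>
  Fubini, after the translation \<open>x = y + u\<close>.
\<close>

lemma integral_rho:
  assumes t: "t > 0" and \<gamma>: "continuous_on UNIV \<gamma>" "compact_support \<gamma>"
    and G: "continuous_on UNIV G" "compact_support G"
  shows "(LBINT y. \<gamma> y * (LBINT u. scaled_density t u * G (y + u))) = (LBINT x. G x * rho \<gamma> t x)"
proof -
  obtain C where C: "\<And>x. \<bar>G x\<bar> \<le> C" using compact_support_imp_bounded[OF G] by blast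
  have [measurable]: "\<gamma> \<in> borel_measurable borel" "G \<in> borel_measurable borel"
    using \<gamma>(1) G(1) by (auto intro: borel_measurable_continuous_onI)
  have \<gamma>_int: "integrable lborel \<gamma>"
  proof -
    obtain R where R: "\<And>x. R < \<bar>x\<bar> \<Longrightarrow> \<gamma> x = 0"
      using compact_support_bound[OF \<gamma>(2)] by blast
    have "integrable lborel (\<lambda>x. indicator {-R..R} x *\<^sub>R \<gamma> x)"
      using borel_integrable_atLeastAtMost'[OF continuous_on_subset[OF \<gamma>(1)], of "-R" R]
      by (simp add: set_integrable_def)
    also have "(\<lambda>x. indicator {-R..R} x *\<^sub>R \<gamma> x) = \<gamma>"
    proof
      show "indicator {-R..R} x *\<^sub>R \<gamma> x = \<gamma> x" for x
        using R[of x] by (cases "R < \<bar>x\<bar>") (auto simp: indicator_def abs_le_iff)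
    qed
    finally show ?thesis .
  qed
  note f_int = integrable_scaled_density[OF t]
  let ?f = "\<lambda>y x. \<gamma> y * (scaled_density t (x - y) * G x)"
  have shift_int: "integrable lborel (\<lambda>x. scaled_density t (x - y))" for y
    using lborel_integrable_real_affine[OF f_int, of 1 "- y"] by (simp add: algebra_simps)
  have fG_int: "integrable lborel (\<lambda>x. scaled_density t (x - y) * G x)" for y
    by (rule Bochner_Integration.integrable_bound[OF integrable_mult_right[OF shift_int, of C]])
       (use C in \<open>auto simp: abs_mult mult.commute[of _ "\<bar>G _\<bar>"] intro!: mult_mono order_trans[OF C abs_ge_self]\<close>)
  have mass: "(LBINT x. \<bar>scaled_density t (x - y)\<bar>) = (LBINT x. \<bar>scaled_density t x\<bar>)" for y
    by (subst lborel_integral_real_affine[of 1 _ y]) simp_all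
  have int: "integrable (lborel \<Otimes>\<^sub>M lborel) (\<lambda>(y, x). ?f y x)"
  proof (rule lborel_pair.Fubini_integrable)
    show "integrable lborel (\<lambda>y. LBINT x. norm (case (y, x) of (y, x) \<Rightarrow> ?f y x))"
    proof (rule Bochner_Integration.integrable_bound[OF integrable_mult_left[OF \<gamma>_int, of "C * (LBINT x. \<bar>scaled_density t x\<bar>)"]])
      show "AE y in lborel. norm (LBINT x. norm (case (y, x) of (y, x) \<Rightarrow> ?f y x))
          \<le> norm (\<gamma> y * (C * (LBINT x. \<bar>scaled_density t x\<bar>)))"
      proof (rule AE_I2)
        fix y
        have "(LBINT x. \<bar>scaled_density t (x - y) * G x\<bar>) \<le> (LBINT x. C * \<bar>scaled_density t (x - y)\<bar>)"
          by (rule integral_mono[OF integrable_abs[OF fG_int] integrable_mult_right[OF integrable_abs[OF shift_int]]])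
             (use C in \<open>auto simp: abs_mult mult.commute[of C] intro!: mult_left_mono\<close>)
        also have "\<dots> = C * (LBINT x. \<bar>scaled_density t x\<bar>)" by (simp add: mass)
        finally have "\<bar>\<gamma> y\<bar> * (LBINT x. \<bar>scaled_density t (x - y) * G x\<bar>)
            \<le> \<bar>\<gamma> y\<bar> * (C * (LBINT x. \<bar>scaled_density t x\<bar>))"
          by (intro mult_left_mono) auto
        also have "\<dots> \<le> \<bar>\<gamma> y\<bar> * \<bar>C * (LBINT x. \<bar>scaled_density t x\<bar>)\<bar>"
          by (intro mult_left_mono) auto
        finally have "\<bar>\<gamma> y\<bar> * (LBINT x. \<bar>scaled_density t (x - y) * G x\<bar>)
            \<le> \<bar>\<gamma> y\<bar> * \<bar>C * (LBINT x. \<bar>scaled_density t x\<bar>)\<bar>" .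
        moreover have "0 \<le> (LBINT x. \<bar>scaled_density t (x - y) * G x\<bar>)"
          by (intro Bochner_Integration.integral_nonneg) auto
        moreover have "(LBINT x. \<bar>?f y x\<bar>) = \<bar>\<gamma> y\<bar> * (LBINT x. \<bar>scaled_density t (x - y) * G x\<bar>)"
          by (simp only: abs_mult[of "\<gamma> y"] integral_mult_right_zero)
        ultimately show "norm (LBINT x. norm (case (y, x) of (y, x) \<Rightarrow> ?f y x))
            \<le> norm (\<gamma> y * (C * (LBINT x. \<bar>scaled_density t x\<bar>)))"
          by (simp add: abs_mult[of "\<gamma> y"])
      qed
    qed measurable
    show "AE y in lborel. integrable lborel (\<lambda>x. case (y, x) of (y, x) \<Rightarrow> ?f y x)"
      using integrable_mult_right[OF fG_int] by simp
  qed measurable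
  have "(LBINT u. scaled_density t u * G (y + u)) = (LBINT x. scaled_density t (x - y) * G x)" for y
    by (subst lborel_integral_real_affine[of 1 _ "- y"]) simp_all
  then have "(LBINT y. \<gamma> y * (LBINT u. scaled_density t u * G (y + u))) = (LBINT y. LBINT x. ?f y x)"
    by simp
  also have "\<dots> = (LBINT x. LBINT y. ?f y x)"
    by (rule lborel_pair.Fubini_integral[OF int, symmetric])
  also have "\<dots> = (LBINT x. G x * rho \<gamma> t x)"
    by (simp add: rho_def convolution_def mult_ac flip: integral_mult_right_zero)
  finally show ?thesis .
qed

text \<open>
  The starting point may move with \<open>n\<close>, as it does along a Riemann sum: by uniform continuity of \<open>G\<close>
  the moving point can be replaced by its limit, up to a uniformly small error.
\<close>

lemma walk_law_shifted_limit:
  assumes m: "(\<lambda>n. real (m n) / real n) \<longlonglongrightarrow> t" and t: "t > 0"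
    and G: "continuous_on UNIV G" "compact_support G" and y: "y \<longlonglongrightarrow> y0"
  shows "(\<lambda>n. LINT k|walk_law (m n). G (y n + real_of_int k / real n))
    \<longlonglongrightarrow> (LBINT u. scaled_density t u * G (y0 + u) :: real)"
proof -
  obtain C where C: "\<And>x. \<bar>G x\<bar> \<le> C" using compact_support_imp_bounded[OF G] by blast
  let ?E = "\<lambda>n z. LINT k|walk_law (m n). G (z + real_of_int k / real n)"
  have int: "integrable (measure_pmf (walk_law (m n))) (\<lambda>k. G (z + real_of_int k / real n))" for n z
    using C by (intro measure_pmf.integrable_const_bound[of _ C]) auto
  have "(\<lambda>n. ?E n (y n) - ?E n y0) \<longlonglongrightarrow> 0"
  proof (rule LIMSEQ_I)
    fix e :: real assume e: "0 < e"
    then obtain d where d: "0 < d" "\<And>x z. dist z x < d \<Longrightarrow> dist (G z) (G x) < e / 2"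
      using compact_support_imp_uniformly_continuous[OF G] unfolding uniformly_continuous_on_def
      by (metis UNIV_I half_gt_zero)
    obtain n0 where n0: "\<And>n. n \<ge> n0 \<Longrightarrow> dist (y n) y0 < d"
      using y d(1) unfolding LIMSEQ_def by blast
    have "norm (?E n (y n) - ?E n y0 - 0) < e" if "n \<ge> n0" for n
    proof -
      have "\<bar>G (y n + real_of_int k / real n) - G (y0 + real_of_int k / real n)\<bar> \<le> e / 2" for k
        using d(2)[of "y n + real_of_int k / real n" "y0 + real_of_int k / real n"] n0[OF that]
        by (simp add: dist_real_def)
      then have "(LINT k|walk_law (m n). \<bar>G (y n + real_of_int k / real n) - G (y0 + real_of_int k / real n)\<bar>)
          \<le> (LINT k|walk_law (m n). e / 2)"
        using int by (intro integral_mono) auto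
      moreover have "\<bar>?E n (y n) - ?E n y0\<bar>
          \<le> (LINT k|walk_law (m n). \<bar>G (y n + real_of_int k / real n) - G (y0 + real_of_int k / real n)\<bar>)"
        unfolding Bochner_Integration.integral_diff[OF int int, symmetric] by (rule integral_abs_bound)
      ultimately show ?thesis using e by simp
    qed
    then show "\<exists>n0. \<forall>n\<ge>n0. norm (?E n (y n) - ?E n y0 - 0) < e" by blast
  qed
  moreover have "(\<lambda>n. ?E n y0) \<longlonglongrightarrow> (LBINT u. scaled_density t u * G (y0 + u))"
    by (rule walk_law_weak_limit[OF m t, where B = C])
       (auto intro!: continuous_on_compose2[OF G(1)] continuous_intros C)
  ultimately show ?thesis
    using tendsto_add by fastforce
qed

section \<open>Occupation numbers of the system of walks\<close>

lemma norm_site_ket: "norm (site k \<otimes> ket c) = 1"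
proof -
  have "coord (site k \<otimes> ket c) i = (if i = k then ket c else 0)" for i
    by (simp add: tensor.rep_eq site_def single.rep_eq vec_eq_iff)
  then have "(norm (site k \<otimes> ket c))\<^sup>2 = (\<Sum>\<^sub>\<infinity>i. if i = k then (norm (ket c))\<^sup>2 else 0)"
    unfolding norm_ell2_square by (intro infsum_cong) simp
  also have "\<dots> = (\<Sum>\<^sub>\<infinity>i\<in>{k}. (norm (ket c))\<^sup>2)"
    by (rule infsum_cong_neutral) auto
  also have "\<dots> = 1" by (cases c) (simp_all add: norm_coin_square ket_def axis_def)
  finally show ?thesis by (intro power2_eq_imp_eq[of _ 1]) auto
qed

text \<open>
  An exchange of finite sums: only the sites where some walk is observed contribute.
\<close>

lemma infsum_occupation:
  fixes g :: "int \<Rightarrow> real"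
  assumes F: "finite F" "{\<psi>. \<Phi> \<psi> \<noteq> 0} \<subseteq> F"
  shows "(\<Sum>\<^sub>\<infinity>k. g k * real (occupation \<Phi> x k)) = (\<Sum>\<psi>\<in>F. \<Sum>j=1..\<Phi> \<psi>. g (x \<psi> j))"
proof -
  define K where "K = (\<Union>\<psi>\<in>F. x \<psi> ` {1..\<Phi> \<psi>})"
  have K: "finite K" using F(1) by (simp add: K_def)
  have occ: "real (occupation \<Phi> x k) = (\<Sum>\<psi>\<in>F. \<Sum>j=1..\<Phi> \<psi>. of_bool (x \<psi> j = k))" for k
  proof -
    have "occupation \<Phi> x k = (\<Sum>\<psi>\<in>F. \<Sum>j=1..\<Phi> \<psi>. of_bool (x \<psi> j = k))"
      unfolding occupation_def using F by (intro sum.mono_neutral_left) auto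
    then show ?thesis by (simp only: of_nat_sum of_nat_of_bool)
  qed
  have "(\<Sum>\<^sub>\<infinity>k. g k * real (occupation \<Phi> x k)) = (\<Sum>\<^sub>\<infinity>k\<in>K. g k * real (occupation \<Phi> x k))"
  proof (rule infsum_cong_neutral)
    fix k assume "k \<in> UNIV - K"
    then have "real (occupation \<Phi> x k) = 0"
      unfolding occ by (intro sum.neutral ballI) (auto simp: K_def)
    then show "g k * real (occupation \<Phi> x k) = 0" by simp
  qed auto
  also have "\<dots> = (\<Sum>k\<in>K. \<Sum>\<psi>\<in>F. \<Sum>j=1..\<Phi> \<psi>. g k * of_bool (x \<psi> j = k))"
    unfolding infsum_finite[OF K] occ sum_distrib_left ..
  also have "\<dots> = (\<Sum>\<psi>\<in>F. \<Sum>k\<in>K. \<Sum>j=1..\<Phi> \<psi>. g k * of_bool (x \<psi> j = k))"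
    by (rule sum.swap)
  also have "\<dots> = (\<Sum>\<psi>\<in>F. \<Sum>j=1..\<Phi> \<psi>. \<Sum>k\<in>K. g k * of_bool (x \<psi> j = k))"
    by (intro sum.cong refl sum.swap)
  also have "\<dots> = (\<Sum>\<psi>\<in>F. \<Sum>j=1..\<Phi> \<psi>. g (x \<psi> j))"
  proof (intro sum.cong refl)
    fix \<psi> j assume "\<psi> \<in> F" "j \<in> {1..\<Phi> \<psi>}"
    then have "x \<psi> j \<in> K" unfolding K_def by blast
    have "(\<Sum>k\<in>K. g k * of_bool (x \<psi> j = k)) = (\<Sum>k\<in>K. if k = x \<psi> j then g k else 0)"
      by (intro sum.cong) auto
    then show "(\<Sum>k\<in>K. g k * of_bool (x \<psi> j = k)) = g (x \<psi> j)"
      using K \<open>x \<psi> j \<in> K\<close> by (simp add: sum.delta)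
  qed
  finally show ?thesis .
qed

text \<open>
  The points outside \<open>S\<close> have probability \<open>0\<close> each and are countably many, so the values lie in \<open>S\<close>
  almost surely.
\<close>

lemma (in prob_space) expectation_finitely_supported:
  fixes Y :: "'a \<Rightarrow> 'b::countable" and g :: "'b \<Rightarrow> real"
  assumes [measurable]: "Y \<in> measurable M (count_space UNIV)" and S: "finite S"
    and p: "\<And>l. prob {\<omega>\<in>space M. Y \<omega> = l} = p l" and out: "\<And>l. l \<notin> S \<Longrightarrow> p l = 0"
  shows "expectation (\<lambda>\<omega>. g (Y \<omega>)) = (\<Sum>l\<in>S. p l * g l)"
proof -
  have "AE \<omega> in M. Y \<omega> \<noteq> l" if "l \<notin> S" for l
    using out[OF that] p[of l] by (subst AE_iff_measurable[OF _ refl]) (auto simp: emeasure_eq_measure)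
  then have "AE \<omega> in M. \<forall>l. l \<notin> S \<longrightarrow> Y \<omega> \<noteq> l" by (simp add: AE_all_countable)
  then have "AE \<omega> in M. g (Y \<omega>) = (\<Sum>l\<in>S. g l * indicator {\<omega>\<in>space M. Y \<omega> = l} \<omega>)"
  proof (rule AE_mp[OF _ AE_I2], intro impI)
    fix \<omega> assume w: "\<omega> \<in> space M" and "\<forall>l. l \<notin> S \<longrightarrow> Y \<omega> \<noteq> l"
    then have "Y \<omega> \<in> S" by blast
    have "(\<Sum>l\<in>S. g l * indicator {\<omega>\<in>space M. Y \<omega> = l} \<omega>) = (\<Sum>l\<in>S. if l = Y \<omega> then g l else 0)"
      using w by (intro sum.cong) (auto simp: indicator_def)
    then show "g (Y \<omega>) = (\<Sum>l\<in>S. g l * indicator {\<omega>\<in>space M. Y \<omega> = l} \<omega>)"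
      using S \<open>Y \<omega> \<in> S\<close> by (simp add: sum.delta)
  qed
  then have "expectation (\<lambda>\<omega>. g (Y \<omega>)) = expectation (\<lambda>\<omega>. \<Sum>l\<in>S. g l * indicator {\<omega>\<in>space M. Y \<omega> = l} \<omega>)"
    by (intro integral_cong_AE) measurable
  also have "\<dots> = (\<Sum>l\<in>S. g l * prob {\<omega>\<in>space M. Y \<omega> = l})"
    by (subst Bochner_Integration.integral_sum) (auto simp: emeasure_eq_measure)
  finally show ?thesis by (simp add: p mult.commute)
qed

text \<open>
  The occupation sum agrees with a measurable function only almost everywhere, as it involves
  uncountably many coordinates of the configuration.  Passing to the completion repairs this.
\<close>

lemma AE_eq_completion:
  fixes f f' :: "'a \<Rightarrow> real"
  assumes f: "f \<in> borel_measurable M" and eq: "AE \<omega> in M. f' \<omega> = f \<omega>"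
  shows "f' \<in> borel_measurable (completion M)"
    and "A \<in> sets borel \<Longrightarrow> measure (completion M) {\<omega>\<in>space M. f' \<omega> \<in> A} = measure M {\<omega>\<in>space M. f \<omega> \<in> A}"
proof -
  have eq': "AE \<omega> in completion M. f' \<omega> = f \<omega>" using eq by (rule AE_completion)
  have f_set: "{\<omega>\<in>space M. f \<omega> \<in> A} \<in> sets M" if "A \<in> sets borel" for A
    using measurable_sets[OF f that] by (simp add: vimage_def Int_def conj_commute)
  have f'_set: "{\<omega>\<in>space M. f' \<omega> \<in> A} \<in> sets (completion M)" if "A \<in> sets borel" for A
    by (rule completion.in_sets_AE[OF _ sets_completionI_sets[OF f_set[OF that]]])
       (use eq' in \<open>auto elim!: eventually_mono\<close>)
  show "f' \<in> borel_measurable (completion M)"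
    using f'_set by (auto intro!: measurableI simp: vimage_def Int_def conj_commute)
  show "measure (completion M) {\<omega>\<in>space M. f' \<omega> \<in> A} = measure M {\<omega>\<in>space M. f \<omega> \<in> A}" if A: "A \<in> sets borel"
  proof -
    have "measure (completion M) {\<omega>\<in>space M. f' \<omega> \<in> A} = measure (completion M) {\<omega>\<in>space M. f \<omega> \<in> A}"
      by (rule measure_eq_AE) (use eq' f'_set[OF A] f_set[OF A] in \<open>auto elim!: eventually_mono\<close>)
    then show ?thesis using f_set[OF A] by simp
  qed
qed

text \<open>
  The product form of \<open>initial_measure\<close> says that the numbers of walks in the different states are
  independent Poisson variables.
\<close>

lemma (in prob_space) initial_configuration_marginals:
  assumes init: "initial_configuration M \<gamma> n \<Psi>"
  shows "indep_vars (\<lambda>_. count_space UNIV) (\<lambda>\<psi> \<omega>. \<Psi> \<omega> \<psi>) UNIV"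
    and "distr M (count_space UNIV) (\<lambda>\<omega>. \<Psi> \<omega> \<psi>) = measure_pmf (poisson_law (initial_rate \<gamma> n \<psi>))"
proof -
  let ?P = "\<Pi>\<^sub>M \<psi>\<in>UNIV. count_space UNIV"
  have meas [measurable]: "\<Psi> \<in> measurable M ?P" and law: "distr M ?P \<Psi> = initial_measure \<gamma> n"
    using init by (auto simp: initial_configuration_def)
  have comp: "(\<lambda>\<omega>. \<omega> \<psi>) \<in> measurable ?P (count_space UNIV)" for \<psi> :: state
    by (rule measurable_component_singleton) simp
  have rv: "(\<lambda>\<omega>. \<Psi> \<omega> \<psi>) \<in> measurable M (count_space UNIV)" for \<psi>
    by (rule measurable_compose[OF meas comp])
  show marg: "distr M (count_space UNIV) (\<lambda>\<omega>. \<Psi> \<omega> \<psi>) = measure_pmf (poisson_law (initial_rate \<gamma> n \<psi>))" for \<psi>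
  proof -
    have "distr M (count_space UNIV) (\<lambda>\<omega>. \<Psi> \<omega> \<psi>) = distr (initial_measure \<gamma> n) (count_space UNIV) (\<lambda>\<omega>. \<omega> \<psi>)"
      unfolding law[symmetric] by (subst distr_distr[OF comp meas]) (simp add: comp_def)
    also have "\<dots> = distr (initial_measure \<gamma> n) (measure_pmf (poisson_law (initial_rate \<gamma> n \<psi>))) (\<lambda>\<omega>. \<omega> \<psi>)"
      by (rule distr_cong) auto
    also have "\<dots> = measure_pmf (poisson_law (initial_rate \<gamma> n \<psi>))"
      unfolding initial_measure_def
      by (rule distr_PiM_component) (auto intro: measure_pmf.prob_space_axioms)
    finally show ?thesis .
  qed
  have "distr M ?P (\<lambda>\<omega>. \<lambda>\<psi>\<in>UNIV. \<Psi> \<omega> \<psi>) = (\<Pi>\<^sub>M \<psi>\<in>UNIV. distr M (count_space UNIV) (\<lambda>\<omega>. \<Psi> \<omega> \<psi>))"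
    unfolding marg using law by (simp add: initial_measure_def restrict_UNIV)
  then show "indep_vars (\<lambda>_. count_space UNIV) (\<lambda>\<psi> \<omega>. \<Psi> \<omega> \<psi>) UNIV"
    using rv by (subst indep_vars_iff_distr_eq_PiM) auto
qed

text \<open>
  The basis states over \<open>lattice_points R n\<close>.  They carry all walks almost surely when \<open>\<gamma>\<close> vanishes
  outside \<open>[-R, R]\<close>.
\<close>

definition initial_states :: "real \<Rightarrow> nat \<Rightarrow> state set" where
  "initial_states R n = (\<lambda>(k, c). site k \<otimes> ket c) ` (lattice_points R n \<times> UNIV)"

lemma sum_initial_states:
  fixes h :: "state \<Rightarrow> real"
  shows "(\<Sum>\<psi>\<in>initial_states R n. h \<psi>) = (\<Sum>k\<in>lattice_points R n. \<Sum>c\<in>UNIV. h (site k \<otimes> ket c))"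
proof -
  have "inj_on (\<lambda>(k, c). site k \<otimes> ket c) (lattice_points R n \<times> UNIV)"
    by (auto simp: inj_on_def site_tensor_ket_inject)
  then show ?thesis
    unfolding initial_states_def by (subst sum.reindex) (simp_all add: sum.cartesian_product split_def)
qed

lemma finite_initial_states: "finite (initial_states R n)"
  unfolding initial_states_def using finite_lattice_points by simp

text \<open>
  \<open>n\<close> times the mean of the empirical sum at time \<open>m\<close>.  The two coin states over a site are merged:
  their rates \<open>\<gamma>/2\<close> combine with the two displacement laws to \<open>\<gamma>\<close> times \<open>walk_law m\<close>.
\<close>

definition mean_occupation :: "(real \<Rightarrow> real) \<Rightarrow> (real \<Rightarrow> real) \<Rightarrow> real \<Rightarrow> nat \<Rightarrow> nat \<Rightarrow> real" where
  "mean_occupation \<gamma> G R n m = (\<Sum>k\<in>lattice_points R n. \<gamma> (real_of_int k / real n)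
     * (LINT j|walk_law m. G (real_of_int k / real n + real_of_int j / real n)))"

text \<open>
  Almost surely only the finitely many states in \<open>initial_states R n\<close> are occupied, and on that event
  the occupation sum is a finite sum of Poisson numbers of marks, to which
  \<open>poisson_marked_sum_deviation\<close> applies.  The null set is a union over the countably many basis
  states of rate \<open>0\<close>, together with the common null set for all other states.
\<close>

lemma (in prob_space) empirical_sum_deviation:
  fixes X :: "state \<Rightarrow> nat \<Rightarrow> 'a \<Rightarrow> int"
  assumes n: "1 \<le> n" and \<gamma>: "\<And>x. 0 \<le> \<gamma> x" "\<And>x. R < \<bar>x\<bar> \<Longrightarrow> \<gamma> x = 0"
    and G: "\<And>x. \<bar>G x\<bar> \<le> C"
    and init: "initial_configuration M \<gamma> n \<Psi>" and obs: "observed_positions M m \<Psi> X"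
    and \<epsilon>: "0 < \<epsilon>"
  defines "Z \<equiv> (\<lambda>\<omega>. \<Sum>\<psi>\<in>initial_states R n. \<Sum>j=1..\<Psi> \<omega> \<psi>. G (real_of_int (X \<psi> j \<omega>) / real n))"
  shows "Z \<in> borel_measurable M"
    and "AE \<omega> in M. (\<Sum>\<^sub>\<infinity>k. G (real_of_int k / real n) * real (occupation (\<Psi> \<omega>) (\<lambda>\<psi> j. X \<psi> j \<omega>) k)) = Z \<omega>"
    and "prob {\<omega>\<in>space M. \<epsilon> < \<bar>Z \<omega> - mean_occupation \<gamma> G R n m\<bar>}
      \<le> 8 * C\<^sup>2 * (\<Sum>k\<in>lattice_points R n. \<gamma> (real_of_int k / real n)) / \<epsilon>\<^sup>2"
proof -
  let ?F = "initial_states R n" and ?r = "initial_rate \<gamma> n" and ?J = "{\<psi> :: state. norm \<psi> = 1}"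
  let ?g = "\<lambda>l. G (real_of_int l / real n)"
  have X_indep: "indep_vars (\<lambda>_. count_space UNIV) (\<lambda>(\<psi>, j). X \<psi> j) (?J \<times> {1..})"
    and X_law: "\<And>\<psi> j l. norm \<psi> = 1 \<Longrightarrow> 1 \<le> j \<Longrightarrow> prob {\<omega>\<in>space M. X \<psi> j \<omega> = l} = detection_prob m \<psi> l"
    and NX: "indep_set (sets (vimage_algebra (space M) \<Psi> (\<Pi>\<^sub>M i\<in>UNIV. count_space UNIV)))
      (sets (vimage_algebra (space M) (\<lambda>\<omega>. restrict (\<lambda>(i, j). X i j \<omega>) (?J \<times> {1..}))
        (\<Pi>\<^sub>M p\<in>?J \<times> {1..}. count_space UNIV)))"
    using obs by (auto simp: observed_positions_def Let_def)
  note N_indep = initial_configuration_marginals(1)[OF init]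
  note N_law = initial_configuration_marginals(2)[OF init]
  have FJ: "?F \<subseteq> ?J" by (auto simp: initial_states_def norm_site_ket)
  have r: "0 \<le> ?r \<psi>" for \<psi> using \<gamma>(1) by (simp add: initial_rate_def)
  define \<mu> where "\<mu> \<psi> = expectation (\<lambda>\<omega>. ?g (X \<psi> 1 \<omega>))" for \<psi>
  have mean: "expectation (\<lambda>\<omega>. ?g (X (site k \<otimes> ket c) j \<omega>))
      = (\<Sum>l\<in>{-int m..int m}. ((cmod (amplitude m c Plus l))\<^sup>2 + (cmod (amplitude m c Minus l))\<^sup>2) * ?g (k + l))"
    if "1 \<le> j" for k c j
  proof -
    have "X (site k \<otimes> ket c) j \<in> measurable M (count_space UNIV)"
      using X_indep that norm_site_ket[of k c] by (auto simp: indep_vars_def)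
    then have "expectation (\<lambda>\<omega>. ?g (X (site k \<otimes> ket c) j \<omega>))
      = (\<Sum>l\<in>{k - int m..k + int m}. detection_prob m (site k \<otimes> ket c) l * ?g l)"
      by (rule expectation_finitely_supported)
         (auto simp: X_law[OF norm_site_ket that] detection_prob_site intro!: amplitude_eq_0)
    also have "\<dots> = (\<Sum>l\<in>{-int m..int m}. ((cmod (amplitude m c Plus l))\<^sup>2 + (cmod (amplitude m c Minus l))\<^sup>2) * ?g (k + l))"
      by (rule sum.reindex_bij_witness[of _ "\<lambda>l. k + l" "\<lambda>l. l - k"]) (auto simp: detection_prob_site)
    finally show ?thesis .
  qed
  have mean': "expectation (\<lambda>\<omega>. ?g (X \<psi> j \<omega>)) = \<mu> \<psi>" if "\<psi> \<in> ?F" "1 \<le> j" for \<psi> j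
    using that mean[of j] mean[of 1] by (auto simp: \<mu>_def initial_states_def)
  have shifted: "?g (k + l) = G (real_of_int k / real n + real_of_int l / real n)" for k l
    by (simp add: add_divide_distrib)
  have halves: "1 / 2 * x * ((p + q) * y) + 1 / 2 * x * ((p' + q') * y) = x * ((p + q + (p' + q')) / 2 * y)"
    for x y p q p' q' :: real by (simp add: field_simps)
  have total: "(\<Sum>\<psi>\<in>?F. ?r \<psi> * \<mu> \<psi>) = mean_occupation \<gamma> G R n m"
    unfolding sum_initial_states mean_occupation_def
  proof (intro sum.cong refl)
    fix k
    show "(\<Sum>c\<in>UNIV. ?r (site k \<otimes> ket c) * \<mu> (site k \<otimes> ket c)) = \<gamma> (real_of_int k / real n)
        * (LINT j|walk_law m. G (real_of_int k / real n + real_of_int j / real n))"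
      unfolding expectation_walk_law \<mu>_def mean[OF order_refl] initial_rate_basis sum_coin mean_detection_def
        sum_distrib_left sum.distrib[symmetric] shifted
      by (intro sum.cong refl) (simp only: real_scaleR_def halves)
  qed
  have rates: "(\<Sum>\<psi>\<in>?F. ?r \<psi>) = (\<Sum>k\<in>lattice_points R n. \<gamma> (real_of_int k / real n))"
    unfolding sum_initial_states sum_coin initial_rate_basis by simp
  note dev = poisson_marked_sum_deviation[OF finite_initial_states FJ N_indep N_law r X_indep NX, of ?g C \<mu> \<epsilon>,
      OF G mean' \<epsilon>]
  show "Z \<in> borel_measurable M" unfolding Z_def by (rule dev(1))
  show "prob {\<omega>\<in>space M. \<epsilon> < \<bar>Z \<omega> - mean_occupation \<gamma> G R n m\<bar>}
      \<le> 8 * C\<^sup>2 * (\<Sum>k\<in>lattice_points R n. \<gamma> (real_of_int k / real n)) / \<epsilon>\<^sup>2"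
    using dev(2) unfolding total rates Z_def .
  have "AE \<omega> in M. \<Psi> \<omega> (site k \<otimes> ket c) = 0" if "k \<notin> lattice_points R n" for k c
  proof -
    have "R < \<bar>real_of_int k / real n\<bar>"
      using that n by (simp add: lattice_points_def field_simps abs_divide)
    then have "AE x in distr M (count_space UNIV) (\<lambda>\<omega>. \<Psi> \<omega> (site k \<otimes> ket c)). x = 0"
      unfolding N_law initial_rate_basis by (simp add: \<gamma>(2) poisson_law_def AE_measure_pmf_iff)
    moreover have "(\<lambda>\<omega>. \<Psi> \<omega> (site k \<otimes> ket c)) \<in> measurable M (count_space UNIV)"
      using N_indep by (auto simp: indep_vars_def)
    ultimately show ?thesis by (subst (asm) AE_distr_iff) auto
  qed
  then have "AE \<omega> in M. \<forall>k. k \<notin> lattice_points R n \<longrightarrow> (\<forall>c\<in>UNIV. \<Psi> \<omega> (site k \<otimes> ket c) = 0)"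
    unfolding AE_all_countable by (intro allI AE_impI AE_finite_allI) auto
  moreover have "AE \<omega> in M. \<forall>\<psi>. \<psi> \<notin> basis_states \<longrightarrow> \<Psi> \<omega> \<psi> = 0"
    using init by (simp add: initial_configuration_def)
  ultimately show "AE \<omega> in M. (\<Sum>\<^sub>\<infinity>k. ?g k * real (occupation (\<Psi> \<omega>) (\<lambda>\<psi> j. X \<psi> j \<omega>) k)) = Z \<omega>"
  proof eventually_elim
    case (elim \<omega>)
    have "{\<psi>. \<Psi> \<omega> \<psi> \<noteq> 0} \<subseteq> ?F"
    proof
      fix \<psi> assume "\<psi> \<in> {\<psi>. \<Psi> \<omega> \<psi> \<noteq> 0}"
      then obtain k c where "\<psi> = site k \<otimes> ket c" "k \<in> lattice_points R n"
        using elim by (fastforce simp: basis_states_def)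
      then show "\<psi> \<in> ?F" by (auto simp: initial_states_def)
    qed
    then show ?case
      unfolding Z_def by (rule infsum_occupation[OF finite_initial_states])
  qed
qed

text \<open>
  A Riemann sum whose second factor converges along the sample points by \<open>walk_law_shifted_limit\<close>.
\<close>

lemma mean_occupation_limit:
  assumes \<gamma>: "continuous_on UNIV \<gamma>" "compact_support \<gamma>" "\<And>x. R < \<bar>x\<bar> \<Longrightarrow> \<gamma> x = 0"
    and G: "continuous_on UNIV G" "compact_support G"
    and t: "t > 0" and m: "(\<lambda>n. real (m n) / real n) \<longlonglongrightarrow> t"
  shows "(\<lambda>n. 1 / real n * mean_occupation \<gamma> G R n (m n)) \<longlonglongrightarrow> (LBINT x. G x * rho \<gamma> t x)"
proof -
  obtain C where C: "0 < C" "\<And>x. \<bar>G x\<bar> \<le> C" using compact_support_imp_bounded[OF G] by blast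
  obtain B where B: "0 < B" "\<And>x. \<bar>\<gamma> x\<bar> \<le> B" using compact_support_imp_bounded[OF \<gamma>(1,2)] by blast
  let ?E = "\<lambda>n x. LINT j|walk_law (m n). G (x + real_of_int j / real n)"
  have E: "\<bar>?E n x\<bar> \<le> C" for n x
  proof -
    have "\<bar>?E n x\<bar> \<le> (LINT j|walk_law (m n). \<bar>G (x + real_of_int j / real n)\<bar>)"
      by (rule integral_abs_bound)
    also have "\<dots> \<le> (LINT j|walk_law (m n). C)"
      using C by (intro integral_mono measure_pmf.integrable_const_bound[of _ C]) auto
    finally show ?thesis by simp
  qed
  have "(\<lambda>n. 1 / real n * (\<Sum>k\<in>lattice_points R n. \<gamma> (real_of_int k / real n) * ?E n (real_of_int k / real n)))
      \<longlonglongrightarrow> (LBINT y. \<gamma> y * (LBINT u. scaled_density t u * G (y + u)))"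
  proof (rule riemann_sum_tendsto)
    show "\<gamma> x * ?E n x = 0" if "R < \<bar>x\<bar>" for n x using \<gamma>(3)[OF that] by simp
    show "\<bar>\<gamma> x * ?E n x\<bar> \<le> B * C" for n x
      unfolding abs_mult using B C E by (intro mult_mono) auto
    fix y
    have "isCont \<gamma> y" using \<gamma>(1) by (simp add: continuous_on_eq_continuous_at)
    then have "(\<lambda>n. \<gamma> (real_of_int \<lfloor>real n * y\<rfloor> / real n)) \<longlonglongrightarrow> \<gamma> y"
      using floor_div_tendsto by (rule isCont_tendsto_compose)
    then show "(\<lambda>n. \<gamma> (real_of_int \<lfloor>real n * y\<rfloor> / real n) * ?E n (real_of_int \<lfloor>real n * y\<rfloor> / real n))
        \<longlonglongrightarrow> \<gamma> y * (LBINT u. scaled_density t u * G (y + u))"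
      by (rule tendsto_mult) (rule walk_law_shifted_limit[OF m t G floor_div_tendsto])
  qed
  then show ?thesis
    unfolding mean_occupation_def integral_rho[OF t \<gamma>(1,2) G] .
qed

theorem theorem2p1:
  fixes \<gamma> G :: "real \<Rightarrow> real"
    and t :: real
    and M :: "nat \<Rightarrow> 'w measure"
    and \<Psi> :: "nat \<Rightarrow> 'w \<Rightarrow> config"
    and X :: "nat \<Rightarrow> nat \<Rightarrow> state \<Rightarrow> nat \<Rightarrow> 'w \<Rightarrow> int"
  assumes "continuous_on UNIV \<gamma>" and "\<And>x. 0 \<le> \<gamma> x" and "compact_support \<gamma>"
    and "\<And>n. n \<ge> 1 \<Longrightarrow> prob_space (M n)"
    and "\<And>n. n \<ge> 1 \<Longrightarrow> initial_configuration (M n) \<gamma> n (\<Psi> n)"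
    and "\<And>n m. n \<ge> 1 \<Longrightarrow> observed_positions (M n) m (\<Psi> n) (X n m)"
    and "t > 0"
    and "continuous_on UNIV G" and "compact_support G"
  shows "converges_in_probability M
    (\<lambda>n \<omega>. 1 / real n * (\<Sum>\<^sub>\<infinity>k. G (real_of_int k / real n)
       * real (occupation (\<Psi> n \<omega>) (\<lambda>\<psi> j. X n (nat \<lfloor>t * real n\<rfloor>) \<psi> j \<omega>) k)))
    (LBINT x. G x * rho \<gamma> t x)"
proof -
  define m where "m n = nat \<lfloor>t * real n\<rfloor>" for n
  define L where "L = (LBINT x. G x * rho \<gamma> t x)"
  obtain R where R: "\<And>x. R < \<bar>x\<bar> \<Longrightarrow> \<gamma> x = 0" using compact_support_bound[OF assms(3)] by blast
  obtain C where C: "\<And>x. \<bar>G x\<bar> \<le> C" using compact_support_imp_bounded[OF assms(8,9)] by blast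
  obtain B where B: "\<And>x. \<bar>\<gamma> x\<bar> \<le> B" using compact_support_imp_bounded[OF assms(1,3)] by blast
  define S where "S n \<omega> = (\<Sum>\<psi>\<in>initial_states R n. \<Sum>j=1..\<Psi> n \<omega> \<psi>. G (real_of_int (X n (m n) \<psi> j \<omega>) / real n))" for n \<omega>
  define Z where "Z n \<omega> = 1 / real n * (\<Sum>\<^sub>\<infinity>k. G (real_of_int k / real n)
       * real (occupation (\<Psi> n \<omega>) (\<lambda>\<psi> j. X n (m n) \<psi> j \<omega>) k))" for n \<omega>
  define a where "a n = 1 / real n * mean_occupation \<gamma> G R n (m n)" for n
  define \<Lambda> where "\<Lambda> n = 1 / real n * (\<Sum>k\<in>lattice_points R n. \<gamma> (real_of_int k / real n))" for n
  have "m n = nat \<lfloor>real n * t\<rfloor>" for n by (simp add: m_def mult.commute)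
  then have m: "(\<lambda>n. real (m n) / real n) \<longlonglongrightarrow> t"
    using floor_div_tendsto[of t] assms(7) by simp
  have a_lim: "a \<longlonglongrightarrow> L"
    unfolding a_def L_def by (rule mean_occupation_limit[OF assms(1,3) R assms(8,9,7) m])
  have "\<Lambda> \<longlonglongrightarrow> (LBINT y. \<gamma> y)"
    unfolding \<Lambda>_def
    by (rule riemann_sum_tendsto[of R "\<lambda>_. \<gamma>" B])
       (use R B assms(1) in \<open>auto simp: continuous_on_eq_continuous_at intro: isCont_tendsto_compose[OF _ floor_div_tendsto]\<close>)
  then have \<Lambda>_lim: "(\<lambda>n. (1 / real n) * \<Lambda> n) \<longlonglongrightarrow> 0"
    using tendsto_mult[OF lim_1_over_n] by fastforce
  have S_meas: "S n \<in> borel_measurable (M n)"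
    and S_AE: "AE \<omega> in M n. Z n \<omega> = 1 / real n * S n \<omega>"
    and S_dev: "\<And>\<epsilon>. 0 < \<epsilon> \<Longrightarrow> measure (M n) {\<omega>\<in>space (M n). \<epsilon> < \<bar>S n \<omega> - mean_occupation \<gamma> G R n (m n)\<bar>}
      \<le> 8 * C\<^sup>2 * (\<Sum>k\<in>lattice_points R n. \<gamma> (real_of_int k / real n)) / \<epsilon>\<^sup>2"
    if n: "1 \<le> n" for n
  proof -
    interpret prob_space "M n" using assms(4)[OF n] .
    note dev = empirical_sum_deviation[where R = R and C = C and \<gamma> = \<gamma> and G = G,
        OF n assms(2) _ C assms(5)[OF n] assms(6)[OF n, of "m n"]]
    show "S n \<in> borel_measurable (M n)" unfolding S_def[abs_def] by (rule dev(1)[where \<epsilon> = 1]) (simp_all add: R)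
    show "AE \<omega> in M n. Z n \<omega> = 1 / real n * S n \<omega>"
      using dev(2)[where \<epsilon> = 1] R unfolding Z_def S_def by (auto elim!: eventually_mono)
    show "prob {\<omega>\<in>space (M n). \<epsilon> < \<bar>S n \<omega> - mean_occupation \<gamma> G R n (m n)\<bar>}
      \<le> 8 * C\<^sup>2 * (\<Sum>k\<in>lattice_points R n. \<gamma> (real_of_int k / real n)) / \<epsilon>\<^sup>2" if "0 < \<epsilon>" for \<epsilon>
      unfolding S_def by (rule dev(3)) (simp_all add: R that)
  qed
  have S_meas': "(\<lambda>\<omega>. 1 / real n * S n \<omega>) \<in> borel_measurable (M n)" if "1 \<le> n" for n
    using S_meas[OF that] by measurable
  have "\<forall>\<^sub>F n in sequentially. Z n \<in> borel_measurable (completion (M n))"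
    by (rule eventually_sequentiallyI[of 1]) (rule AE_eq_completion(1)[OF S_meas' S_AE])
  moreover have "(\<lambda>n. measure (completion (M n)) {\<omega>\<in>space (M n). \<bar>Z n \<omega> - L\<bar> > \<epsilon>}) \<longlonglongrightarrow> 0" if \<epsilon>: "0 < \<epsilon>" for \<epsilon>
  proof (rule Lim_null_comparison)
    have near: "\<forall>\<^sub>F n in sequentially. dist (a n) L < \<epsilon> / 2"
      using a_lim \<epsilon> by (intro tendstoD) auto
    \<comment> \<open>Once the scaled mean is within \<open>\<epsilon>/2\<close> of the limit, a deviation above \<open>\<epsilon>\<close> of the scaled sum forces a
        deviation above \<open>\<epsilon> n / 2\<close> of the sum itself from its mean.\<close>
    show "\<forall>\<^sub>F n in sequentially. norm (measure (completion (M n)) {\<omega>\<in>space (M n). \<bar>Z n \<omega> - L\<bar> > \<epsilon>})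
        \<le> 32 * C\<^sup>2 / \<epsilon>\<^sup>2 * ((1 / real n) * \<Lambda> n)"
      using near eventually_ge_at_top[of 1]
    proof eventually_elim
      case (elim n)
      interpret prob_space "M n" using assms(4)[OF elim(2)] .
      have n: "0 < real n" using elim(2) by simp
      have [measurable]: "S n \<in> borel_measurable (M n)" by (rule S_meas[OF elim(2)])
      have A: "{z. \<bar>z - L\<bar> > \<epsilon>} \<in> sets borel" by measurable
      have "measure (completion (M n)) {\<omega>\<in>space (M n). \<bar>Z n \<omega> - L\<bar> > \<epsilon>}
          = prob {\<omega>\<in>space (M n). \<bar>1 / real n * S n \<omega> - L\<bar> > \<epsilon>}"
        using AE_eq_completion(2)[OF S_meas' S_AE A] elim(2) by simp
      also have "\<dots> \<le> prob {\<omega>\<in>space (M n). \<epsilon> / 2 * real n < \<bar>S n \<omega> - mean_occupation \<gamma> G R n (m n)\<bar>}"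
      proof (rule finite_measure_mono)
        show "{\<omega>\<in>space (M n). \<bar>1 / real n * S n \<omega> - L\<bar> > \<epsilon>}
            \<subseteq> {\<omega>\<in>space (M n). \<epsilon> / 2 * real n < \<bar>S n \<omega> - mean_occupation \<gamma> G R n (m n)\<bar>}"
        proof clarify
          fix \<omega> assume "\<epsilon> < \<bar>1 / real n * S n \<omega> - L\<bar>"
          then have "\<epsilon> / 2 < \<bar>1 / real n * S n \<omega> - a n\<bar>"
            using elim(1) unfolding dist_real_def by linarith
          also have "1 / real n * S n \<omega> - a n = (S n \<omega> - mean_occupation \<gamma> G R n (m n)) / real n"
            by (simp add: a_def diff_divide_distrib)
          finally show "\<epsilon> / 2 * real n < \<bar>S n \<omega> - mean_occupation \<gamma> G R n (m n)\<bar>"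
            using n by (simp add: abs_divide less_divide_eq)
        qed
      qed measurable
      also have "\<dots> \<le> 8 * C\<^sup>2 * (\<Sum>k\<in>lattice_points R n. \<gamma> (real_of_int k / real n)) / (\<epsilon> / 2 * real n)\<^sup>2"
        using \<epsilon> n by (intro S_dev elim(2)) auto
      also have "\<dots> = 32 * C\<^sup>2 / \<epsilon>\<^sup>2 * ((1 / real n) * \<Lambda> n)"
        using n \<epsilon> by (simp add: \<Lambda>_def power2_eq_square field_simps)
      finally show ?case by simp
    qed
    show "(\<lambda>n. 32 * C\<^sup>2 / \<epsilon>\<^sup>2 * ((1 / real n) * \<Lambda> n)) \<longlonglongrightarrow> 0"
      using tendsto_mult_left[OF \<Lambda>_lim, of "32 * C\<^sup>2 / \<epsilon>\<^sup>2"] by simp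
  qed
  ultimately show ?thesis
    unfolding converges_in_probability_def Z_def L_def m_def by blast
qed

end
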